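(* Let $n\in\mathbb{N}=\{1,2,3,\dots\}$, $\vartheta_n:=\frac{\pi}{2n}$ and $\Theta_n:=\sin\vartheta_n$. For every $k\in\{0,\dots,n-1\}$ with $\gcd(k,n)=1$, the set $\gamma_{n,k}\subset\mathbb{S}^2$ (obtained, as defined in the context, from the stack of $n$ latitudinal circles $C_0,\dots,C_{n-1}$ by rotating the eastern hemisphere against the fixed western hemisphere by the angle $2k\vartheta_n$) is a piecewise circular closed curve that solves Problem (P) for the prescribed minimal thickness $\Theta_n$: it is a closed curve on $\mathbb{S}^2$ with $\triangle[\gamma_{n,k}]\ge\Theta_n$, and its length is maximal among all closed curves $\gamma:\mathbb{S}^1\to\mathbb{S}^2$ with $\triangle[\gamma]\ge\Theta_n$. In this way one obtains $\varphi(n)$ explicit solutions of Problem (P) for the prescribed minimal thickness $\Theta_n$, one for each such $k$.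
   Context: $\mathbb{S}^2=\{x\in\mathbb{R}^3:|x|=1\}$, with intrinsic (geodesic) distance $\mathrm{dist}_{\mathbb{S}^2}$, and $\mathbb{S}^1\cong\mathbb{R}/(2\pi\mathbb{Z})$. All curves are assumed to be simple, of positive length, and continuously differentiable (regular, e.g. in arclength parametrization); a closed curve is identified with its image when convenient. Thickness: for a curve $\gamma\subset\mathbb{R}^3$, $\triangle[\gamma]:=\inf R(x,y,z)$, the infimum taken over all triples of pairwise distinct points $x,y,z\in\gamma$, where $R(x,y,z)$ is the radius of the circumcircle of $x,y,z$ ($R=\infty$ for collinear points). Problem (P): for a given constant $\Theta>0$, find the longest closed curve $\gamma:\mathbb{S}^1\to\mathbb{S}^2$ with prescribed minimal thickness $\Theta$, i.e. with $\triangle[\gamma]\ge\Theta$. A solution is a length maximizer in this class. Construction of $\gamma_{n,k}$: let $e_1,e_2,e_3$ be the standard basis of $\mathbb{R}^3$ and let $e_3$ be the north pole. For $i=0,\dots,n-1$ let $C_i$ be the latitudinal circle $C_i=\{x\in\mathbb{S}^2:\mathrm{dist}_{\mathbb{S}^2}(x,e_3)=(2i+1)\vartheta_n\}$; thus $\mathrm{dist}_{\mathbb{S}^2}(C_0,\text{north pole})=\vartheta_n$ and $\mathrm{dist}_{\mathbb{S}^2}(C_i,C_{i-1})=2\vartheta_n$ for $i=1,\dots,n-1$. Cut the sphere along the longitudinal great circle $\{x_1=0\}$ into the closed western hemisphere $\mathbb{S}^w=\{x\in\mathbb{S}^2:x_1\le 0\}$ and the closed eastern hemisphere $\mathbb{S}^e=\{x\in\mathbb{S}^2:x_1\ge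 0\}$. Let $\rho_\alpha$ be the rotation of $\mathbb{R}^3$ about the $e_1$-axis by the angle $\alpha$ (with a fixed sense of rotation). Then $$\gamma_{n,k}:=\Big(\mathbb{S}^w\cap\bigcup_{i=0}^{n-1}C_i\Big)\cup\rho_{2k\vartheta_n}\Big(\mathbb{S}^e\cap\bigcup_{i=0}^{n-1}C_i\Big).$$ $\varphi$ is Euler's totient function: $\varphi(n)$ is the number of integers $0\le k<n$ with $\gcd(k,n)=1$ (with $\gcd(0,n)=n$, so $k=0$ is admissible only for $n=1$). *)

theory Defs
  imports "HOL-Analysis.Analysis" "HOL-Number_Theory.Totient"
begin

text \<open>Closed curves on the unit sphere are \<open>2 * pi\<close>-periodic maps, i.e. maps on
  the reals modulo \<open>2 * pi\<close>; the curve as a point set is their range.\<close>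

abbreviation S2 :: "(real ^ 3) set" where
  "S2 \<equiv> sphere 0 1"

text \<open>Great-circle distance; meaningful for \<open>x\<close>, \<open>y\<close> on the unit sphere only.\<close>

definition dist_S2 :: "real ^ 3 \<Rightarrow> real ^ 3 \<Rightarrow> real" where
  "dist_S2 x y = arccos (x \<bullet> y)"

definition closed_curve_S2 :: "(real \<Rightarrow> real ^ 3) \<Rightarrow> bool" where
  "closed_curve_S2 g \<longleftrightarrow>
     range g \<subseteq> S2 \<and>
     (\<forall>t. g (t + 2 * pi) = g t) \<and>
     inj_on g {0..<2 * pi} \<and>
     g C1_differentiable_on UNIV \<and>
     (\<forall>t. vector_derivative g (at t) \<noteq> 0)"

definition curve_length :: "(real \<Rightarrow> real ^ 3) \<Rightarrow> real" where
  "curve_length g = integral {0..2 * pi} (\<lambda>t. norm (vector_derivative g (at t)))"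

text \<open>The circle with centre \<open>c\<close> and radius \<open>r\<close> in the plane through \<open>c\<close> with
  normal \<open>N\<close>.\<close>

definition circle3 :: "real ^ 3 \<Rightarrow> real ^ 3 \<Rightarrow> real \<Rightarrow> (real ^ 3) set" where
  "circle3 c N r = {p. N \<bullet> (p - c) = 0 \<and> dist c p = r}"

text \<open>Three non-collinear points lie on exactly one circle, so the description
  below is proper.\<close>

definition circumradius :: "real ^ 3 \<Rightarrow> real ^ 3 \<Rightarrow> real ^ 3 \<Rightarrow> ereal" where
  "circumradius x y z =
     (if collinear {x, y, z} then \<infinity>
      else ereal (THE r. \<exists>c N. N \<noteq> 0 \<and> {x, y, z} \<subseteq> circle3 c N r))"

definition thickness :: "(real ^ 3) set \<Rightarrow> ereal" where
  "thickness A =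
     Inf {circumradius x y z | x y z.
            x \<in> A \<and> y \<in> A \<and> z \<in> A \<and> x \<noteq> y \<and> y \<noteq> z \<and> x \<noteq> z}"

definition admissible :: "real \<Rightarrow> (real \<Rightarrow> real ^ 3) \<Rightarrow> bool" where
  "admissible \<Theta> g \<longleftrightarrow> closed_curve_S2 g \<and> ereal \<Theta> \<le> thickness (range g)"

definition solves_P :: "real \<Rightarrow> (real \<Rightarrow> real ^ 3) \<Rightarrow> bool" where
  "solves_P \<Theta> g \<longleftrightarrow>
     admissible \<Theta> g \<and> (\<forall>h. admissible \<Theta> h \<longrightarrow> curve_length h \<le> curve_length g)"

definition piecewise_circular :: "(real \<Rightarrow> real ^ 3) \<Rightarrow> bool" where
  "piecewise_circular g \<longleftrightarrow>
     (\<exists>(m::nat) s. s 0 = 0 \<and> s m = 2 * pi \<and>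
        (\<forall>j<m. s j < s (Suc j) \<and>
           (\<exists>c N r. N \<noteq> 0 \<and> 0 < r \<and> g ` {s j..s (Suc j)} \<subseteq> circle3 c N r)))"

definition \<theta> :: "nat \<Rightarrow> real" where
  "\<theta> n = pi / (2 * real n)"

definition lat_circle :: "nat \<Rightarrow> nat \<Rightarrow> (real ^ 3) set" where
  "lat_circle n i = {x \<in> S2. dist_S2 x (axis 3 1) = (2 * real i + 1) * \<theta> n}"

definition west :: "(real ^ 3) set" where
  "west = {x \<in> S2. x $ 1 \<le> 0}"

definition east :: "(real ^ 3) set" where
  "east = {x \<in> S2. x $ 1 \<ge> 0}"

definition rot1 :: "real \<Rightarrow> real ^ 3 \<Rightarrow> real ^ 3" where
  "rot1 \<alpha> x = vector [x $ 1, cos \<alpha> * x $ 2 - sin \<alpha> * x $ 3, sin \<alpha> * x $ 2 + cos \<alpha> * x $ 3]"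

definition glued_circles :: "nat \<Rightarrow> nat \<Rightarrow> (real ^ 3) set" where
  "glued_circles n k =
     (west \<inter> (\<Union>i<n. lat_circle n i)) \<union>
     rot1 (2 * real k * \<theta> n) ` (east \<inter> (\<Union>i<n. lat_circle n i))"

end

theory Submission
  imports Defs
begin

text \<open>Two facts carry the proof: every admissible curve has length at most \<open>2 * pi / sin (\<theta> n)\<close>,
and the glued circles form an admissible curve of exactly this length.

The length bound (\<open>admissible_length_le\<close>) is a Crofton argument. Let the thickness be at least
\<open>sin \<phi>\<close> and let \<open>0 < r < \<phi>\<close>. A circle on the sphere of geodesic radius \<open>r\<close> has
Euclidean radius \<open>sin r < sin \<phi>\<close>, so three points of the curve on it would be a triple of too
small circumradius: every such circle meets the curve at most twice. On the other hand the number
of intersections of a curve of length \<open>L\<close> with the circle of radius \<open>r\<close> about \<open>p\<close>, integrated over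
all \<open>p\<close>, is \<open>4 * L * sin r\<close>. Hence \<open>4 * L * sin r \<le> 2 * (4 * pi)\<close>, and \<open>r \<rightarrow> \<phi>\<close> gives the bound.
Only an inequality is required, and it has a discrete form: a circle that separates two
consecutive points of a fine subdivision meets the arc between them, and the centres of the
circles that separate points at distance \<open>d\<close> fill an area of about \<open>4 * d * sin r\<close>. Areas are
measured as volumes of cones in the unit ball (a third of the area), because Lebesgue measure is
invariant under orthogonal maps; the volume estimate is \<open>measure_straddle_ge\<close>.

The glued circles consist of \<open>2 * n\<close> semicircles with end points at the odd multiples of \<open>\<theta> n\<close> on
the great circle \<open>x $ 1 = 0\<close>, all of them orthogonal to that great circle. Following the curve,
the semicircle with number \<open>M\<close> lies on the circle of colatitude \<open>(1 - 2 * k * M) * \<theta> n\<close> around its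
axis, the two axes alternating. These odd numbers are to be read modulo \<open>4 * n\<close>, and each
semicircle is used exactly once per period because \<open>k\<close> and \<open>n\<close> are coprime
(\<open>same_circle_imp\<close>, \<open>circle_bij\<close>). The lengths add up to \<open>2 * pi / sin (\<theta> n)\<close> by a telescoping sum.

For the thickness, three points of the glued set lie on the circle of some geodesic radius \<open>r\<close>
about some \<open>p\<close>, and their circumradius is \<open>sin r\<close>. If \<open>r < \<theta> n\<close>, this circle can meet only one
latitude of each of the two stacks, because neighbouring latitudes are \<open>2 * \<theta> n\<close> apart. In the
projection to the disc spanned by the cut, the semicircles are chords, and the inner product with
\<open>p\<close> is concave along the chords on the side of \<open>p\<close> and convex along the others. This leaves room
for at most two points (\<open>circle_meets_at_most_twice\<close>).

Different rotations give different sets because the eastern half of the set determines the axis of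
its latitudes: the easternmost point of the first latitude lies strictly between two neighbouring
latitudes of any other admissible axis (\<open>glued_circles_neq\<close>).\<close>

section \<open>Circumradius on the unit sphere\<close>

text \<open>A line meets the unit sphere where a quadratic polynomial in the parameter vanishes, that is, in
  at most two points.\<close>

lemma sphere_triple_not_collinear:
  fixes x y z :: "real ^ 3"
  assumes "norm x = 1" "norm y = 1" "norm z = 1" "x \<noteq> y" "y \<noteq> z" "x \<noteq> z"
  shows "\<not> collinear {x, y, z}"
proof
  assume "collinear {x, y, z}"
  then have "collinear {0, x - y, z - y}" by (simp add: collinear_3)
  then obtain c where c: "z - y = c *\<^sub>R (x - y)"
    using assms by (auto simp: collinear_lemma)
  define u where "u = x - y"
  have xs: "x = y + u" and zs: "z = y + c *\<^sub>R u" using c by (auto simp: u_def algebra_simps)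
  have n: "y \<bullet> y = 1" "x \<bullet> x = 1" "z \<bullet> z = 1" using assms by (auto simp: norm_eq_1)
  have 1: "2 * (y \<bullet> u) + u \<bullet> u = 0"
    using n(2) unfolding xs by (simp add: inner_add inner_commute n(1))
  have 2: "2 * c * (y \<bullet> u) + c * c * (u \<bullet> u) = 0"
    using n(3) unfolding zs by (simp add: inner_add inner_commute n(1))
  have "c * (c - 1) * (u \<bullet> u) = 0" using 1 2 by algebra
  moreover have "u \<noteq> 0" using assms(4) by (simp add: u_def)
  ultimately have "c = 0 \<or> c = 1" by simp
  then show False using assms(5,6) zs xs by auto
qed

text \<open>By the Lagrange identity both \<open>N\<close> and \<open>d\<close> are multiples of \<open>cross3 u v\<close>, and they are
  orthogonal to each other.\<close>

lemma orthogonal_to_independent_triple: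
  fixes u v N d :: "real ^ 3"
  assumes W: "cross3 u v \<noteq> 0" and N: "N \<noteq> 0" "N \<bullet> u = 0" "N \<bullet> v = 0"
    and d: "d \<bullet> u = 0" "d \<bullet> v = 0" "d \<bullet> N = 0"
  shows "d = 0"
proof -
  have "cross3 (cross3 u v) d = 0" "cross3 (cross3 u v) N = 0"
    using d N by (simp_all add: cross_skew[of "cross3 u v"] Lagrange)
  then have par: "collinear {0, cross3 u v, d}" "collinear {0, cross3 u v, N}"
    by (simp_all only: cross_eq_0)
  have "\<exists>a. d = a *\<^sub>R cross3 u v"
    using par(1) W unfolding collinear_lemma by (auto intro: exI[of _ "0::real"])
  moreover have "\<exists>b. N = b *\<^sub>R cross3 u v"
    using par(2) W N(1) unfolding collinear_lemma by auto
  ultimately obtain a b where a: "d = a *\<^sub>R cross3 u v" and b: "N = b *\<^sub>R cross3 u v"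
    by blast
  have "a * b * (cross3 u v \<bullet> cross3 u v) = 0" using d(3) unfolding a b by auto
  then have "a = 0 \<or> b = 0" using W by (simp only: mult_eq_0_iff inner_eq_zero_iff) blast
  then show ?thesis using a b N by auto
qed

text \<open>Both circles lie in the plane of the triangle, and the difference of their centres is orthogonal to
  two sides of the triangle and to the normal of that plane, hence zero. This makes the definite
  description in the circumradius proper.\<close>

lemma circle3_radius_unique:
  assumes nc: "\<not> collinear {x, y, z}"
    and "N \<noteq> 0" "{x, y, z} \<subseteq> circle3 c N r"
    and "N' \<noteq> 0" "{x, y, z} \<subseteq> circle3 c' N' r'"
  shows "r = r'"
proof -
  have W: "cross3 (x - y) (z - y) \<noteq> 0"
    using nc by (simp add: cross_eq_0 collinear_3)
  have pl: "N \<bullet> (x - c) = 0" "N \<bullet> (y - c) = 0" "N \<bullet> (z - c) = 0"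
    and pl': "N' \<bullet> (x - c') = 0" "N' \<bullet> (y - c') = 0" "N' \<bullet> (z - c') = 0"
    and di: "dist c x = r" "dist c y = r" "dist c z = r"
    and di': "dist c' x = r'" "dist c' y = r'" "dist c' z = r'"
    using assms by (auto simp: circle3_def)
  have N: "N \<bullet> (x - y) = 0" "N \<bullet> (z - y) = 0" and N': "N' \<bullet> (x - y) = 0" "N' \<bullet> (z - y) = 0"
    using pl pl' by (auto simp: inner_diff_right)
  have eq: "(x - c) \<bullet> (x - c) = (y - c) \<bullet> (y - c)" "(z - c) \<bullet> (z - c) = (y - c) \<bullet> (y - c)"
    "(x - c') \<bullet> (x - c') = (y - c') \<bullet> (y - c')" "(z - c') \<bullet> (z - c') = (y - c') \<bullet> (y - c')"
    using di di' by (simp_all add: dist_norm norm_minus_commute flip: power2_norm_eq_inner)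
  have d: "(c - c') \<bullet> (x - y) = 0" "(c - c') \<bullet> (z - y) = 0"
    using eq by (auto simp: inner_diff_right inner_diff_left inner_commute)
  have "N - ((N \<bullet> N') / (N' \<bullet> N')) *\<^sub>R N' = 0"
    by (rule orthogonal_to_independent_triple[OF W assms(4) N'])
      (use N N' assms(4) in \<open>auto simp: inner_diff_left\<close>)
  then obtain b where b: "N = b *\<^sub>R N'" by auto
  then have "b \<noteq> 0" using assms(2) by auto
  then have "N' \<bullet> (y - c) = 0" using pl b by simp
  then have "(c - c') \<bullet> N' = 0" using pl'(2) by (simp add: inner_diff_right inner_diff_left inner_commute)
  then have "c - c' = 0"
    using orthogonal_to_independent_triple[OF W assms(4) N' d] by blast
  then show ?thesis using di di' by simp
qed

lemma circumradius_eqI: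
  assumes "\<not> collinear {x, y, z}" "N \<noteq> 0" "{x, y, z} \<subseteq> circle3 c N r"
  shows "circumradius x y z = ereal r"
proof -
  have "(THE r. \<exists>c N. N \<noteq> 0 \<and> {x, y, z} \<subseteq> circle3 c N r) = r"
  proof (rule the_equality)
    show "\<exists>c N. N \<noteq> 0 \<and> {x, y, z} \<subseteq> circle3 c N r"
      using assms(2,3) by (intro exI conjI)
    show "r' = r" if "\<exists>c N. N \<noteq> 0 \<and> {x, y, z} \<subseteq> circle3 c N r'" for r'
      using that circle3_radius_unique[OF assms(1) _ _ assms(2,3)] by (elim exE conjE)
  qed
  then show ?thesis using assms(1) by (simp only: circumradius_def if_False)
qed

lemma sphere_section_in_circle3:
  assumes "norm p = 1" "norm w = 1" "w \<bullet> p = \<kappa>"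
  shows "w \<in> circle3 (\<kappa> *\<^sub>R p) p (sqrt (1 - \<kappa>\<^sup>2))"
proof -
  have pp: "p \<bullet> p = 1" and ww: "w \<bullet> w = 1" using assms by (simp_all add: norm_eq_1)
  have "(\<kappa> *\<^sub>R p - w) \<bullet> (\<kappa> *\<^sub>R p - w) = 1 - \<kappa>\<^sup>2"
    using assms(3) by (simp add: inner_diff_left inner_diff_right pp ww inner_commute power2_eq_square)
  then have "dist (\<kappa> *\<^sub>R p) w = sqrt (1 - \<kappa>\<^sup>2)" by (simp add: dist_norm norm_eq_sqrt_inner)
  then show ?thesis using assms(3) pp by (simp add: circle3_def inner_diff_right inner_commute)
qed

lemma circumradius_on_sphere:
  assumes "norm p = 1" and "norm x = 1" "norm y = 1" "norm z = 1"
    and "x \<noteq> y" "y \<noteq> z" "x \<noteq> z"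
    and "x \<bullet> p = \<kappa>" "y \<bullet> p = \<kappa>" "z \<bullet> p = \<kappa>"
  shows "circumradius x y z = ereal (sqrt (1 - \<kappa>\<^sup>2))"
proof (rule circumradius_eqI)
  show "\<not> collinear {x, y, z}" using assms by (intro sphere_triple_not_collinear) auto
  show "p \<noteq> 0" using assms(1) by auto
  note on = sphere_section_in_circle3[OF assms(1)]
  show "{x, y, z} \<subseteq> circle3 (\<kappa> *\<^sub>R p) p (sqrt (1 - \<kappa>\<^sup>2))"
    using on[OF assms(2,8)] on[OF assms(3,9)] on[OF assms(4,10)] by blast
qed

text \<open>The centre \<open>p\<close> is the unit normal of the plane through the three points, with the sign for which
  the circle has geodesic radius at most \<open>pi / 2\<close>.\<close>

lemma three_points_on_circle:
  fixes x y z :: "real ^ 3"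
  assumes "norm x = 1" "norm y = 1" "norm z = 1" "x \<noteq> y" "y \<noteq> z" "x \<noteq> z"
  obtains p \<kappa> where "norm p = 1" "0 \<le> \<kappa>" "x \<bullet> p = \<kappa>" "y \<bullet> p = \<kappa>" "z \<bullet> p = \<kappa>"
proof -
  define W where "W = cross3 (x - y) (z - y)"
  have "W \<noteq> 0"
    using sphere_triple_not_collinear[OF assms] by (simp add: W_def cross_eq_0 collinear_3[of x y z])
  have W: "(x - y) \<bullet> W = 0" "(z - y) \<bullet> W = 0" by (simp_all add: W_def dot_cross_self)
  define p where "p = (if 0 \<le> x \<bullet> W then 1 else -1 :: real) *\<^sub>R sgn W"
  have 1: "norm p = 1" using \<open>W \<noteq> 0\<close> by (simp add: p_def norm_sgn)
  have 2: "0 \<le> x \<bullet> p" by (auto simp: p_def sgn_div_norm mult_nonneg_nonpos)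
  have 3: "y \<bullet> p = x \<bullet> p" "z \<bullet> p = x \<bullet> p"
    using W by (auto simp: p_def sgn_div_norm inner_diff_left)
  show thesis by (rule that[OF 1 2 refl 3])
qed

section \<open>Area swept by the circles of fixed radius that separate two points\<close>

text \<open>The second coordinate comes first, so that Fubini slices by it and the slices of the wedge below are
  again nested intervals.\<close>

definition cart3 :: "real \<times> real \<times> real \<Rightarrow> real ^ 3" where
  "cart3 p = fst p *\<^sub>R axis 2 1 + fst (snd p) *\<^sub>R axis 3 1 + snd (snd p) *\<^sub>R axis 1 1"

lemma cart3_nth [simp]:
  "cart3 (y, z, x) $ 1 = x" "cart3 (y, z, x) $ 2 = y" "cart3 (y, z, x) $ 3 = z"
  by (simp_all add: cart3_def axis_def)

lemma borel_measurable_cart3 [measurable]: "cart3 \<in> borel_measurable borel"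
  unfolding cart3_def by (intro borel_measurable_continuous_onI continuous_intros)

lemma box_Pair_eq: "box (a, b) (c, d) = box a c \<times> box b d"
  by (auto simp: box_def Basis_prod_def ball_Un)

lemma emeasure_lborel_Times:
  fixes A :: "'a::euclidean_space set" and B :: "'b::euclidean_space set"
  assumes "A \<in> sets borel" "B \<in> sets borel"
  shows "emeasure lborel (A \<times> B) = emeasure lborel A * emeasure lborel B"
  using assms by (simp add: lborel_prod[symmetric] lborel.emeasure_pair_measure_Times)

lemma borel_slice:
  fixes W :: "('a::euclidean_space \<times> 'b::euclidean_space) set"
  shows "W \<in> sets borel \<Longrightarrow> Pair y -` W \<in> sets borel"
  by (metis borel_prod sets_Pair1)

lemma emeasure_lborel_slices:
  fixes W :: "('a::euclidean_space \<times> 'b::euclidean_space) set"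
  assumes "W \<in> sets borel"
  shows "emeasure lborel W = (\<integral>\<^sup>+y. emeasure lborel (Pair y -` W) \<partial>lborel)"
proof -
  have "W \<in> sets (lborel \<Otimes>\<^sub>M lborel)" using assms by (simp only: lborel_prod sets_lborel)
  from lborel.emeasure_pair_measure_alt[OF this] show ?thesis by (simp add: lborel_prod)
qed

lemma lborel_cart3: "(lborel :: (real ^ 3) measure) = distr lborel borel cart3"
proof (rule lborel_eqI)
  fix l u :: "real ^ 3"
  assume "\<And>b. b \<in> Basis \<Longrightarrow> l \<bullet> b \<le> u \<bullet> b"
  then have "l \<bullet> axis i 1 \<le> u \<bullet> axis i 1" for i
    by (simp add: axis_in_Basis_iff)
  then have le: "l $ i \<le> u $ i" for i
    by (simp add: inner_axis)
  have "cart3 -` box l u = box (l $ 2, l $ 3, l $ 1) (u $ 2, u $ 3, u $ 1)"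
    by (auto simp: mem_box_cart forall_3 box_Pair_eq)
  then have "emeasure (distr lborel borel cart3) (box l u)
      = emeasure lborel (box (l $ 2, l $ 3, l $ 1) (u $ 2, u $ 3, u $ 1))"
    by (simp add: emeasure_distr)
  also have "\<dots> = ennreal ((u $ 2 - l $ 2) * ((u $ 3 - l $ 3) * (u $ 1 - l $ 1)))"
    using le by (simp add: box_Pair_eq emeasure_lborel_Times borel_Times ennreal_mult)
  also have "(u $ 2 - l $ 2) * ((u $ 3 - l $ 3) * (u $ 1 - l $ 1)) = (\<Prod>b\<in>Basis. (u - l) \<bullet> b)"
  proof -
    have B: "(Basis :: (real ^ 3) set) = range (\<lambda>i. axis i 1)"
      by (auto simp: Basis_vec_def)
    have "(\<Prod>b\<in>Basis. (u - l) \<bullet> b) = (\<Prod>i\<in>UNIV. (u - l) $ i)"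
      unfolding B by (subst prod.reindex) (auto simp: inj_on_def axis_eq_axis inner_axis)
    also have "\<dots> = (u - l) $ 1 * ((u - l) $ 2 * (u - l) $ 3)"
      unfolding UNIV_3 by simp
    finally show ?thesis by (simp only: vector_minus_component mult.commute mult.left_commute)
  qed
  finally show "emeasure (distr lborel borel cart3) (box l u) = ennreal (\<Prod>b\<in>Basis. (u - l) \<bullet> b)" .
qed simp

text \<open>A part of the region between two planes through the second coordinate axis that lies in the unit ball and
  in a circular cone around the third axis; \<open>C\<close> and \<open>S\<close> are the cosine and sine of half
  the angle between the planes, and \<open>c\<close> is the cosine of the angle between the axis and the boundary of the cone. On the
  bounding planes the Euclidean norm is \<open>sqrt ((x $ 2)\<^sup>2 + (x $ 3)\<^sup>2 / C\<^sup>2)\<close>; bounding that expression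
  instead of the norm makes the wedge a little smaller and its volume elementary.\<close>

definition wedge :: "real \<Rightarrow> real \<Rightarrow> real \<Rightarrow> (real ^ 3) set" where
  "wedge c C S = {x. C * \<bar>x $ 1\<bar> < S * x $ 3 \<and> (x $ 2)\<^sup>2 + (x $ 3)\<^sup>2 / C\<^sup>2 < 1 \<and> 0 < x $ 3 \<and>
     c\<^sup>2 * ((x $ 2)\<^sup>2 + (x $ 3)\<^sup>2 / C\<^sup>2) < (x $ 3)\<^sup>2}"

lemma open_wedge: "open (wedge c C S)"
  unfolding wedge_def divide_inverse
  by (intro open_Collect_conj open_Collect_less continuous_intros)

lemma nn_integral_FTC_open:
  fixes f :: "real \<Rightarrow> real"
  assumes f: "f \<in> borel_measurable borel" and "a \<le> b"
    and "\<And>x. x \<in> {a..b} \<Longrightarrow> (F has_real_derivative f x) (at x)" "\<And>x. x \<in> {a..b} \<Longrightarrow> 0 \<le> f x"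
  shows "(\<integral>\<^sup>+x. ennreal (f x) * indicator {a<..<b} x \<partial>lborel) = ennreal (F b - F a)"
proof -
  have "(\<integral>\<^sup>+x. ennreal (f x) * indicator {a<..<b} x \<partial>lborel) = (\<integral>\<^sup>+x. ennreal (f x) * indicator {a..b} x \<partial>lborel)"
    using AE_lborel_singleton[of a] AE_lborel_singleton[of b]
    by (intro nn_integral_cong_AE) (auto split: split_indicator)
  also have "\<dots> = ennreal (F b - F a)"
    by (rule nn_integral_FTC_Icc) (use assms in \<open>auto intro: has_field_derivative_at_within\<close>)
  finally show ?thesis .
qed

text \<open>For fixed \<open>y = x $ 2\<close> the third coordinate runs from \<open>z0\<close> to \<open>z1\<close>, which is an interval as long as
  \<open>\<bar>y\<bar> < \<sigma>\<close>; the first one runs through an interval of length \<open>2 * S * z / C\<close>.\<close>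

lemma emeasure_wedge_ge:
  assumes "0 < C" "0 \<le> S" "0 \<le> c" "c < C"
  shows "ennreal (4 / 3 * S * sqrt (C\<^sup>2 - c\<^sup>2)) \<le> emeasure lborel (wedge c C S)"
proof -
  define K where "K = sqrt (C\<^sup>2 - c\<^sup>2)"
  define \<sigma> where "\<sigma> = K / C"
  have c2: "c\<^sup>2 < C\<^sup>2" using assms by (simp add: power_strict_mono)
  then have K: "0 < K" "K\<^sup>2 = C\<^sup>2 - c\<^sup>2" by (simp_all add: K_def)
  have s0: "0 < \<sigma>" using K assms by (simp add: \<sigma>_def)
  define W' where "W' = cart3 -` wedge c C S"
  have W': "W' \<in> sets borel" unfolding W'_def
    using measurable_sets_borel[OF borel_measurable_cart3 borel_open[OF open_wedge]] by simp
  have slice: "ennreal (S * C * (1 - y\<^sup>2 / \<sigma>\<^sup>2)) \<le> emeasure lborel (Pair y -` W')"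
    if y: "y \<in> {-\<sigma><..<\<sigma>}" for y
  proof -
    define z0 where "z0 = C * c * \<bar>y\<bar> / K"
    define z1 where "z1 = C * sqrt (1 - y\<^sup>2)"
    have y2: "y\<^sup>2 < \<sigma>\<^sup>2" using y by (intro abs_le_square_iff[THEN iffD1, THEN order.not_eq_order_implies_strict[rotated]]) (auto simp: power2_eq_iff)
    have s1: "\<sigma>\<^sup>2 = 1 - c\<^sup>2 / C\<^sup>2" using K(2) assms by (simp add: \<sigma>_def power_divide field_simps)
    have "0 \<le> c\<^sup>2 / C\<^sup>2" by simp
    then have "y\<^sup>2 \<le> 1" using y2 s1 by linarith
    then have z1: "z1\<^sup>2 = C\<^sup>2 * (1 - y\<^sup>2)" "0 \<le> z1" using assms by (simp_all add: z1_def power_mult_distrib)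
    have z0: "z0\<^sup>2 = C\<^sup>2 * c\<^sup>2 * y\<^sup>2 / K\<^sup>2" "0 \<le> z0" using assms K(1) by (simp_all add: z0_def power_mult_distrib power_divide)
    have D: "z1\<^sup>2 - z0\<^sup>2 = C\<^sup>2 * (1 - y\<^sup>2 / \<sigma>\<^sup>2)"
    proof -
      have "z1\<^sup>2 - z0\<^sup>2 = C\<^sup>2 * (1 - y\<^sup>2 * (K\<^sup>2 + c\<^sup>2) / K\<^sup>2)"
        using K(1) unfolding z1 z0 by (simp add: field_simps)
      also have "(K\<^sup>2 + c\<^sup>2) = C\<^sup>2" using K by simp
      finally show ?thesis by (simp add: \<sigma>_def power_divide)
    qed
    have diff: "S / C * z1\<^sup>2 - S / C * z0\<^sup>2 = S * C * (1 - y\<^sup>2 / \<sigma>\<^sup>2)"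
    proof -
      have "S / C * (z1\<^sup>2 - z0\<^sup>2) = S / C * (C\<^sup>2 * (1 - y\<^sup>2 / \<sigma>\<^sup>2))" by (simp only: D)
      then show ?thesis using assms by (simp add: right_diff_distrib power2_eq_square)
    qed
    have "z0\<^sup>2 \<le> z1\<^sup>2"
    proof -
      have "y\<^sup>2 / \<sigma>\<^sup>2 \<le> 1" using y2 s0 by simp
      then have "0 \<le> C\<^sup>2 * (1 - y\<^sup>2 / \<sigma>\<^sup>2)" by simp
      also note D[symmetric]
      finally show ?thesis by simp
    qed
    then have z01: "z0 \<le> z1" using z1(2) by (rule power2_le_imp_le)
    have sub: "ennreal (2 * (S * z / C)) * indicator {z0<..<z1} z \<le> emeasure lborel (Pair z -` Pair y -` W')" for z
    proof (cases "z \<in> {z0<..<z1}")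
      case True
      then have z: "0 < z" "z < z1" "z0 < z" using z0(2) by auto
      have "z\<^sup>2 < C\<^sup>2 * (1 - y\<^sup>2)" using z z1(1) by (metis power_strict_mono order.strict_implies_order pos2)
      then have a: "y\<^sup>2 + z\<^sup>2 / C\<^sup>2 < 1" using assms by (simp add: field_simps)
      have "C\<^sup>2 * c\<^sup>2 * y\<^sup>2 / K\<^sup>2 < z\<^sup>2" using z z0 by (metis power_strict_mono pos2)
      then have "C\<^sup>2 * c\<^sup>2 * y\<^sup>2 < z\<^sup>2 * K\<^sup>2" using K(1) by (simp add: field_simps)
      then have b: "c\<^sup>2 * (y\<^sup>2 + z\<^sup>2 / C\<^sup>2) < z\<^sup>2" using K(2) assms by (simp add: field_simps)
      have "{- (S * z / C)<..<S * z / C} \<subseteq> Pair z -` Pair y -` W'"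
      proof
        fix x assume "x \<in> {- (S * z / C)<..<S * z / C}"
        then have "\<bar>x\<bar> < S * z / C" by auto
        then have "C * \<bar>x\<bar> < S * z" using assms by (simp add: field_simps)
        then show "x \<in> Pair z -` Pair y -` W'" using a b z by (simp add: W'_def wedge_def)
      qed
      then have "emeasure lborel {- (S * z / C)<..<S * z / C} \<le> emeasure lborel (Pair z -` Pair y -` W')"
        using W' by (intro emeasure_mono) (auto intro: borel_slice)
      moreover have "0 \<le> S * z / C" using assms z by simp
      then have "emeasure lborel {- (S * z / C)<..<S * z / C} = ennreal (2 * (S * z / C))"
        by (subst emeasure_lborel_Ioo) auto
      ultimately show ?thesis using True by simp
    qed simp
    have "ennreal (S / C * z1\<^sup>2 - S / C * z0\<^sup>2) = (\<integral>\<^sup>+z. ennreal (2 * (S * z / C)) * indicator {z0<..<z1} z \<partial>lborel)"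
      using z01 z0(2) assms
      by (intro nn_integral_FTC_open[symmetric]) (auto intro!: derivative_eq_intros)
    also have "\<dots> \<le> (\<integral>\<^sup>+z. emeasure lborel (Pair z -` Pair y -` W') \<partial>lborel)"
      by (intro nn_integral_mono sub)
    also have "\<dots> = emeasure lborel (Pair y -` W')"
      using W' by (intro emeasure_lborel_slices[symmetric] borel_slice)
    finally show ?thesis unfolding diff .
  qed
  have "ennreal (4 / 3 * S * K) =
      ennreal (S * C * (\<sigma> - \<sigma> ^ 3 / (3 * \<sigma>\<^sup>2)) - S * C * (- \<sigma> - (- \<sigma>) ^ 3 / (3 * \<sigma>\<^sup>2)))"
    using s0 assms(1) by (simp add: \<sigma>_def field_simps power2_eq_square power3_eq_cube)
  also have "\<dots> = (\<integral>\<^sup>+y. ennreal (S * C * (1 - y\<^sup>2 / \<sigma>\<^sup>2)) * indicator {-\<sigma><..<\<sigma>} y \<partial>lborel)"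
  proof (intro nn_integral_FTC_open[symmetric])
    fix y assume y: "y \<in> {-\<sigma>..\<sigma>}"
    then have "y\<^sup>2 \<le> \<sigma>\<^sup>2" by (auto simp: abs_le_square_iff[symmetric])
    then show "0 \<le> S * C * (1 - y\<^sup>2 / \<sigma>\<^sup>2)" using s0 assms by simp
    show "((\<lambda>y. S * C * (y - y ^ 3 / (3 * \<sigma>\<^sup>2))) has_real_derivative S * C * (1 - y\<^sup>2 / \<sigma>\<^sup>2)) (at y)"
    proof -
      have "((\<lambda>y. S * C * (y - y ^ 3 / (3 * q))) has_real_derivative S * C * (1 - y\<^sup>2 / q)) (at y)"
        if "q \<noteq> 0" for q :: real
        using that
        by (auto intro!: derivative_eq_intros)
      then show ?thesis using s0 by simp
    qed
  qed (use s0 in auto)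
  also have "\<dots> \<le> (\<integral>\<^sup>+y. emeasure lborel (Pair y -` W') \<partial>lborel)"
    using slice by (intro nn_integral_mono) (auto split: split_indicator)
  also have "\<dots> = emeasure lborel W'"
    using W' by (intro emeasure_lborel_slices[symmetric])
  also have "\<dots> = emeasure lborel (wedge c C S)"
  proof -
    have "emeasure lborel (wedge c C S) = emeasure (distr lborel borel cart3) (wedge c C S)"
      by (simp only: lborel_cart3[symmetric])
    also have "\<dots> = emeasure lborel W'"
      by (simp add: emeasure_distr open_wedge borel_open W'_def)
    finally show ?thesis by simp
  qed
  finally show ?thesis unfolding K_def .
qed

definition reflection :: "'a::real_inner \<Rightarrow> 'a \<Rightarrow> 'a" where
  "reflection m x = x - (2 * (x \<bullet> m)) *\<^sub>R m"

lemma reflection_reflection: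
  assumes "norm m = 1" shows "reflection m (reflection m x) = x"
proof -
  have "m \<bullet> m = 1" using assms by (simp add: norm_eq_1)
  then show ?thesis by (simp add: reflection_def inner_diff_left algebra_simps)
qed

lemma reflection_inner_commute: "reflection m x \<bullet> y = x \<bullet> reflection m y"
  by (simp add: reflection_def inner_diff_left inner_diff_right inner_commute)

lemma orthogonal_transformation_reflection:
  assumes "norm m = 1" shows "orthogonal_transformation (reflection m)"
proof -
  have "linear (reflection m)"
    by (rule linearI) (auto simp: reflection_def inner_add_left algebra_simps)
  moreover have "reflection m v \<bullet> reflection m w = v \<bullet> w" for v w
    using reflection_reflection[OF assms] by (simp add: reflection_inner_commute)
  ultimately show ?thesis by (simp add: orthogonal_transformation_def)
qed

lemma norm_reflection: "norm m = 1 \<Longrightarrow> norm (reflection m x) = norm x"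
  using orthogonal_transformation_norm[OF orthogonal_transformation_reflection] .

lemma reflection_image_Collect:
  assumes "norm m = 1" shows "reflection m ` {x. P x} = {x. P (reflection m x)}"
  using reflection_reflection[OF assms] by (auto simp: image_iff) metis

text \<open>The cone in the unit ball over all points \<open>p\<close> of the sphere whose circle of geodesic radius
  \<open>arccos c\<close> separates \<open>a\<close> from \<open>b\<close>. Multiplying by the norm avoids normalising \<open>x\<close>.\<close>

definition straddle :: "real \<Rightarrow> real ^ 3 \<Rightarrow> real ^ 3 \<Rightarrow> (real ^ 3) set" where
  "straddle c a b = {x. norm x < 1 \<and> (x \<bullet> a - c * norm x) * (x \<bullet> b - c * norm x) < 0}"

lemma lmeasurable_unit_ball_Collect:
  assumes "open {x. P x}" shows "{x::real ^ 3. norm x < 1 \<and> P x} \<in> lmeasurable"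
proof (rule lmeasurable_open)
  have "{x. norm x < 1 \<and> P x} = ball 0 1 \<inter> {x. P x}" by auto
  then show "bounded {x. norm x < 1 \<and> P x}" "open {x. norm x < 1 \<and> P x}"
    using assms by (auto simp: open_Int bounded_Int)
qed

lemma straddle_lmeasurable: "straddle c a b \<in> lmeasurable"
  unfolding straddle_def
  by (intro lmeasurable_unit_ball_Collect open_Collect_less continuous_intros)

text \<open>The set is contained in the frontier of a convex cone: moving a point in direction \<open>- b\<close> decreases
  \<open>x \<bullet> b\<close> faster than \<open>c * norm x\<close>, because \<open>c < 1\<close>.\<close>

lemma negligible_cone_boundary:
  fixes b :: "'a::euclidean_space"
  assumes "0 \<le> c" "c < 1" "norm b = 1"
  shows "negligible {x. x \<bullet> b = c * norm x}"
proof -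
  define K where "K = {x. c * norm x \<le> x \<bullet> b}"
  have "convex K"
  proof (rule convexI)
    fix x y :: 'a and u v :: real
    assume K: "x \<in> K" "y \<in> K" and uv: "0 \<le> u" "0 \<le> v"
    have "c * norm (u *\<^sub>R x + v *\<^sub>R y) \<le> c * (u * norm x + v * norm y)"
      using norm_triangle_ineq[of "u *\<^sub>R x" "v *\<^sub>R y"] uv assms(1) by (intro mult_left_mono) auto
    also have "\<dots> \<le> u * (x \<bullet> b) + v * (y \<bullet> b)"
      using K uv mult_left_mono[of "c * norm x" "x \<bullet> b" u] mult_left_mono[of "c * norm y" "y \<bullet> b" v]
      by (simp add: K_def algebra_simps)
    finally show "u *\<^sub>R x + v *\<^sub>R y \<in> K" by (simp add: K_def inner_add_left)
  qed
  moreover have "{x. x \<bullet> b = c * norm x} \<subseteq> frontier K"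
  proof
    fix x assume "x \<in> {x. x \<bullet> b = c * norm x}"
    then have x: "x \<bullet> b = c * norm x" by simp
    have "x \<notin> interior K"
    proof
      assume "x \<in> interior K"
      then obtain e where e: "e > 0" "ball x e \<subseteq> K" by (auto simp: mem_interior)
      have "x - (e / 2) *\<^sub>R b \<in> K"
        using e assms(3) by (intro subsetD[OF e(2)]) (simp add: dist_norm)
      then have "c * norm (x - (e / 2) *\<^sub>R b) \<le> c * norm x - e / 2"
        using assms(3) x by (simp add: K_def inner_diff_left power2_norm_eq_inner[symmetric])
      moreover have "c * (norm x - e / 2) \<le> c * norm (x - (e / 2) *\<^sub>R b)"
        using norm_triangle_ineq2[of x "(e / 2) *\<^sub>R b"] e assms by (intro mult_left_mono) auto
      moreover have "c * (e / 2) < 1 * (e / 2)" using e assms by (intro mult_strict_right_mono) auto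
      ultimately show False by (simp add: right_diff_distrib)
    qed
    moreover have "x \<in> closure K" using x by (intro subsetD[OF closure_subset]) (simp add: K_def)
    ultimately show "x \<in> frontier K" by (simp add: frontier_def)
  qed
  ultimately show ?thesis using negligible_convex_frontier negligible_subset by blast
qed

text \<open>The reflection that exchanges \<open>a\<close> and \<open>b\<close> maps the part \<open>D1\<close> of the set where \<open>x\<close> is close to \<open>a\<close> and
  far from \<open>b\<close> to the opposite part \<open>D2\<close>. Up to a null set, \<open>D1\<close> contains the difference of the half
  caps \<open>Ea\<close> and \<open>Eb\<close> that are cut off by the symmetry plane. Two reflections turn \<open>Eb\<close> into a part \<open>G\<close> of
  \<open>Ea\<close>, cut off by another plane, and what remains of \<open>Ea\<close> contains a wedge between these two planes.\<close>

lemma measure_straddle_ge: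
  assumes "norm a = 1" "norm b = 1" "a \<noteq> b" "0 \<le> c" "c\<^sup>2 < 1 - (norm (a - b))\<^sup>2 / 4"
  shows "4 / 3 * norm (a - b) * sqrt (1 - (norm (a - b))\<^sup>2 / 4 - c\<^sup>2)
          \<le> measure lebesgue (straddle c a b)"
proof -
  let ?d = "norm (a - b)"
  have aa: "a \<bullet> a = 1" "b \<bullet> b = 1" using assms by (simp_all add: norm_eq_1)
  have d: "0 < ?d" using assms by simp
  define S where "S = ?d / 2"
  define C where "C = sqrt (1 - ?d\<^sup>2 / 4)"
  define m where "m = (1 / ?d) *\<^sub>R (a - b)"
  have ab: "a \<bullet> b = 1 - ?d\<^sup>2 / 2"
    by (simp add: power2_norm_eq_inner inner_diff_left inner_diff_right aa inner_commute field_simps)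
  have C: "0 < C" "C\<^sup>2 = 1 - ?d\<^sup>2 / 4" "c < C" "0 < S" "C\<^sup>2 + S\<^sup>2 = 1"
  proof -
    have pos: "0 < 1 - ?d\<^sup>2 / 4" using assms(5) zero_le_power2[of c] by linarith
    show "0 < C" "C\<^sup>2 = 1 - ?d\<^sup>2 / 4" using pos by (auto simp: C_def)
    then show "c < C" "C\<^sup>2 + S\<^sup>2 = 1" using assms(5) by (auto simp: S_def power_divide intro: power2_less_imp_less)
    show "0 < S" using d by (simp add: S_def)
  qed
  have "c\<^sup>2 < 1" using assms(5) zero_le_power2[of ?d] by linarith
  then have c1: "c < 1" using power2_less_imp_less[of c 1] by simp
  have m: "norm m = 1" using d by (simp add: m_def)
  have mm: "m \<bullet> m = 1" using m by (simp add: norm_eq_1)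
  have abm: "x \<bullet> a - x \<bullet> b = ?d * (x \<bullet> m)" for x
    using d by (simp add: m_def inner_diff_right)
  have am: "a \<bullet> m = S"
    using d by (simp add: m_def inner_diff_right aa ab S_def power2_eq_square)
  have ra: "reflection m a = b"
    unfolding reflection_def am using d by (simp add: S_def m_def)
  then have rb: "reflection m b = a" using reflection_reflection[OF m] by metis
  \<comment> \<open>The frame \<open>n\<close>, \<open>cross3 a n\<close>, \<open>a\<close> takes the role of the coordinate axes.\<close>
  define n where "n = (1 / C) *\<^sub>R (m - S *\<^sub>R a)"
  have mn: "m = C *\<^sub>R n + S *\<^sub>R a" using C(1) by (simp add: n_def)
  have na: "n \<bullet> a = 0" using am by (simp add: n_def inner_diff_left inner_commute[of m] aa)
  have nn: "n \<bullet> n = 1"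
  proof -
    have "C * C * (n \<bullet> n) = 1 - S\<^sup>2"
      using mm na unfolding mn by (simp add: inner_add_left inner_add_right aa inner_commute power2_eq_square)
    also have "\<dots> = C * C" using C(5) by (simp add: power2_eq_square)
    finally show ?thesis using C(1) by simp
  qed
  then have n: "norm n = 1" by (simp add: norm_eq_1)
  \<comment> \<open>The reflection in \<open>n\<close> preserves the cap around \<open>a\<close> and moves the plane orthogonal to \<open>m\<close>.\<close>
  have rna: "reflection n a = a" using na by (simp add: reflection_def inner_commute)
  have rnm: "reflection n m = S *\<^sub>R a - C *\<^sub>R n"
  proof -
    have "m \<bullet> n = C" using na nn by (simp add: mn inner_add_left inner_commute[of a])
    then show ?thesis unfolding reflection_def by (simp add: mn vec_eq_iff)
  qed
  have rmm: "reflection m m = - m" by (simp add: reflection_def mm scaleR_2)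
  define D1 where "D1 = {x::real^3. norm x < 1 \<and> c * norm x < x \<bullet> a \<and> x \<bullet> b < c * norm x}"
  define D2 where "D2 = {x::real^3. norm x < 1 \<and> c * norm x < x \<bullet> b \<and> x \<bullet> a < c * norm x}"
  define Ea where "Ea = {x::real^3. norm x < 1 \<and> c * norm x < x \<bullet> a \<and> 0 < x \<bullet> m}"
  define Eb where "Eb = {x::real^3. norm x < 1 \<and> c * norm x < x \<bullet> b \<and> 0 < x \<bullet> m}"
  define F where "F = {x::real^3. norm x < 1 \<and> c * norm x < x \<bullet> a \<and> x \<bullet> m < 0}"
  define G where "G = {x::real^3. norm x < 1 \<and> c * norm x < x \<bullet> a \<and> S * (x \<bullet> a) < C * (x \<bullet> n)}"
  define N where "N = {x::real^3. x \<bullet> b = c * norm x}"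
  have lm: "D1 \<in> lmeasurable" "D2 \<in> lmeasurable" "Ea \<in> lmeasurable" "Eb \<in> lmeasurable"
    "F \<in> lmeasurable" "G \<in> lmeasurable"
    unfolding D1_def D2_def Ea_def Eb_def F_def G_def
    by (intro lmeasurable_unit_ball_Collect open_Collect_conj open_Collect_less continuous_intros)+
  have eqs: "D2 = reflection m ` D1" "Eb = reflection m ` F" "G = reflection n ` F"
    unfolding D1_def D2_def Eb_def F_def G_def reflection_image_Collect[OF m] reflection_image_Collect[OF n]
    by (auto simp: norm_reflection[OF m] norm_reflection[OF n] reflection_inner_commute ra rb rna rnm rmm inner_diff_right)
  have D2: "measure lebesgue D2 = measure lebesgue D1"
    unfolding eqs by (rule measure_orthogonal_image[OF orthogonal_transformation_reflection[OF m] lm(1)])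
  have "measure lebesgue Eb = measure lebesgue F"
    unfolding eqs by (rule measure_orthogonal_image[OF orthogonal_transformation_reflection[OF m] lm(5)])
  also have "\<dots> = measure lebesgue G"
    unfolding eqs by (rule measure_orthogonal_image[OF orthogonal_transformation_reflection[OF n] lm(5), symmetric])
  finally have EbG: "measure lebesgue Eb = measure lebesgue G" .
  have cpos: "0 < x \<bullet> a" if "c * norm x < x \<bullet> a" for x
    using that assms(4) by (meson le_less_trans mult_nonneg_nonneg norm_ge_zero)
  have "Eb \<subseteq> Ea"
  proof
    fix x assume "x \<in> Eb"
    moreover from this have "0 < ?d * (x \<bullet> m)" using d by (simp add: Eb_def)
    ultimately show "x \<in> Ea" using abm[of x] by (auto simp: Ea_def Eb_def)
  qed
  have "G \<subseteq> Ea"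
  proof
    fix x assume x: "x \<in> G"
    then have "0 < S * (x \<bullet> a)" using cpos C(4) by (auto simp: G_def)
    then have "0 < x \<bullet> m" using x unfolding mn by (simp add: G_def inner_add_right)
    then show "x \<in> Ea" using x by (auto simp: Ea_def G_def)
  qed
  define T where "T x = x $ 1 *\<^sub>R n + x $ 2 *\<^sub>R cross3 a n + x $ 3 *\<^sub>R a" for x :: "real ^ 3"
  define u where "u = cross3 a n"
  have u: "u \<bullet> a = 0" "u \<bullet> n = 0" "u \<bullet> u = 1"
    using norm_cross_dot[of a n] assms(1) n na
    by (simp_all add: u_def dot_cross_self inner_commute[of a n] flip: power2_norm_eq_inner)
  have T: "orthogonal_transformation T"
    unfolding orthogonal_transformation_def
  proof
    show "linear T" by (rule linearI) (auto simp: T_def algebra_simps)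
    have sym: "a \<bullet> u = 0" "n \<bullet> u = 0" "a \<bullet> n = 0" using u na by (simp_all add: inner_commute)
    have "T v \<bullet> T w = v $ 1 * w $ 1 + v $ 2 * w $ 2 + v $ 3 * w $ 3" for v w
      by (simp add: T_def u_def[symmetric] inner_add_left inner_add_right u na nn aa sym)
    then show "\<forall>v w. T v \<bullet> T w = v \<bullet> w" by (simp add: inner_vec_def sum_3)
  qed
  have Tin: "T x \<bullet> a = x $ 3" "T x \<bullet> n = x $ 1" "norm (T x) = norm x" for x
    using u na nn aa T orthogonal_transformation_norm[OF T]
    by (auto simp: T_def u_def[symmetric] inner_add_left inner_commute[of a n])
  have sub: "T ` wedge c C S \<subseteq> Ea - G"
  proof
    fix y assume "y \<in> T ` wedge c C S"
    then obtain x where y: "y = T x" and x: "x \<in> wedge c C S" by blast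
    define \<rho> where "\<rho> = (x $ 2)\<^sup>2 + (x $ 3)\<^sup>2 / C\<^sup>2"
    have x1: "C * \<bar>x $ 1\<bar> < S * x $ 3" "\<rho> < 1" "0 < x $ 3" "c\<^sup>2 * \<rho> < (x $ 3)\<^sup>2"
      using x by (auto simp: wedge_def \<rho>_def)
    have "(C * \<bar>x $ 1\<bar>)\<^sup>2 \<le> (S * x $ 3)\<^sup>2"
      using x1(1) C by (intro power_mono) auto
    then have "C\<^sup>2 * ((x $ 1)\<^sup>2 + (x $ 3)\<^sup>2) \<le> (C\<^sup>2 + S\<^sup>2) * (x $ 3)\<^sup>2"
      by (simp add: power_mult_distrib algebra_simps)
    then have "(x $ 1)\<^sup>2 + (x $ 3)\<^sup>2 \<le> (x $ 3)\<^sup>2 / C\<^sup>2"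
      using C(1,5) by (simp add: field_simps)
    then have "(norm x)\<^sup>2 \<le> \<rho>"
      unfolding power2_norm_eq_inner inner_vec_def sum_3 \<rho>_def by (simp add: power2_eq_square)
    then have nx: "(norm x)\<^sup>2 < 1\<^sup>2" "c\<^sup>2 * (norm x)\<^sup>2 < (x $ 3)\<^sup>2"
      using x1(2,4) mult_left_mono[of "(norm x)\<^sup>2" \<rho> "c\<^sup>2"] by simp_all
    have "norm x < 1" by (rule power2_less_imp_less[OF nx(1)]) simp
    moreover have "c * norm x < x $ 3"
      using nx(2) x1(3) by (intro power2_less_imp_less[of _ "x $ 3"]) (auto simp: power_mult_distrib)
    moreover have "- (S * x $ 3) < C * x $ 1 \<and> C * x $ 1 < S * x $ 3"
    proof -
      have "\<bar>C * x $ 1\<bar> < S * x $ 3" using x1(1) C(1) by (simp add: abs_mult)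
      then show ?thesis by linarith
    qed
    ultimately show "y \<in> Ea - G"
      unfolding y Ea_def G_def mn using Tin[of x] by (simp add: inner_add_right)
  qed
  have wm: "wedge c C S \<in> lmeasurable"
  proof (rule lmeasurable_open[OF _ open_wedge])
    have "wedge c C S \<subseteq> ball 0 1"
      using sub Tin by (auto simp: Ea_def subset_iff)
    then show "bounded (wedge c C S)" using bounded_ball bounded_subset by blast
  qed
  have "ennreal (4 / 3 * S * sqrt (C\<^sup>2 - c\<^sup>2)) \<le> emeasure lebesgue (wedge c C S)"
    using emeasure_wedge_ge[of C S c] C assms(4) by (simp add: open_wedge borel_open)
  also have "\<dots> = ennreal (measure lebesgue (wedge c C S))"
    using wm by (simp add: emeasure_eq_measure2)
  finally have "4 / 3 * S * sqrt (C\<^sup>2 - c\<^sup>2) \<le> measure lebesgue (wedge c C S)" by simp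
  also have "\<dots> = measure lebesgue (T ` wedge c C S)"
    by (rule measure_orthogonal_image[OF T wm, symmetric])
  also have "\<dots> \<le> measure lebesgue (Ea - G)"
    using sub lm measurable_orthogonal_image[OF T wm]
    by (intro measure_mono_fmeasurable) (auto intro: fmeasurableD)
  also have "\<dots> = measure lebesgue Ea - measure lebesgue G"
    using \<open>G \<subseteq> Ea\<close> lm by (intro measurable_measure_Diff) (auto intro: fmeasurableD)
  also have "\<dots> = measure lebesgue Ea - measure lebesgue Eb" using EbG by simp
  also have "\<dots> = measure lebesgue (Ea - Eb)"
    using \<open>Eb \<subseteq> Ea\<close> lm by (intro measurable_measure_Diff[symmetric]) (auto intro: fmeasurableD)
  also have "\<dots> = measure lebesgue (Ea - Eb - N)"
    using lm negligible_cone_boundary[OF assms(4) c1 assms(2)]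
    by (intro measure_Diff_null_set[symmetric]) (auto intro: fmeasurableD simp: N_def negligible_iff_null_sets)
  also have "\<dots> \<le> measure lebesgue D1"
    using lm negligible_cone_boundary[OF assms(4) c1 assms(2)]
    by (intro measure_mono_fmeasurable) (auto intro: fmeasurableD simp: N_def D1_def Ea_def Eb_def negligible_iff_null_sets)
  finally have main: "4 / 3 * S * sqrt (C\<^sup>2 - c\<^sup>2) \<le> measure lebesgue D1" .
  have "straddle c a b = D1 \<union> D2" "D1 \<inter> D2 = {}"
    by (auto simp: straddle_def D1_def D2_def mult_less_0_iff)
  then have "measure lebesgue (straddle c a b) = measure lebesgue D1 + measure lebesgue D2"
    using lm by (simp add: measure_Un3)
  then show ?thesis using main D2 by (simp add: S_def C(2))
qed

section \<open>Length bound for thick curves\<close>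

text \<open>On an interval of length \<open>h\<close> where \<open>D\<close> varies by at most \<open>e'\<close>, chord and arc length both differ by at most
  \<open>e' * h\<close> from \<open>h\<close> times the speed at the left end point.\<close>

lemma chord_sum_approximates_length:
  fixes g D :: "real \<Rightarrow> 'a::euclidean_space"
  assumes D: "\<And>t. (g has_vector_derivative D t) (at t)" and cD: "continuous_on UNIV D"
    and "0 < T" "0 < e"
  obtains N :: nat where "0 < N"
    "\<And>j. j < N \<Longrightarrow> norm (g (T * real j / N) - g (T * real (Suc j) / N)) \<le> e"
    "integral {0..T} (\<lambda>t. norm (D t)) - e
       \<le> (\<Sum>j<N. norm (g (T * real j / N) - g (T * real (Suc j) / N)))"
proof -
  \<comment> \<open>Both comparisons together cost \<open>2 * e' * h\<close> per interval, and the intervals have total length \<open>T\<close>.\<close>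
  define e' where "e' = e / (2 * T)"
  have e': "0 < e'" using assms by (simp add: e'_def)
  have cg: "continuous_on UNIV g"
    using D by (auto intro!: continuous_at_imp_continuous_on has_vector_derivative_continuous)
  have "uniformly_continuous_on {0..T} D" "uniformly_continuous_on {0..T} g"
    using cD cg by (auto intro!: compact_uniformly_continuous intro: continuous_on_subset)
  then obtain d1 d2 where d1: "0 < d1" "\<And>s t. s \<in> {0..T} \<Longrightarrow> t \<in> {0..T} \<Longrightarrow> dist s t < d1 \<Longrightarrow> dist (D s) (D t) < e'"
    and d2: "0 < d2" "\<And>s t. s \<in> {0..T} \<Longrightarrow> t \<in> {0..T} \<Longrightarrow> dist s t < d2 \<Longrightarrow> dist (g s) (g t) < e"
    using e' \<open>0 < e\<close> unfolding uniformly_continuous_on_def by metis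
  obtain N :: nat where N: "T / min d1 d2 < N" using reals_Archimedean2 by blast
  have Npos: "0 < N"
  proof -
    have "0 < T / min d1 d2" using assms d1(1) d2(1) by simp
    then show ?thesis using N by (simp only: of_nat_0_less_iff[where 'a=real, symmetric])
  qed
  have small: "T / N < min d1 d2"
  proof -
    have "T < real N * min d1 d2" using N d1(1) d2(1) by (subst (asm) pos_divide_less_eq) auto
    then show ?thesis using Npos by (subst pos_divide_less_eq) (auto simp only: of_nat_0_less_iff mult.commute)
  qed
  define h where "h = T / N"
  define t where "t j = T * real j / N" for j
  have t: "t j \<in> {0..T}" if "j \<le> N" for j
    using that Npos assms by (auto simp: t_def field_simps)
  have tS: "t (Suc j) - t j = h" for j by (simp add: t_def h_def distrib_left add_divide_distrib)
  have near: "dist s r < min d1 d2" if "s \<in> {t j..t (Suc j)}" "r \<in> {t j..t (Suc j)}" for s r j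
    using that tS[of j] small[folded h_def] by (auto simp: dist_real_def)
  have tle: "t j \<le> t (Suc j)" for j
  proof -
    have "0 \<le> h" using assms by (simp add: h_def)
    then show ?thesis using tS[of j] by linarith
  qed
  have in0T: "s \<in> {0..T}" if "s \<in> {t j..t (Suc j)}" "j < N" for s j
    using that t[of j] t[of "Suc j"] by auto
  define I where "I x = integral {0..x} (\<lambda>t. norm (D t))" for x
  have cn: "(\<lambda>t. norm (D t)) integrable_on {a..b}" for a b
    using cD by (intro integrable_continuous_real continuous_intros) (auto intro: continuous_on_subset)
  have step: "I (t (Suc j)) - I (t j) - 2 * e' * h \<le> norm (g (t j) - g (t (Suc j)))" if j: "j < N" for j
  proof -
    let ?a = "t j" and ?b = "t (Suc j)"
    have ab: "?a \<le> ?b" "0 \<le> ?a" using tle t[of j] j by auto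
    have close: "norm (D s - D ?a) \<le> e'" if "s \<in> {?a..?b}" for s
      using d1(2)[OF in0T[OF that j] in0T[of ?a j]] near[OF that, of ?a] ab j by (auto simp: dist_norm)
    have "I ?b - I ?a = integral {?a..?b} (\<lambda>t. norm (D t))"
      using Henstock_Kurzweil_Integration.integral_combine[OF ab(2) ab(1) cn] by (simp add: I_def)
    also have "\<dots> \<le> integral {?a..?b} (\<lambda>t. norm (D ?a) + e')"
    proof (rule integral_le[OF cn])
      fix s assume "s \<in> {?a..?b}"
      from close[OF this] show "norm (D s) \<le> norm (D ?a) + e'"
        using norm_triangle_ineq2[of "D s" "D ?a"] by linarith
    qed auto
    also have "\<dots> = (norm (D ?a) + e') * h" using ab tS[of j] by simp
    finally have 1: "I ?b - I ?a \<le> (norm (D ?a) + e') * h" .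
    have "(D has_integral (g ?b - g ?a)) {?a..?b}"
      using ab D by (intro fundamental_theorem_of_calculus) (auto intro: has_vector_derivative_at_within)
    moreover have "((\<lambda>s. D ?a) has_integral h *\<^sub>R D ?a) {?a..?b}"
      using has_integral_const_real[of "D ?a" ?a ?b] ab tS[of j] by simp
    ultimately have "((\<lambda>s. D s - D ?a) has_integral (g ?b - g ?a - h *\<^sub>R D ?a)) {?a..?b}"
      by (rule has_integral_diff)
    then have "norm (g ?b - g ?a - h *\<^sub>R D ?a) \<le> e' * measure lborel {?a..?b}"
      using close e' by (intro has_integral_bound_real[where S="{}"]) auto
    then have "norm (g ?b - g ?a - h *\<^sub>R D ?a) \<le> e' * h" using ab tS[of j] by simp
    moreover have "0 \<le> h" using tle[of j] tS[of j] by linarith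
    then have "norm (D ?a) * h = norm (h *\<^sub>R D ?a)" by simp
    moreover have "norm (h *\<^sub>R D ?a) \<le> norm (g ?b - g ?a) + norm (g ?b - g ?a - h *\<^sub>R D ?a)"
      using norm_triangle_ineq4[of "g ?b - g ?a" "g ?b - g ?a - h *\<^sub>R D ?a"] by simp
    moreover have "I ?b - I ?a \<le> norm (D ?a) * h + e' * h"
      using 1 by (simp only: distrib_right)
    ultimately have "I ?b - I ?a \<le> norm (g ?b - g ?a) + 2 * (e' * h)" by linarith
    then show ?thesis by (simp add: norm_minus_commute)
  qed
  have "I T - e = (\<Sum>j<N. I (t (Suc j)) - I (t j) - 2 * e' * h)"
  proof -
    have "(\<Sum>j<N. I (t (Suc j)) - I (t j)) = I (t N) - I (t 0)" by (rule sum_lessThan_telescope)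
    also have "\<dots> = I T" using Npos by (simp add: t_def I_def)
    finally show ?thesis using Npos assms by (simp add: sum_subtractf e'_def h_def)
  qed
  also have "\<dots> \<le> (\<Sum>j<N. norm (g (t j) - g (t (Suc j))))"
    by (intro sum_mono step) auto
  finally have 1: "I T - e \<le> (\<Sum>j<N. norm (g (t j) - g (t (Suc j))))" .
  have 2: "norm (g (t j) - g (t (Suc j))) \<le> e" if "j < N" for j
    using d2(2)[OF t[of j] t[of "Suc j"]] near[of "t j" j "t (Suc j)"] tle[of j] that by (auto simp: dist_norm)
  show thesis using that[of N] Npos 1 2 by (simp add: I_def t_def)
qed

text \<open>The sum is the integral of the number of sets that contain a point.\<close>

lemma sum_measure_le_multiplicity:
  assumes "finite J" and A: "\<And>j. j \<in> J \<Longrightarrow> A j \<in> fmeasurable M" and B: "B \<in> fmeasurable M"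
    and AB: "\<And>j. j \<in> J \<Longrightarrow> A j \<subseteq> B" and k: "\<And>x. x \<in> B \<Longrightarrow> card {j \<in> J. x \<in> A j} \<le> k"
  shows "(\<Sum>j\<in>J. measure M (A j)) \<le> real k * measure M B"
proof -
  have int: "integrable M (indicator (A j) :: _ \<Rightarrow> real)" if "j \<in> J" for j
    using A[OF that] by (simp add: fmeasurable_def less_top[symmetric])
  have intB: "integrable M (indicator B :: _ \<Rightarrow> real)"
    using B by (simp add: fmeasurable_def less_top[symmetric])
  have spA: "A j \<inter> space M = A j" if "j \<in> J" for j
    using A[OF that] by (auto dest: fmeasurableD sets.sets_into_space)
  have spB: "B \<inter> space M = B" using B by (auto dest: fmeasurableD sets.sets_into_space)
  have "(\<Sum>j\<in>J. measure M (A j)) = (\<Sum>j\<in>J. \<integral>x. indicator (A j) x \<partial>M)"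
    using spA by (intro sum.cong) auto
  also have "\<dots> = (\<integral>x. (\<Sum>j\<in>J. indicator (A j) x) \<partial>M)"
    using int by (intro Bochner_Integration.integral_sum[symmetric])
  also have "\<dots> \<le> (\<integral>x. real k * indicator B x \<partial>M)"
  proof (rule integral_mono)
    show "integrable M (\<lambda>x. \<Sum>j\<in>J. indicator (A j) x :: real)" using int by auto
    show "integrable M (\<lambda>x. real k * indicator B x)" using intB by auto
    fix x
    have "(\<Sum>j\<in>J. indicator (A j) x :: real) = card {j \<in> J. x \<in> A j}"
      using assms(1) by (simp add: indicator_def sum.If_cases Int_def)
    also have "\<dots> \<le> real k * indicator B x"
    proof (cases "x \<in> B")
      case False
      then have *: "{j \<in> J. x \<in> A j} = {}" using AB by auto
      show ?thesis using False by (subst *) simp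
    qed (use k in auto)
    finally show "(\<Sum>j\<in>J. indicator (A j) x :: real) \<le> real k * indicator B x" .
  qed
  also have "\<dots> = real k * measure M B" using spB by simp
  finally show ?thesis .
qed

text \<open>The circle has Euclidean radius \<open>sin r\<close>, which would be the circumradius of three points of the curve
  on it. Parameters are taken from a single period because the curve is injective there.\<close>

lemma thick_curve_meets_small_circle_at_most_twice:
  assumes g: "closed_curve_S2 g" and th: "ereal (sin \<phi>) \<le> thickness (range g)"
    and r: "0 < r" "r < \<phi>" "\<phi> \<le> pi / 2" and p: "norm p = 1"
    and R: "R \<subseteq> {0..<2 * pi}" "\<And>t. t \<in> R \<Longrightarrow> g t \<bullet> p = cos r"
  shows "\<not> (\<exists>t1\<in>R. \<exists>t2\<in>R. \<exists>t3\<in>R. t1 \<noteq> t2 \<and> t2 \<noteq> t3 \<and> t1 \<noteq> t3)"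
proof
  assume "\<exists>t1\<in>R. \<exists>t2\<in>R. \<exists>t3\<in>R. t1 \<noteq> t2 \<and> t2 \<noteq> t3 \<and> t1 \<noteq> t3"
  then obtain a b c where R3: "a \<in> R" "b \<in> R" "c \<in> R" and ne: "a \<noteq> b" "b \<noteq> c" "a \<noteq> c" by blast
  have nrm: "norm (g t) = 1" for t using g by (auto simp: closed_curve_S2_def image_subset_iff)
  have inj: "inj_on g {0..<2 * pi}" using g by (simp add: closed_curve_S2_def)
  have gne: "g a \<noteq> g b" "g b \<noteq> g c" "g a \<noteq> g c"
    using inj_onD[OF inj] R3 R(1) ne by blast+
  have "circumradius (g a) (g b) (g c) = ereal (sqrt (1 - (cos r)\<^sup>2))"
    using R(2) R3 by (intro circumradius_on_sphere[OF p nrm nrm nrm gne]) auto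
  also have "sqrt (1 - (cos r)\<^sup>2) = sin r"
    using r by (simp add: sin_squared_eq[symmetric] sin_ge_zero)
  finally have "thickness (range g) \<le> ereal (sin r)"
    unfolding thickness_def using gne
    by (intro Inf_lower CollectI exI[of _ "g a"] exI[of _ "g b"] exI[of _ "g c"] conjI rangeI) simp_all
  then have "sin \<phi> \<le> sin r" using th by (metis ereal_less_eq(3) order.trans)
  moreover have "sin r < sin \<phi>" using r by (intro sin_monotone_2pi) auto
  ultimately show False by simp
qed

text \<open>By the intermediate value theorem the arc from \<open>a\<close> to \<open>b\<close> crosses the circle about \<open>sgn x\<close>. As the
  end points lie strictly on different sides, the crossing is an interior point, so that crossings
  found on adjacent intervals are different.\<close>

lemma straddle_imp_crossing:
  fixes g :: "real \<Rightarrow> real ^ 3"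
  assumes "continuous_on UNIV g" "a \<le> b" "x \<in> straddle c (g a) (g b)"
  obtains \<tau> where "a < \<tau>" "\<tau> < b" "g \<tau> \<bullet> sgn x = c"
proof -
  define f where "f t = x \<bullet> g t - c * norm x" for t
  have cf: "continuous_on {a..b} f"
    unfolding f_def using continuous_on_subset[OF assms(1)] by (intro continuous_intros) auto
  have ab: "f a * f b < 0" using assms(3) by (simp add: straddle_def f_def)
  have "\<exists>\<tau>. a \<le> \<tau> \<and> \<tau> \<le> b \<and> f \<tau> = 0"
  proof (cases "f a < 0")
    case True
    then show ?thesis using ab IVT'[of f a 0 b] cf assms(2) by (auto simp: mult_less_0_iff)
  next
    case False
    then show ?thesis using ab IVT2'[of f b 0 a] cf assms(2) by (auto simp: mult_less_0_iff)
  qed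
  then obtain \<tau> where \<tau>: "a \<le> \<tau>" "\<tau> \<le> b" "f \<tau> = 0" by blast
  moreover have "\<tau> \<noteq> a" "\<tau> \<noteq> b" using ab \<tau>(3) by auto
  moreover have "x \<noteq> 0" using ab by (auto simp: f_def)
  then have "g \<tau> \<bullet> sgn x = c" using \<tau>(3) by (simp add: f_def sgn_div_norm inner_commute field_simps)
  ultimately show thesis using that[of \<tau>] by simp
qed

text \<open>A point \<open>x\<close> in three of the sets would give three parameters at which the curve meets the circle of
  radius \<open>r\<close> about \<open>sgn x\<close>. So the sum is at most twice the volume of the unit ball.\<close>

lemma sum_measure_straddle_le:
  assumes g: "closed_curve_S2 g" and th: "ereal (sin \<phi>) \<le> thickness (range g)"
    and r: "0 < r" "r < \<phi>" "\<phi> \<le> pi / 2" and N: "0 < N"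
  shows "(\<Sum>j<N. measure lebesgue (straddle (cos r) (g (2 * pi * real j / real N)) (g (2 * pi * real (Suc j) / real N))))
           \<le> 8 / 3 * pi"
proof -
  define t where "t j = 2 * pi * real j / real N" for j
  define A where "A j = straddle (cos r) (g (t j)) (g (t (Suc j)))" for j
  have tmono: "t i \<le> t j" if "i \<le> j" for i j using that by (simp add: t_def divide_right_mono)
  have t0N: "t 0 = 0" "t N = 2 * pi" using N by (simp_all add: t_def)
  have cg: "continuous_on UNIV g"
    using g by (auto simp: closed_curve_S2_def intro: C1_differentiable_imp_continuous_on)
  have card: "card {j \<in> {..<N}. x \<in> A j} \<le> 2" for x
  proof (rule ccontr)
    let ?J = "{j \<in> {..<N}. x \<in> A j}"
    assume "\<not> card ?J \<le> 2"
    then have "3 \<le> card ?J" by simp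
    then obtain T where T: "T \<subseteq> ?J" "card T = 3" by (rule obtain_subset_with_card_n)
    from T(2) obtain i j k where Tijk: "T = {i, j, k}" and ne: "i \<noteq> j" "j \<noteq> k" "i \<noteq> k"
      unfolding card_3_iff by blast
    have ijk: "i \<in> ?J" "j \<in> ?J" "k \<in> ?J" using T(1) unfolding Tijk by blast+
    have "\<exists>\<tau>. t j < \<tau> \<and> \<tau> < t (Suc j) \<and> g \<tau> \<bullet> sgn x = cos r" if "j \<in> ?J" for j
    proof -
      have "x \<in> straddle (cos r) (g (t j)) (g (t (Suc j)))" using that by (simp add: A_def)
      then obtain \<tau> where "t j < \<tau>" "\<tau> < t (Suc j)" "g \<tau> \<bullet> sgn x = cos r"
        using straddle_imp_crossing[OF cg tmono[of j "Suc j"]] by auto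
      then show ?thesis by blast
    qed
    then have "\<forall>j\<in>?J. \<exists>\<tau>. t j < \<tau> \<and> \<tau> < t (Suc j) \<and> g \<tau> \<bullet> sgn x = cos r" by blast
    then obtain \<tau> where "\<forall>j\<in>?J. t j < \<tau> j \<and> \<tau> j < t (Suc j) \<and> g (\<tau> j) \<bullet> sgn x = cos r"
      by (rule bchoice[THEN exE])
    then have \<tau>: "t j < \<tau> j \<and> \<tau> j < t (Suc j) \<and> g (\<tau> j) \<bullet> sgn x = cos r" if "j \<in> ?J" for j
      using that by blast
    have diff: "\<tau> i \<noteq> \<tau> j" if "i \<in> ?J" "j \<in> ?J" "i \<noteq> j" for i j
    proof (cases "i < j")
      case True
      then show ?thesis using \<tau>[OF that(1)] \<tau>[OF that(2)] tmono[of "Suc i" j] by auto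
    next
      case False
      then show ?thesis using \<tau>[OF that(1)] \<tau>[OF that(2)] tmono[of "Suc j" i] that(3) by auto
    qed
    have "x \<noteq> 0" using ijk(1) by (auto simp: A_def straddle_def)
    then have "norm (sgn x) = 1" by (simp add: norm_sgn)
    moreover have "\<tau> ` ?J \<subseteq> {0..<2 * pi}"
    proof
      fix s assume "s \<in> \<tau> ` ?J"
      then obtain j where j: "j \<in> ?J" "s = \<tau> j" by blast
      then have "0 \<le> t j" "t (Suc j) \<le> 2 * pi" using tmono[of 0 j] tmono[of "Suc j" N] t0N by auto
      then show "s \<in> {0..<2 * pi}" using \<tau>[OF j(1)] j(2) by auto
    qed
    moreover have "g s \<bullet> sgn x = cos r" if "s \<in> \<tau> ` ?J" for s using that \<tau> by blast
    ultimately have "\<not> (\<exists>t1\<in>\<tau> ` ?J. \<exists>t2\<in>\<tau> ` ?J. \<exists>t3\<in>\<tau> ` ?J. t1 \<noteq> t2 \<and> t2 \<noteq> t3 \<and> t1 \<noteq> t3)"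
      by (rule thick_curve_meets_small_circle_at_most_twice[OF g th r])
    then show False using diff[OF ijk(1,2) ne(1)] diff[OF ijk(2,3) ne(2)] diff[OF ijk(1,3) ne(3)] ijk by blast
  qed
  have "(\<Sum>j<N. measure lebesgue (A j)) \<le> real 2 * measure lebesgue (ball 0 1 :: (real ^ 3) set)"
    using card by (intro sum_measure_le_multiplicity) (auto simp: A_def straddle_lmeasurable, auto simp: straddle_def)
  also have "\<dots> = 8 / 3 * pi" by (simp add: content_ball unit_ball_vol_3)
  finally show ?thesis by (simp add: A_def t_def)
qed

text \<open>Discrete form of \<open>4 * L * sin r \<le> 8 * pi\<close>: with subdivision points at distance at most \<open>e\<close>, the
  volumes of the straddling cones have sum at least \<open>4 / 3 * sqrt ((sin r)\<^sup>2 - e\<^sup>2 / 4) * (L - e)\<close> and at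
  most twice the volume of the ball.\<close>

lemma length_bound_small_radius:
  assumes g: "closed_curve_S2 g" and th: "ereal (sin \<phi>) \<le> thickness (range g)"
    and r: "0 < r" "r < \<phi>" "\<phi> \<le> pi / 2"
  shows "sin r * curve_length g \<le> 2 * pi"
proof -
  define D where "D t = vector_derivative g (at t)" for t
  have gD: "(g has_vector_derivative D t) (at t)" and cD: "continuous_on UNIV D" for t
    using g unfolding closed_curve_S2_def C1_differentiable_on_eq D_def
    by (auto simp: vector_derivative_works[symmetric])
  have L: "curve_length g = integral {0..2 * pi} (\<lambda>t. norm (D t))"
    by (simp add: curve_length_def D_def)
  have nrm: "norm (g t) = 1" for t using g by (auto simp: closed_curve_S2_def image_subset_iff)
  have sr: "0 < sin r" using r by (intro sin_gt_zero) auto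
  have sc: "1 - (cos r)\<^sup>2 = (sin r)\<^sup>2" by (simp add: sin_squared_eq)
  have bound: "sqrt ((sin r)\<^sup>2 - e\<^sup>2 / 4) * (curve_length g - e) \<le> 2 * pi" if e: "0 < e" "e < sin r" for e
  proof -
    obtain N :: nat where N: "0 < N"
      "\<And>j. j < N \<Longrightarrow> norm (g (2 * pi * real j / N) - g (2 * pi * real (Suc j) / N)) \<le> e"
      "curve_length g - e \<le> (\<Sum>j<N. norm (g (2 * pi * real j / N) - g (2 * pi * real (Suc j) / N)))"
      using chord_sum_approximates_length[OF gD cD _ e(1), of "2 * pi"] unfolding L by auto
    define d where "d j = norm (g (2 * pi * real j / N) - g (2 * pi * real (Suc j) / N))" for j
    define q where "q = sqrt ((sin r)\<^sup>2 - e\<^sup>2 / 4)"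
    have "e\<^sup>2 \<le> (sin r)\<^sup>2" using e by (intro power_mono) auto
    then have "e\<^sup>2 / 4 \<le> (sin r)\<^sup>2" using zero_le_power2[of e] by linarith
    then have q0: "0 \<le> q" by (simp add: q_def)
    have piece: "4 / 3 * (q * d j)
        \<le> measure lebesgue (straddle (cos r) (g (2 * pi * real j / N)) (g (2 * pi * real (Suc j) / N)))"
      if j: "j < N" for j
    proof (cases "d j = 0")
      case False
      have de: "(d j)\<^sup>2 \<le> e\<^sup>2" using N(2)[OF j] by (intro power_mono) (auto simp: d_def)
      have "e\<^sup>2 < (sin r)\<^sup>2" using e by (intro power_strict_mono) auto
      then have lt: "(d j)\<^sup>2 / 4 < (sin r)\<^sup>2" using de zero_le_power2[of e] by linarith
      have "q \<le> sqrt (1 - (d j)\<^sup>2 / 4 - (cos r)\<^sup>2)"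
        unfolding q_def using de sc by (intro real_sqrt_le_mono) linarith
      then have "4 / 3 * (q * d j) \<le> 4 / 3 * d j * sqrt (1 - (d j)\<^sup>2 / 4 - (cos r)\<^sup>2)"
        using mult_left_mono[of q "sqrt (1 - (d j)\<^sup>2 / 4 - (cos r)\<^sup>2)" "4 / 3 * d j"]
        by (simp add: d_def mult.commute)
      also have "\<dots> \<le> measure lebesgue (straddle (cos r) (g (2 * pi * real j / N)) (g (2 * pi * real (Suc j) / N)))"
        unfolding d_def
      proof (rule measure_straddle_ge[OF nrm nrm])
        show "g (2 * pi * real j / N) \<noteq> g (2 * pi * real (Suc j) / N)" using False by (auto simp: d_def)
        show "0 \<le> cos r" using r by (intro cos_ge_zero) auto
        show "(cos r)\<^sup>2 < 1 - (norm (g (2 * pi * real j / N) - g (2 * pi * real (Suc j) / N)))\<^sup>2 / 4"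
          using lt sc unfolding d_def by linarith
      qed
      finally show ?thesis .
    qed simp
    have "4 / 3 * (q * (curve_length g - e)) \<le> 4 / 3 * (q * (\<Sum>j<N. d j))"
      using N(3) q0 by (intro mult_left_mono) (auto simp: d_def)
    also have "\<dots> = (\<Sum>j<N. 4 / 3 * (q * d j))" by (simp add: sum_distrib_left)
    also have "\<dots> \<le> (\<Sum>j<N. measure lebesgue (straddle (cos r) (g (2 * pi * real j / N)) (g (2 * pi * real (Suc j) / N))))"
      by (intro sum_mono piece) auto
    also have "\<dots> \<le> 8 / 3 * pi" by (rule sum_measure_straddle_le[OF g th r N(1)])
    finally show ?thesis by (simp add: q_def mult.commute)
  qed
  have "((\<lambda>e. sqrt ((sin r)\<^sup>2 - e\<^sup>2 / 4) * (curve_length g - e))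
      \<longlongrightarrow> sqrt ((sin r)\<^sup>2 - 0\<^sup>2 / 4) * (curve_length g - 0)) (at_right 0)"
    by (intro tendsto_intros) simp
  then have "sqrt ((sin r)\<^sup>2 - 0\<^sup>2 / 4) * (curve_length g - 0) \<le> 2 * pi"
  proof (rule tendsto_upperbound)
    show "\<forall>\<^sub>F e in at_right 0. sqrt ((sin r)\<^sup>2 - e\<^sup>2 / 4) * (curve_length g - e) \<le> 2 * pi"
      using eventually_at_right_less[of 0] eventually_at_right_real[OF sr]
      by eventually_elim (use bound in auto)
  qed simp
  then show ?thesis using sr by simp
qed

lemma admissible_length_le:
  assumes "admissible (sin \<phi>) g" "0 < \<phi>" "\<phi> \<le> pi / 2"
  shows "curve_length g \<le> 2 * pi / sin \<phi>"
proof -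
  have "((\<lambda>r. sin r * curve_length g) \<longlongrightarrow> sin \<phi> * curve_length g) (at_left \<phi>)"
    by (intro tendsto_intros)
  then have "sin \<phi> * curve_length g \<le> 2 * pi"
  proof (rule tendsto_upperbound)
    show "\<forall>\<^sub>F r in at_left \<phi>. sin r * curve_length g \<le> 2 * pi"
      using eventually_at_left_real[OF assms(2)]
      by eventually_elim (use length_bound_small_radius assms in \<open>auto simp: admissible_def\<close>)
  qed simp
  moreover have "0 < sin \<phi>" using assms by (intro sin_gt_zero) auto
  ultimately show ?thesis by (simp add: field_simps)
qed

section \<open>Gluing pieces along the integers\<close>

text \<open>At the right end point of its unit interval a piece agrees with the next one, which is the one
  selected by the floor function.\<close>

lemma floor_glue_eq:
  fixes X :: "int \<Rightarrow> real \<Rightarrow> 'a"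
  assumes "\<And>M. X (M - 1) (of_int M) = X M (of_int M)" and "s \<in> {of_int M..of_int M + 1}"
  shows "X \<lfloor>s\<rfloor> s = X M s"
proof (cases "s = of_int M + 1")
  case True
  then have "\<lfloor>s\<rfloor> = M + 1" by simp
  then show ?thesis using assms(1)[of "M + 1"] True by simp
next
  case False
  then have "\<lfloor>s\<rfloor> = M" using assms(2) by (simp add: floor_eq_iff)
  then show ?thesis by simp
qed

text \<open>One unit interval reaches strictly to the left of \<open>s\<close> and the other strictly to the right. Limits
  at \<open>s\<close> can therefore be checked on the two intervals separately, and on each of them the glued
  function is a single piece.\<close>

lemma at_within_unit_intervals:
  fixes s :: real
  shows "at s = sup (at s within {of_int (\<lceil>s\<rceil> - 1)..of_int (\<lceil>s\<rceil> - 1) + 1})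
                    (at s within {of_int \<lfloor>s\<rfloor>..of_int \<lfloor>s\<rfloor> + 1})"
    and "s \<in> {of_int (\<lceil>s\<rceil> - 1)..of_int (\<lceil>s\<rceil> - 1) + 1}" "s \<in> {of_int \<lfloor>s\<rfloor>..of_int \<lfloor>s\<rfloor> + 1}"
proof -
  let ?a = "of_int (\<lceil>s\<rceil> - 1) :: real" and ?b = "of_int \<lfloor>s\<rfloor> + 1 :: real"
  have ab: "?a < s" "s < ?b" "of_int \<lfloor>s\<rfloor> \<le> s" "s \<le> of_int \<lceil>s\<rceil>"
    and fc: "of_int \<lfloor>s\<rfloor> \<le> (of_int \<lceil>s\<rceil> :: real)" by linarith+
  have "at s = at s within ({?a..?a + 1} \<union> {of_int \<lfloor>s\<rfloor>..?b})"
  proof (rule at_within_interior[symmetric])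
    have "{?a<..<?b} \<subseteq> {?a..?a + 1} \<union> {of_int \<lfloor>s\<rfloor>..?b}"
    proof
      fix x assume x: "x \<in> {?a<..<?b}"
      show "x \<in> {?a..?a + 1} \<union> {of_int \<lfloor>s\<rfloor>..?b}"
      proof (cases "of_int \<lfloor>s\<rfloor> \<le> x")
        case False
        then have "x \<le> of_int \<lceil>s\<rceil>" using fc by linarith
        then show ?thesis using x by simp
      qed (use x in auto)
    qed
    then have "{?a<..<?b} \<subseteq> interior ({?a..?a + 1} \<union> {of_int \<lfloor>s\<rfloor>..?b})"
      by (simp add: interior_maximal)
    then show "s \<in> interior ({?a..?a + 1} \<union> {of_int \<lfloor>s\<rfloor>..?b})" using ab by auto
  qed
  then show "at s = sup (at s within {?a..?a + 1}) (at s within {of_int \<lfloor>s\<rfloor>..?b})"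
    by (simp only: at_within_union)
  show "s \<in> {?a..?a + 1}" "s \<in> {of_int \<lfloor>s\<rfloor>..?b}" using ab by auto
qed

lemma floor_glue_continuous:
  fixes X :: "int \<Rightarrow> real \<Rightarrow> 'a::topological_space"
  assumes match: "\<And>M. X (M - 1) (of_int M) = X M (of_int M)"
    and cont: "\<And>M. continuous_on UNIV (X M)"
  shows "continuous_on UNIV (\<lambda>s. X \<lfloor>s\<rfloor> s)"
proof (rule continuous_at_imp_continuous_on, rule ballI)
  fix s :: real
  have piece: "((\<lambda>s. X \<lfloor>s\<rfloor> s) \<longlongrightarrow> X \<lfloor>s\<rfloor> s) (at s within {of_int M..of_int M + 1})"
    if "s \<in> {of_int M..of_int M + 1}" for M
  proof -
    have "(X M \<longlongrightarrow> X M s) (at s within {of_int M..of_int M + 1})"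
      using continuous_on_subset[OF cont[of M], of "{of_int M..of_int M + 1}"] that
      by (simp add: continuous_on_def)
    moreover have "\<forall>\<^sub>F t in at s within {of_int M..of_int M + 1}. X M t = X \<lfloor>t\<rfloor> t"
      using floor_glue_eq[where X=X, OF match] by (auto simp: eventually_at_filter)
    ultimately show ?thesis
      using floor_glue_eq[where X=X, OF match that] by (auto intro: Lim_transform_eventually)
  qed
  show "isCont (\<lambda>s. X \<lfloor>s\<rfloor> s) s"
    unfolding isCont_def by (subst at_within_unit_intervals(1), rule filterlim_sup)
      (rule piece, rule at_within_unit_intervals)+
qed

lemma floor_glue_has_vector_derivative:
  fixes X X' :: "int \<Rightarrow> real \<Rightarrow> 'a::real_normed_vector"
  assumes match: "\<And>M. X (M - 1) (of_int M) = X M (of_int M)"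
    and match': "\<And>M. X' (M - 1) (of_int M) = X' M (of_int M)"
    and der: "\<And>M s. (X M has_vector_derivative X' M s) (at s)"
  shows "((\<lambda>s. X \<lfloor>s\<rfloor> s) has_vector_derivative X' \<lfloor>s\<rfloor> s) (at s)"
proof -
  have piece: "((\<lambda>s. X \<lfloor>s\<rfloor> s) has_vector_derivative X' \<lfloor>s\<rfloor> s) (at s within {of_int M..of_int M + 1})"
    if "s \<in> {of_int M..of_int M + 1}" for M
  proof -
    have "(X M has_vector_derivative X' \<lfloor>s\<rfloor> s) (at s within {of_int M..of_int M + 1})"
      using der[of M s] floor_glue_eq[where X=X', OF match' that]
      by (simp add: has_vector_derivative_at_within)
    then show ?thesis
      by (rule has_vector_derivative_transform[OF that, rotated])
        (use floor_glue_eq[where X=X, OF match] in auto)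
  qed
  have "((\<lambda>s. X \<lfloor>s\<rfloor> s) has_vector_derivative X' \<lfloor>s\<rfloor> s) (at s within {of_int (\<lceil>s\<rceil> - 1)..of_int (\<lceil>s\<rceil> - 1) + 1})"
    "((\<lambda>s. X \<lfloor>s\<rfloor> s) has_vector_derivative X' \<lfloor>s\<rfloor> s) (at s within {of_int \<lfloor>s\<rfloor>..of_int \<lfloor>s\<rfloor> + 1})"
    by (rule piece, rule at_within_unit_intervals)+
  then show ?thesis
    unfolding has_vector_derivative_def has_derivative_within
    by (subst at_within_unit_intervals(1)) (auto intro: filterlim_sup)
qed

section \<open>Odd multiples of the angle\<close>

lemma theta_pos: "1 \<le> n \<Longrightarrow> 0 < \<theta> n" by (simp add: \<theta>_def)

lemma four_n_theta: "1 \<le> n \<Longrightarrow> 4 * real n * \<theta> n = 2 * pi" by (simp add: \<theta>_def)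

lemma cos_int_theta_eq_iff:
  assumes "1 \<le> n"
  shows "cos (of_int J * \<theta> n) = cos (of_int J' * \<theta> n) \<longleftrightarrow>
     4 * int n dvd J - J' \<or> 4 * int n dvd J + J'"
proof -
  have pos: "0 < \<theta> n" using theta_pos[OF assms] .
  have per: "2 * of_int q * pi = of_int (4 * int n * q) * \<theta> n" for q
  proof -
    have "of_int (4 * int n * q) * \<theta> n = (4 * real n * \<theta> n) * of_int q" by simp
    then show ?thesis by (simp only: four_n_theta[OF assms]) simp
  qed
  have *: "x * \<theta> n = y * \<theta> n \<longleftrightarrow> x = y" for x y using pos by simp
  have "cos (of_int J * \<theta> n) = cos (of_int J' * \<theta> n) \<longleftrightarrow>
     (\<exists>q::int. of_int J * \<theta> n = of_int J' * \<theta> n + 2 * of_int q * pi \<or> of_int J * \<theta> n = - (of_int J' * \<theta> n) + 2 * of_int q * pi)"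
    unfolding cos_eq by (auto elim!: Ints_cases)
  also have "\<dots> \<longleftrightarrow> (\<exists>q::int. J = J' + 4 * int n * q \<or> J = - J' + 4 * int n * q)"
  proof (intro arg_cong[where f=Ex] ext)
    fix q :: int
    have "of_int J * \<theta> n = of_int J' * \<theta> n + 2 * of_int q * pi \<longleftrightarrow> J = J' + 4 * int n * q"
      unfolding per using *[of "of_int J" "of_int (J' + 4 * int n * q)"]
      by (simp only: of_int_add of_int_eq_iff distrib_right) (metis of_int_add of_int_eq_iff)
    moreover have "of_int J * \<theta> n = - (of_int J' * \<theta> n) + 2 * of_int q * pi \<longleftrightarrow> J = - J' + 4 * int n * q"
      unfolding per using *[of "of_int J" "of_int (- J' + 4 * int n * q)"]
      by (simp only: of_int_add of_int_minus of_int_eq_iff distrib_right mult_minus_left) (metis of_int_add of_int_minus of_int_eq_iff)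
    ultimately show "(of_int J * \<theta> n = of_int J' * \<theta> n + 2 * of_int q * pi \<or> of_int J * \<theta> n = - (of_int J' * \<theta> n) + 2 * of_int q * pi)
       = (J = J' + 4 * int n * q \<or> J = - J' + 4 * int n * q)" by simp
  qed
  also have "\<dots> \<longleftrightarrow> 4 * int n dvd J - J' \<or> 4 * int n dvd J + J'"
    unfolding dvd_def by (auto simp: algebra_simps)
  finally show ?thesis .
qed

text \<open>Modulo \<open>4 * n\<close> and up to sign, every odd number is one of \<open>1, 3, \<dots>, 2 * n - 1\<close>.\<close>

lemma cos_odd_theta_reduce:
  assumes n: "1 \<le> n" and "odd J"
  obtains i where "i < n" "cos (of_int J * \<theta> n) = cos ((2 * real i + 1) * \<theta> n)"
proof -
  define r where "r = J mod (4 * int n)"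
  have r: "0 \<le> r" "r < 4 * int n" using n by (simp_all add: r_def)
  have Jr: "4 * int n dvd J - r" by (simp add: r_def mod_eq_dvd_iff[symmetric])
  then have "even (J - r)" by (rule dvd_trans[rotated]) simp
  then have ro: "odd r" using assms(2) by presburger
  define m where "m = (if r < 2 * int n then r else 4 * int n - r)"
  have m: "odd m" "0 < m" "m < 2 * int n" using r ro by (auto simp: m_def) presburger+
  then obtain i' where i': "m = 2 * i' + 1" by (auto elim: oddE)
  define i where "i = nat i'"
  have i: "int i = i'" "i < n" using i' m by (auto simp: i_def)
  have "4 * int n dvd J - m \<or> 4 * int n dvd J + m"
  proof (cases "r < 2 * int n")
    case True then show ?thesis using Jr by (simp add: m_def)
  next
    case False
    have "J + m = (J - r) + 4 * int n" using False by (simp add: m_def)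
    then show ?thesis using Jr by (metis dvd_add dvd_refl)
  qed
  then have "cos (of_int J * \<theta> n) = cos (of_int m * \<theta> n)" using cos_int_theta_eq_iff[OF n] by blast
  also have "(of_int m :: real) = 2 * real i + 1" using i i' by (metis of_int_of_nat_eq of_int_add of_int_mult of_int_1 of_int_numeral)
  finally show thesis using that i by blast
qed

lemma odd_theta_range:
  assumes "i < n" shows "\<theta> n \<le> (2 * real i + 1) * \<theta> n" "(2 * real i + 1) * \<theta> n \<le> pi - \<theta> n"
proof -
  have pos: "0 < \<theta> n" using theta_pos assms by auto
  show "\<theta> n \<le> (2 * real i + 1) * \<theta> n" using pos by simp
  have "(2 * real i + 1) * \<theta> n \<le> (2 * real n - 1) * \<theta> n" using assms pos by (intro mult_right_mono) auto
  also have "\<dots> = pi - \<theta> n" using assms by (simp add: \<theta>_def field_simps)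
  finally show "(2 * real i + 1) * \<theta> n \<le> pi - \<theta> n" .
qed

lemma sin_odd_theta_ge:
  assumes "i < n" shows "sin (\<theta> n) \<le> sin ((2 * real i + 1) * \<theta> n)"
proof -
  have n: "1 \<le> n" using assms by simp
  have t: "\<theta> n \<le> pi / 2" using n by (simp add: \<theta>_def field_simps)
  show ?thesis
  proof (cases "(2 * real i + 1) * \<theta> n \<le> pi / 2")
    case True
    then show ?thesis using odd_theta_range(1)[OF assms] theta_pos[OF n] pi_gt_zero
      by (intro sin_monotone_2pi_le) linarith+
  next
    case False
    have "sin (\<theta> n) \<le> sin (pi - (2 * real i + 1) * \<theta> n)"
      using odd_theta_range(2)[OF assms] theta_pos[OF n] False pi_gt_zero
      by (intro sin_monotone_2pi_le) linarith+
    then show ?thesis by simp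
  qed
qed

text \<open>Multiplication by \<open>2 * sin (\<theta> n)\<close> makes the sum telescope to \<open>cos 0 - cos pi\<close>.\<close>

lemma sum_sin_odd_theta:
  assumes n: "1 \<le> n" shows "(\<Sum>i<n. sin ((2 * real i + 1) * \<theta> n)) = 1 / sin (\<theta> n)"
proof -
  have "2 * sin (\<theta> n) * (\<Sum>i<n. sin ((2 * real i + 1) * \<theta> n)) = (\<Sum>i<n. cos (2 * real i * \<theta> n) - cos (2 * real (Suc i) * \<theta> n))"
    unfolding sum_distrib_left
  proof (rule sum.cong[OF refl])
    fix i
    have "cos (2 * real i * \<theta> n) = cos ((2 * real i + 1) * \<theta> n - \<theta> n)"
      "cos (2 * real (Suc i) * \<theta> n) = cos ((2 * real i + 1) * \<theta> n + \<theta> n)"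
      by (simp_all add: algebra_simps)
    then show "2 * sin (\<theta> n) * sin ((2 * real i + 1) * \<theta> n) = cos (2 * real i * \<theta> n) - cos (2 * real (Suc i) * \<theta> n)"
      by (simp add: cos_add cos_diff)
  qed
  also have "\<dots> = cos (2 * real 0 * \<theta> n) - cos (2 * real n * \<theta> n)" by (rule sum_lessThan_telescope')
  also have "2 * real n * \<theta> n = pi" using n by (simp add: \<theta>_def)
  finally have "sin (\<theta> n) * (\<Sum>i<n. sin ((2 * real i + 1) * \<theta> n)) = 1" by simp
  moreover from this have "sin (\<theta> n) \<noteq> 0" by auto
  ultimately show ?thesis by (simp add: field_simps)
qed

section \<open>The glued semicircles as a closed curve\<close>

lemma rot1_nth [simp]:
  "rot1 \<alpha> x $ 1 = x $ 1" "rot1 \<alpha> x $ 2 = cos \<alpha> * x $ 2 - sin \<alpha> * x $ 3"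
  "rot1 \<alpha> x $ 3 = sin \<alpha> * x $ 2 + cos \<alpha> * x $ 3"
  by (simp_all add: rot1_def)

lemma rot1_inner [simp]: "rot1 \<alpha> x \<bullet> rot1 \<alpha> y = x \<bullet> y"
proof -
  have "(sin \<alpha>)\<^sup>2 + (cos \<alpha>)\<^sup>2 = 1" by simp
  then have "x $ 1 * y $ 1 + (cos \<alpha> * x $ 2 - sin \<alpha> * x $ 3) * (cos \<alpha> * y $ 2 - sin \<alpha> * y $ 3)
      + (sin \<alpha> * x $ 2 + cos \<alpha> * x $ 3) * (sin \<alpha> * y $ 2 + cos \<alpha> * y $ 3)
      = x $ 1 * y $ 1 + x $ 2 * y $ 2 + x $ 3 * y $ 3" by algebra
  then show ?thesis by (simp add: inner_vec_def sum_3)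
qed

lemma rot1_norm [simp]: "norm (rot1 \<alpha> x) = norm x"
  by (simp add: norm_eq_sqrt_inner)

lemma rot1_rot1: "rot1 \<alpha> (rot1 \<beta> x) = rot1 (\<alpha> + \<beta>) x"
  by (simp add: vec_eq_iff forall_3 sin_add cos_add algebra_simps)

lemma rot1_0 [simp]: "rot1 0 x = x"
  by (simp add: vec_eq_iff forall_3)

lemma rot1_inverse [simp]: "rot1 (- \<alpha>) (rot1 \<alpha> x) = x"
  by (simp only: rot1_rot1) simp

text \<open>The circle of colatitude \<open>b\<close> about the north pole, starting in the plane \<open>x $ 1 = 0\<close>. The absolute
  value makes the sign of the first coordinate depend on \<open>A\<close> alone, also for negative \<open>b\<close>; so \<open>b\<close> and \<open>- b\<close>
  give the same circle with the start moved to the opposite end point of the semicircle.\<close>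

definition circle_point :: "real \<Rightarrow> real \<Rightarrow> real ^ 3" where
  "circle_point b A = vector [\<bar>sin b\<bar> * sin A, - (sin b * cos A), cos b]"

lemma circle_point_nth [simp]:
  "circle_point b A $ 1 = \<bar>sin b\<bar> * sin A" "circle_point b A $ 2 = - (sin b * cos A)"
  "circle_point b A $ 3 = cos b"
  by (simp_all add: circle_point_def)

lemma norm_circle_point [simp]: "norm (circle_point b A) = 1"
proof -
  have "(sin b)\<^sup>2 + (cos b)\<^sup>2 = 1" "(sin A)\<^sup>2 + (cos A)\<^sup>2 = 1" "\<bar>sin b\<bar>\<^sup>2 = (sin b)\<^sup>2" by simp_all
  then have "(\<bar>sin b\<bar> * sin A) * (\<bar>sin b\<bar> * sin A) + (- (sin b * cos A)) * (- (sin b * cos A)) + cos b * cos b = 1"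
    by algebra
  then show ?thesis by (simp add: norm_eq_1 inner_vec_def sum_3)
qed

lemma cos_sin_int_pi:
  fixes M :: int
  shows "cos (of_int M * pi) = (if even M then 1 else - 1)" "sin (of_int M * pi) = 0"
proof -
  have "cos (of_int M * pi) = (if even M then 1 else - 1) \<and> sin (of_int M * pi) = 0"
  proof (cases "even M")
    case True
    then obtain m where m: "M = 2 * m" by blast
    then have "of_int M * pi = 2 * pi * of_int m" by simp
    then show ?thesis using True by (simp only: cos_int_2pin sin_int_2pin) simp
  next
    case False
    then obtain m where m: "M = 2 * m + 1" by (blast elim: oddE)
    then have "of_int M * pi = 2 * pi * of_int m + pi" by (simp add: algebra_simps)
    then show ?thesis using False by (simp only: cos_add sin_add cos_int_2pin sin_int_2pin) simp
  qed
  then show "cos (of_int M * pi) = (if even M then 1 else - 1)" "sin (of_int M * pi) = 0" by blast+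
qed

lemma circle_point_exists:
  assumes "norm x = 1" "x $ 3 = cos b" "sin b \<noteq> 0" "0 \<le> (if even M then x $ 1 else - (x $ 1))"
  obtains A where "A \<in> {of_int M * pi..(of_int M + 1) * pi}" "x = circle_point b A"
proof -
  define e :: real where "e = (if even M then 1 else - 1)"
  have ee: "e * e = 1" "0 \<le> e * x $ 1" using assms(4) by (auto simp: e_def)
  have x2: "(x $ 1)\<^sup>2 + (x $ 2)\<^sup>2 = (sin b)\<^sup>2"
    using assms(1,2) sin_cos_squared_add[of b]
    unfolding norm_eq_1 inner_vec_def sum_3 by (simp add: power2_eq_square)
  define y where "y = - (e * x $ 2 / sin b)"
  have y1: "y\<^sup>2 = 1 - (x $ 1)\<^sup>2 / (sin b)\<^sup>2"
    using ee x2 assms(3) by (simp add: y_def power_divide power_mult_distrib e_def field_simps)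
  then have "y\<^sup>2 \<le> 1" by simp
  then have y: "-1 \<le> y" "y \<le> 1" by (simp_all add: abs_square_le_1 abs_le_iff)
  define A where "A = arccos y + of_int M * pi"
  have M: "cos (of_int M * pi) = e" "sin (of_int M * pi) = 0"
    by (simp_all add: e_def cos_sin_int_pi)
  have cosA: "cos A = e * y" using y M by (simp add: A_def cos_add)
  have "sin (arccos y) = sqrt ((x $ 1)\<^sup>2 / (sin b)\<^sup>2)"
    using y y1 by (simp add: sin_arccos)
  also have "\<dots> = e * x $ 1 / \<bar>sin b\<bar>"
    using ee(2) by (simp add: real_sqrt_divide e_def split: if_splits)
  finally have sinA: "sin A = e * (e * x $ 1 / \<bar>sin b\<bar>)" using M by (simp add: A_def sin_add)
  have "A \<in> {of_int M * pi..(of_int M + 1) * pi}"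
    using arccos_bounded[OF y] by (simp add: A_def algebra_simps)
  moreover have "x = circle_point b A"
    using sinA cosA assms(2,3) ee(1) by (simp add: vec_eq_iff forall_3 y_def mult.assoc[symmetric])
  ultimately show thesis using that by blast
qed

text \<open>Reparametrisation of the angle: it runs from \<open>M * pi\<close> to \<open>(M + 1) * pi\<close> on each unit interval and has
  speed \<open>pi * (1 + c)\<close> at all integers. A suitable \<open>c\<close> gives semicircles of different radii the same
  speed at their common end points, as a continuous derivative requires.\<close>

definition phase :: "real \<Rightarrow> real \<Rightarrow> real" where
  "phase c s = pi * s + c / 2 * sin (2 * pi * s)"

lemma phase_derivative:
  "(phase c has_real_derivative pi * (1 + c * cos (2 * pi * s))) (at s)"
  unfolding phase_def by (auto intro!: derivative_eq_intros simp: algebra_simps)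

lemma phase_int [simp]: "phase c (of_int M) = of_int M * pi"
  using sin_int_2pin[of M] by (simp add: phase_def)

lemma phase_strict_mono: assumes "\<bar>c\<bar> < 1" "s < t" shows "phase c s < phase c t"
proof (rule DERIV_pos_imp_increasing[OF assms(2)])
  fix x
  have "\<bar>c * cos (2 * pi * x)\<bar> \<le> \<bar>c\<bar> * 1" unfolding abs_mult by (intro mult_left_mono) auto
  then have "0 < 1 + c * cos (2 * pi * x)" using assms(1) by linarith
  then show "\<exists>y. (phase c has_real_derivative y) (at x) \<and> 0 < y"
    by (intro exI[of _ "pi * (1 + c * cos (2 * pi * x))"] conjI phase_derivative) simp
qed

lemma phase_surj:
  assumes "A \<in> {of_int M * pi..(of_int M + 1) * pi}"
  obtains s where "s \<in> {of_int M..of_int M + 1}" "phase c s = A"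
proof -
  have "continuous_on {of_int M..of_int M + 1} (phase c)"
    by (intro continuous_at_imp_continuous_on ballI DERIV_isCont[OF phase_derivative])
  moreover have "phase c (of_int M + 1) = (of_int M + 1) * pi"
    using phase_int[of c "M + 1"] by (simp only: of_int_add of_int_1)
  ultimately have "\<exists>s\<ge>of_int M. s \<le> of_int M + 1 \<and> phase c s = A"
    using assms by (intro IVT') auto
  then obtain s where "of_int M \<le> s" "s \<le> of_int M + 1" "phase c s = A" by blast
  then show thesis by (intro that[of s]) simp_all
qed

lemma phase_range:
  assumes "\<bar>c\<bar> < 1" "s \<in> {of_int M..of_int M + 1}"
  shows "phase c s \<in> {of_int M * pi..(of_int M + 1) * pi}"
proof -
  have "phase c (of_int M + 1) = (of_int M + 1) * pi" using phase_int[of c "M + 1"] by (simp only: of_int_add of_int_1)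
  then show ?thesis
    using phase_strict_mono[OF assms(1), of "of_int M" s] phase_strict_mono[OF assms(1), of s "of_int M + 1"] assms(2)
    by (cases "s = of_int M"; cases "s = of_int M + 1") auto
qed

lemma sin_sign_int:
  assumes "A \<in> {of_int M * pi..(of_int M + 1) * pi}"
  shows "0 \<le> (if even M then sin A else - sin A)"
proof -
  have "0 \<le> sin (A - of_int M * pi)" using assms by (intro sin_ge_zero) (auto simp: algebra_simps)
  then show ?thesis by (auto simp: sin_diff cos_sin_int_pi)
qed

text \<open>Semicircle number \<open>M\<close> is traversed on the parameter interval from \<open>M\<close> to \<open>M + 1\<close>. It has the rotated axis
  and lies in the east for even \<open>M\<close>, and it has the axis \<open>axis 3 1\<close> and lies in the west for odd \<open>M\<close>. Its
  colatitude is signed and may exceed \<open>pi\<close>: the step \<open>- 2 * k * \<theta> n\<close> is what makes consecutive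
  semicircles share an end point.\<close>

locale coprime_gluing =
  fixes n k :: nat
  assumes n: "1 \<le> n" and cop: "gcd k n = 1"
begin

definition odd_index :: "int \<Rightarrow> int" where "odd_index M = 1 - 2 * int k * M"
definition axis_angle :: "int \<Rightarrow> real" where "axis_angle M = (if even M then 2 * real k * \<theta> n else 0)"
definition colat :: "int \<Rightarrow> real" where "colat M = of_int (odd_index M) * \<theta> n"
definition speed_coeff :: "int \<Rightarrow> real" where "speed_coeff M = sin (\<theta> n) / \<bar>sin (colat M)\<bar> - 1"
definition piece :: "int \<Rightarrow> real \<Rightarrow> real ^ 3" where
  "piece M s = rot1 (axis_angle M) (circle_point (colat M) (phase (speed_coeff M) s))"
definition piece' :: "int \<Rightarrow> real \<Rightarrow> real ^ 3" where
  "piece' M s = (pi * (1 + speed_coeff M * cos (2 * pi * s))) *\<^sub>R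
     rot1 (axis_angle M) (vector [\<bar>sin (colat M)\<bar> * cos (phase (speed_coeff M) s), sin (colat M) * sin (phase (speed_coeff M) s), 0])"
definition rope :: "real \<Rightarrow> real ^ 3" where
  "rope t = piece \<lfloor>real n * t / pi\<rfloor> (real n * t / pi)"

lemma odd_odd_index: "odd (odd_index M)" by (simp add: odd_index_def)

lemma colat_reduce:
  obtains i where "i < n" "cos (colat M) = cos ((2 * real i + 1) * \<theta> n)" "\<bar>sin (colat M)\<bar> = sin ((2 * real i + 1) * \<theta> n)"
proof -
  obtain i where i: "i < n" "cos (colat M) = cos ((2 * real i + 1) * \<theta> n)"
    using cos_odd_theta_reduce[OF n odd_odd_index[of M]] unfolding colat_def by metis
  have "(sin (colat M))\<^sup>2 = (sin ((2 * real i + 1) * \<theta> n))\<^sup>2"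
    by (simp only: sin_squared_eq i(2))
  then have "\<bar>sin (colat M)\<bar> = \<bar>sin ((2 * real i + 1) * \<theta> n)\<bar>"
    by (simp only: power2_eq_iff abs_eq_iff)
  also have "\<dots> = sin ((2 * real i + 1) * \<theta> n)"
    using odd_theta_range[OF i(1)] theta_pos[OF n] by (intro abs_of_nonneg sin_ge_zero) linarith+
  finally show thesis using that i by blast
qed

lemma sin_theta_pos: "0 < sin (\<theta> n)"
proof -
  have "\<theta> n < pi" using odd_theta_range[of 0 n] n theta_pos[OF n] by linarith
  then show ?thesis using theta_pos[OF n] by (intro sin_gt_zero)
qed

lemma abs_sin_colat_ge: "sin (\<theta> n) \<le> \<bar>sin (colat M)\<bar>"
  using colat_reduce[of M] sin_odd_theta_ge by metis

lemma sin_colat_nonzero: "sin (colat M) \<noteq> 0"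
  using abs_sin_colat_ge[of M] sin_theta_pos by auto

lemma speed_coeff: "\<bar>speed_coeff M\<bar> < 1"
proof -
  have "0 < sin (\<theta> n) / \<bar>sin (colat M)\<bar>" "sin (\<theta> n) / \<bar>sin (colat M)\<bar> \<le> 1"
    using abs_sin_colat_ge[of M] sin_theta_pos sin_colat_nonzero[of M] by simp_all
  then show ?thesis by (simp add: speed_coeff_def)
qed

text \<open>Equal cosines mean that the two odd indices agree modulo \<open>4 * n\<close> up to sign. For \<open>M\<close> and \<open>M'\<close> of equal
  parity the sum of the indices is \<open>2\<close> modulo \<open>4\<close>, which excludes opposite signs; for equal signs
  coprimality cancels \<open>k\<close>.\<close>

lemma same_circle_imp:
  assumes "even (M - M')" "cos (colat M) = cos (colat M')"
  shows "2 * int n dvd M - M'"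
proof -
  obtain d where d: "M - M' = 2 * d" using assms(1) by blast
  have ne: "\<not> 4 * int n dvd odd_index M + odd_index M'"
  proof
    assume "4 * int n dvd odd_index M + odd_index M'"
    then have "4 dvd odd_index M + odd_index M'" by (rule dvd_trans[rotated]) simp
    moreover have "odd_index M + odd_index M' = 2 - 4 * (int k * (M' + d))"
      using d by (simp add: odd_index_def algebra_simps)
    ultimately show False by presburger
  qed
  then have "4 * int n dvd odd_index M - odd_index M'"
    using assms(2) cos_int_theta_eq_iff[OF n] unfolding colat_def by blast
  moreover have "odd_index M - odd_index M' = 4 * (- (int k * d))"
    using d by (simp add: odd_index_def algebra_simps)
  ultimately have "int n dvd int k * d" by (simp only: dvd_mult_cancel_left dvd_minus_iff) auto
  moreover have "coprime (int n) (int k)" using cop by (simp add: coprime_iff_gcd_eq_1 gcd.commute)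
  ultimately have "int n dvd d" by (simp add: coprime_dvd_mult_right_iff)
  then show ?thesis using d by simp
qed

text \<open>An injective map of a finite set into itself is onto: on each side every one of the \<open>n\<close> circles occurs, and
  it occurs once per period.\<close>

lemma circle_bij:
  "\<exists>f. bij_betw f {..<n} {..<n} \<and>
     (\<forall>l<n. cos (colat (2 * int l + p)) = cos ((2 * real (f l) + 1) * \<theta> n) \<and>
          \<bar>sin (colat (2 * int l + p))\<bar> = sin ((2 * real (f l) + 1) * \<theta> n))"
proof -
  have "\<exists>i<n. cos (colat M) = cos ((2 * real i + 1) * \<theta> n) \<and> \<bar>sin (colat M)\<bar> = sin ((2 * real i + 1) * \<theta> n)" for M
    using colat_reduce[of M] by metis
  then obtain F where F: "\<And>M. F M < n" "\<And>M. cos (colat M) = cos ((2 * real (F M) + 1) * \<theta> n)"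
    "\<And>M. \<bar>sin (colat M)\<bar> = sin ((2 * real (F M) + 1) * \<theta> n)" by metis
  define f where "f l = F (2 * int l + p)" for l :: nat
  have "inj_on f {..<n}"
  proof (rule inj_onI)
    fix l l' assume l: "l \<in> {..<n}" "l' \<in> {..<n}" "f l = f l'"
    then have "cos (colat (2 * int l + p)) = cos (colat (2 * int l' + p))" by (simp add: F(2) f_def)
    then have "2 * int n dvd (2 * int l + p) - (2 * int l' + p)" by (intro same_circle_imp) auto
    then have "2 * int n dvd 2 * (int l - int l')" by (simp only: add_diff_cancel_right right_diff_distrib)
    then have "int n dvd int l - int l'" by (simp only: dvd_mult_cancel_left) simp
    then show "l = l'" using l dvd_imp_le_int[of "int l - int l'" "int n"] by fastforce
  qed
  moreover from this have "f ` {..<n} = {..<n}" by (intro endo_inj_surj) (auto simp: f_def F(1))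
  ultimately have "bij_betw f {..<n} {..<n}" by (simp add: bij_betw_def)
  then show ?thesis using F(2,3) by (intro exI[of _ f]) (simp add: f_def)
qed

lemma colat_step: "colat (M - 1) = colat M + 2 * real k * \<theta> n"
  by (simp add: colat_def odd_index_def algebra_simps)

lemma piece_match: "piece (M - 1) (of_int M) = piece M (of_int M)"
proof -
  \<comment> \<open>\<open>cos (of_int M * pi)\<close> is the sign that tells at which end of its semicircle the parameter is.\<close>
  have *: "piece L (of_int M) = vector [0, - sin (axis_angle L + cos (of_int M * pi) * colat L),
      cos (axis_angle L + cos (of_int M * pi) * colat L)]" for L
    by (simp add: piece_def vec_eq_iff forall_3 cos_sin_int_pi sin_add cos_add)
  have "axis_angle (M - 1) + cos (of_int M * pi) * colat (M - 1) = axis_angle M + cos (of_int M * pi) * colat M"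
    by (simp add: axis_angle_def colat_step cos_sin_int_pi)
  then show ?thesis by (simp only: *)
qed

text \<open>All junctions are passed with the same speed, orthogonally to the plane \<open>x $ 1 = 0\<close>, whatever the
  semicircle.\<close>

lemma piece'_match: "piece' (M - 1) (of_int M) = piece' M (of_int M)"
proof -
  have "piece' L (of_int M) = (pi * sin (\<theta> n) * cos (of_int M * pi)) *\<^sub>R axis 1 1" for L
    using sin_colat_nonzero[of L] cos_int_2pin[of M]
    by (simp add: piece'_def vec_eq_iff forall_3 cos_sin_int_pi speed_coeff_def axis_def)
  then show ?thesis by simp
qed

lemma piece_derivative: "(piece M has_vector_derivative piece' M s) (at s)"
proof -
  define v where "v i = rot1 (axis_angle M) (axis i 1)" for i
  have lin: "rot1 (axis_angle M) (vector [x, y, z]) = x *\<^sub>R v 1 + y *\<^sub>R v 2 + z *\<^sub>R v 3" for x y z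
    by (simp add: v_def vec_eq_iff forall_3 axis_def algebra_simps)
  have "piece M = (\<lambda>s. (\<bar>sin (colat M)\<bar> * sin (phase (speed_coeff M) s)) *\<^sub>R v 1
      + (- (sin (colat M) * cos (phase (speed_coeff M) s))) *\<^sub>R v 2 + cos (colat M) *\<^sub>R v 3)"
    by (simp add: piece_def circle_point_def lin fun_eq_iff)
  moreover have "((\<lambda>s. (\<bar>sin (colat M)\<bar> * sin (phase (speed_coeff M) s)) *\<^sub>R v 1
      + (- (sin (colat M) * cos (phase (speed_coeff M) s))) *\<^sub>R v 2 + cos (colat M) *\<^sub>R v 3)
     has_vector_derivative piece' M s) (at s)"
    unfolding piece'_def lin
    by (rule derivative_eq_intros phase_derivative[THEN DERIV_chain2] phase_derivative refl | simp add: algebra_simps)+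
  ultimately show ?thesis by simp
qed

end

lemma lat_circle_iff:
  assumes "i < n"
  shows "x \<in> lat_circle n i \<longleftrightarrow> norm x = 1 \<and> x $ 3 = cos ((2 * real i + 1) * \<theta> n)"
proof -
  have n: "1 \<le> n" using assms by simp
  have a: "0 \<le> (2 * real i + 1) * \<theta> n" "(2 * real i + 1) * \<theta> n \<le> pi"
    using odd_theta_range[OF assms] theta_pos[OF n] by linarith+
  have "(arccos (x $ 3) = (2 * real i + 1) * \<theta> n) = (x $ 3 = cos ((2 * real i + 1) * \<theta> n))"
    if "norm x = 1"
  proof -
    have "\<bar>x $ 3\<bar> \<le> 1" using component_le_norm_cart[of x 3] that by simp
    then have "cos (arccos (x $ 3)) = x $ 3" by (rule cos_arccos_abs)
    then show ?thesis using arccos_cos[OF a] by metis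
  qed
  then show ?thesis by (auto simp: lat_circle_def dist_S2_def inner_axis)
qed

context coprime_gluing
begin

definition track :: "real \<Rightarrow> real ^ 3" where "track s = piece \<lfloor>s\<rfloor> s"

lemma rope_track: "rope t = track (real n * t / pi)"
  by (simp add: rope_def track_def)

lemma track_piece: "s \<in> {of_int M..of_int M + 1} \<Longrightarrow> track s = piece M s"
  unfolding track_def by (rule floor_glue_eq[OF piece_match])

lemma track_derivative: "(track has_vector_derivative piece' \<lfloor>s\<rfloor> s) (at s)"
  unfolding track_def[abs_def]
  by (rule floor_glue_has_vector_derivative[OF piece_match piece'_match piece_derivative])

lemma rope_derivative:
  "(rope has_vector_derivative (real n / pi) *\<^sub>R piece' \<lfloor>real n * t / pi\<rfloor> (real n * t / pi)) (at t)"
proof -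
  have "((\<lambda>t. real n * t / pi) has_vector_derivative real n / pi) (at t)"
    by (auto intro!: derivative_eq_intros simp: has_real_derivative_iff_has_vector_derivative[symmetric])
  from vector_diff_chain_at[OF this track_derivative]
  show ?thesis by (simp add: rope_track[abs_def] o_def)
qed

lemma continuous_on_piece': "continuous_on UNIV (piece' M)"
proof -
  define v where "v i = rot1 (axis_angle M) (axis i 1)" for i
  have "rot1 (axis_angle M) (vector [x, y, 0]) = x *\<^sub>R v 1 + y *\<^sub>R v 2" for x y
    by (simp add: v_def vec_eq_iff forall_3 axis_def algebra_simps)
  then show ?thesis
    unfolding piece'_def[abs_def] phase_def by (simp only:) (intro continuous_intros)
qed

lemma continuous_rope_derivative:
  "continuous_on UNIV (\<lambda>t. (real n / pi) *\<^sub>R piece' \<lfloor>real n * t / pi\<rfloor> (real n * t / pi))"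
proof -
  have "continuous_on UNIV (\<lambda>s. piece' \<lfloor>s\<rfloor> s)"
    by (rule floor_glue_continuous[OF piece'_match continuous_on_piece'])
  then have "continuous_on UNIV (\<lambda>t. piece' \<lfloor>real n * t / pi\<rfloor> (real n * t / pi))"
    by (rule continuous_on_compose2) (auto intro!: continuous_intros)
  then show ?thesis by (intro continuous_intros)
qed

lemma norm_piece':
  "norm (piece' M s) = pi * (\<bar>sin (colat M)\<bar> + (sin (\<theta> n) - \<bar>sin (colat M)\<bar>) * cos (2 * pi * s))"
  "0 < norm (piece' M s)"
proof -
  let ?c = "speed_coeff M" and ?b = "colat M"
  have "\<bar>?c * cos (2 * pi * s)\<bar> \<le> \<bar>?c\<bar> * 1" unfolding abs_mult by (intro mult_left_mono) auto
  then have pos: "0 < 1 + ?c * cos (2 * pi * s)" using speed_coeff[of M] by linarith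
  have *: "norm (vector [\<bar>sin ?b\<bar> * cos A, sin ?b * sin A, 0] :: real ^ 3) = \<bar>sin ?b\<bar>" for A
  proof -
    have "(sin A)\<^sup>2 + (cos A)\<^sup>2 = 1" "\<bar>sin ?b\<bar>\<^sup>2 = (sin ?b)\<^sup>2" by simp_all
    then have "\<bar>sin ?b\<bar> * cos A * (\<bar>sin ?b\<bar> * cos A) + sin ?b * sin A * (sin ?b * sin A) = (sin ?b)\<^sup>2"
      by algebra
    then have "(norm (vector [\<bar>sin ?b\<bar> * cos A, sin ?b * sin A, 0] :: real ^ 3))\<^sup>2 = \<bar>sin ?b\<bar>\<^sup>2"
      by (simp only: power2_norm_eq_inner inner_vec_def sum_3 vector_3 inner_real_def) simp
    then show ?thesis by (rule power2_eq_imp_eq) auto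
  qed
  have eq: "norm (piece' M s) = pi * (1 + ?c * cos (2 * pi * s)) * \<bar>sin ?b\<bar>"
    using pos by (simp add: piece'_def * abs_mult)
  then show "0 < norm (piece' M s)" using pos sin_colat_nonzero[of M] by simp
  have "?c * \<bar>sin ?b\<bar> = sin (\<theta> n) - \<bar>sin ?b\<bar>"
    using sin_colat_nonzero[of M] by (simp add: speed_coeff_def field_simps)
  then have "(1 + ?c * cos (2 * pi * s)) * \<bar>sin ?b\<bar> = \<bar>sin ?b\<bar> + (sin (\<theta> n) - \<bar>sin ?b\<bar>) * cos (2 * pi * s)"
  proof -
    have "(1 + ?c * cos (2 * pi * s)) * \<bar>sin ?b\<bar> = \<bar>sin ?b\<bar> + (?c * \<bar>sin ?b\<bar>) * cos (2 * pi * s)"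
      by (simp add: distrib_right)
    also note \<open>?c * \<bar>sin ?b\<bar> = sin (\<theta> n) - \<bar>sin ?b\<bar>\<close>
    finally show ?thesis .
  qed
  then show "norm (piece' M s) = pi * (\<bar>sin ?b\<bar> + (sin (\<theta> n) - \<bar>sin ?b\<bar>) * cos (2 * pi * s))"
    unfolding eq by (simp only: mult.assoc)
qed

lemma piece_periodic: "piece (M + 2 * int n * q) (s + of_int (2 * int n * q)) = piece M s"
proof -
  have "colat (M + 2 * int n * q) = colat M + 2 * pi * of_int (- (int k * q))"
    using four_n_theta[OF n] by (simp add: colat_def odd_index_def algebra_simps)
  then have trig: "sin (colat (M + 2 * int n * q)) = sin (colat M)" "cos (colat (M + 2 * int n * q)) = cos (colat M)"
    by (simp_all only: sin_add cos_add sin_int_2pin cos_int_2pin)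
  have "2 * pi * (s + of_int (2 * int n * q)) = 2 * pi * s + 2 * pi * of_int (2 * int n * q)"
    by (simp only: distrib_left)
  then have "sin (2 * pi * (s + of_int (2 * int n * q))) = sin (2 * pi * s)"
    by (simp only: sin_add sin_int_2pin cos_int_2pin)
  then have "phase c (s + of_int (2 * int n * q)) = phase c s + 2 * pi * of_int (int n * q)" for c
    by (simp add: phase_def algebra_simps)
  then have "sin (phase c (s + of_int (2 * int n * q))) = sin (phase c s)"
    "cos (phase c (s + of_int (2 * int n * q))) = cos (phase c s)" for c
    by (simp_all only: sin_add cos_add sin_int_2pin cos_int_2pin)
  then show ?thesis
    by (simp add: piece_def axis_angle_def speed_coeff_def circle_point_def trig)
qed

lemma rope_periodic: "rope (t + 2 * pi) = rope t"
proof -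
  define s where "s = real n * t / pi"
  have "real n * (t + 2 * pi) / pi = s + of_int (2 * int n * 1)" by (simp add: s_def field_simps)
  moreover have "\<lfloor>s + of_int (2 * int n * 1)\<rfloor> = \<lfloor>s\<rfloor> + 2 * int n * 1" by (simp only: floor_add_int)
  ultimately show ?thesis
    using piece_periodic[of "\<lfloor>s\<rfloor>" 1 s] by (simp only: rope_def s_def[symmetric])
qed

lemma piece_nth1: "piece M s $ 1 = \<bar>sin (colat M)\<bar> * sin (phase (speed_coeff M) s)"
  by (simp add: piece_def)

lemma piece_side:
  assumes "s \<in> {of_int M..of_int M + 1}"
  shows "0 \<le> (if even M then piece M s $ 1 else - (piece M s $ 1))"
  using sin_sign_int[OF phase_range[OF speed_coeff assms, of M]]
  by (auto simp: piece_nth1 mult_nonneg_nonpos)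

text \<open>A point in the closed eastern (western) half lies on an even (odd) semicircle. For a junction this
  may be the semicircle that ends there instead of the one that starts there.\<close>

lemma track_on_side:
  assumes "0 \<le> (if even p then track s $ 1 else - (track s $ 1))"
  obtains M where "even (M - p)" "s \<in> {of_int M..of_int M + 1}" "track s = piece M s"
proof (cases "even (\<lfloor>s\<rfloor> - p)")
  case True
  then show thesis using that[of "\<lfloor>s\<rfloor>"] by (auto simp: track_def intro: less_imp_le)
next
  case False
  define M where "M = \<lfloor>s\<rfloor>"
  have s: "s \<in> {of_int M..of_int M + 1}" by (simp add: M_def less_imp_le)
  have odd: "odd (M - p)" using False by (simp add: M_def)
  have tr: "track s = piece M s" by (rule track_piece[OF s])
  have "track s $ 1 = 0" using assms piece_side[OF s] odd unfolding tr by (auto split: if_splits)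
  then have "sin (phase (speed_coeff M) s) = 0" using sin_colat_nonzero[of M] unfolding tr piece_nth1 by simp
  then have z: "sin (phase (speed_coeff M) s - of_int M * pi) = 0"
    by (simp add: sin_diff cos_sin_int_pi)
  have "s < of_int M + 1" by (simp add: M_def)
  then have "phase (speed_coeff M) s < phase (speed_coeff M) (of_int (M + 1))"
    by (intro phase_strict_mono[OF speed_coeff]) simp
  then have "phase (speed_coeff M) s - of_int M * pi < pi" by (simp only: phase_int) (simp add: algebra_simps)
  moreover have "0 \<le> phase (speed_coeff M) s - of_int M * pi"
    using phase_range[OF speed_coeff s, of M] by simp
  ultimately have "\<not> 0 < phase (speed_coeff M) s - of_int M * pi"
    using z sin_gt_zero[of "phase (speed_coeff M) s - of_int M * pi"] by linarith
  then have "phase (speed_coeff M) s = phase (speed_coeff M) (of_int M)"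
    using \<open>0 \<le> phase (speed_coeff M) s - of_int M * pi\<close> by (simp only: phase_int)
  then have sM: "s = of_int M"
    using phase_strict_mono[OF speed_coeff, of s "of_int M" M] phase_strict_mono[OF speed_coeff, of "of_int M" s M]
    by (cases s "of_int M :: real" rule: linorder_cases) auto
  have "s \<in> {of_int (M - 1)..of_int (M - 1) + 1}" using sM by simp
  then show thesis using that[of "M - 1"] track_piece odd by simp
qed

lemma cos_inj_between_multiples:
  assumes "A \<in> {of_int M * pi..(of_int M + 1) * pi}" "A' \<in> {of_int M * pi..(of_int M + 1) * pi}" "cos A = cos A'"
  shows "A = A'"
proof -
  have range: "0 \<le> B - of_int M * pi \<and> B - of_int M * pi \<le> pi"
    if "B \<in> {of_int M * pi..(of_int M + 1) * pi}" for B
    using that by (simp add: distrib_right)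
  have "cos (A - of_int M * pi) = cos (A' - of_int M * pi)"
    by (simp only: cos_diff cos_sin_int_pi assms(3))
  then have "A - of_int M * pi = A' - of_int M * pi"
    using range[OF assms(1)] range[OF assms(2)] cos_inj_pi by blast
  then show ?thesis by simp
qed

lemma piece_eq_imp:
  assumes "s \<in> {of_int M..of_int M + 1}" "s' \<in> {of_int M'..of_int M' + 1}"
    and "even (M' - M)" "piece M s = piece M' s'"
  obtains q where "s' = s + of_int (2 * int n * q)"
proof -
  have par: "even M' = even M" using assms(3) by simp
  have "circle_point (colat M) (phase (speed_coeff M) s) = circle_point (colat M') (phase (speed_coeff M') s')"
    using arg_cong[OF assms(4), of "rot1 (- axis_angle M)"] par by (simp add: piece_def axis_angle_def)
  then have "cos (colat M') = cos (colat M)" by (metis circle_point_nth(3))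
  then have "2 * int n dvd M' - M" by (rule same_circle_imp[OF assms(3)])
  then obtain q where "M' - M = 2 * int n * q" by (rule dvdE)
  then have M': "M' = M + 2 * int n * q" by simp
  define r where "r = s' - of_int (2 * int n * q)"
  have s': "s' = r + of_int (2 * int n * q)" by (simp add: r_def)
  have r: "r \<in> {of_int M..of_int M + 1}" using assms(2) unfolding M' s' by simp
  have "piece M s = piece M r" using assms(4) unfolding M' s' by (simp only: piece_periodic)
  then have "circle_point (colat M) (phase (speed_coeff M) s) = circle_point (colat M) (phase (speed_coeff M) r)"
    unfolding piece_def by (metis rot1_inverse)
  then have "- (sin (colat M) * cos (phase (speed_coeff M) s)) = - (sin (colat M) * cos (phase (speed_coeff M) r))"
    by (metis circle_point_nth(2))
  then have "cos (phase (speed_coeff M) s) = cos (phase (speed_coeff M) r)"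
    using sin_colat_nonzero[of M] by simp
  then have "phase (speed_coeff M) s = phase (speed_coeff M) r"
    by (rule cos_inj_between_multiples[OF phase_range[OF speed_coeff assms(1)] phase_range[OF speed_coeff r]])
  then have "s = r"
    using phase_strict_mono[OF speed_coeff, of s r M] phase_strict_mono[OF speed_coeff, of r s M]
    by (cases s r rule: linorder_cases) auto
  then show thesis using that s' by blast
qed

text \<open>Two parameters with the same image lie on semicircles of the same side, hence on the same circle, so they
  differ by a multiple of the period \<open>2 * n\<close>.\<close>

lemma rope_inj: "inj_on rope {0..<2 * pi}"
proof (rule inj_onI)
  fix t t' assume t: "t \<in> {0..<2 * pi}" "t' \<in> {0..<2 * pi}" and eq: "rope t = rope t'"
  define s s' where "s = real n * t / pi" and "s' = real n * t' / pi"
  have s: "0 \<le> s" "s < 2 * real n" "0 \<le> s'" "s' < 2 * real n"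
    using t n by (auto simp: s_def s'_def field_simps)
  have eq: "track s = track s'" using eq by (simp add: rope_track s_def s'_def)
  define p :: int where "p = (if 0 \<le> track s $ 1 then 0 else 1)"
  have p: "0 \<le> (if even p then track s $ 1 else - (track s $ 1))"
    "0 \<le> (if even p then track s' $ 1 else - (track s' $ 1))"
    by (auto simp: p_def eq[symmetric])
  obtain M where M: "even (M - p)" "s \<in> {of_int M..of_int M + 1}" "track s = piece M s"
    by (rule track_on_side[OF p(1)])
  obtain M' where M': "even (M' - p)" "s' \<in> {of_int M'..of_int M' + 1}" "track s' = piece M' s'"
    by (rule track_on_side[OF p(2)])
  have "even (M' - M)" using M(1) M'(1) by simp
  moreover have "piece M s = piece M' s'" using eq M(3) M'(3) by simp
  ultimately obtain q where q: "s' = s + of_int (2 * int n * q)"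
    using piece_eq_imp[OF M(2) M'(2)] by blast
  have "q = 0"
  proof (rule ccontr)
    assume "q \<noteq> 0"
    then have "1 \<le> \<bar>real_of_int q\<bar>" by linarith
    then have "2 * real n \<le> \<bar>of_int (2 * int n * q) :: real\<bar>" using n by (simp add: abs_mult)
    then show False using q s by linarith
  qed
  then have "s = s'" using q by simp
  then show "t = t'" using n by (simp add: s_def s'_def)
qed

lemma norm_piece [simp]: "norm (piece M s) = 1" by (simp add: piece_def)

lemma closed_curve_rope: "closed_curve_S2 rope"
  unfolding closed_curve_S2_def
proof (intro conjI allI)
  show "range rope \<subseteq> S2" by (auto simp: rope_def)
  show "rope (t + 2 * pi) = rope t" for t by (rule rope_periodic)
  show "inj_on rope {0..<2 * pi}" by (rule rope_inj)
  show "rope C1_differentiable_on UNIV"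
    unfolding C1_differentiable_on_def
    by (intro exI[of _ "\<lambda>t. (real n / pi) *\<^sub>R piece' \<lfloor>real n * t / pi\<rfloor> (real n * t / pi)"] conjI ballI
        rope_derivative continuous_rope_derivative)
  show "vector_derivative rope (at t) \<noteq> 0" for t
    using norm_piece'(2)[of "\<lfloor>real n * t / pi\<rfloor>" "real n * t / pi"] n
    by (auto simp: vector_derivative_at[OF rope_derivative])
qed

lemma range_track: "range track = glued_circles n k"
proof
  show "range track \<subseteq> glued_circles n k"
  proof
    fix x assume "x \<in> range track"
    then obtain s where x: "x = track s" by blast
    define M where "M = \<lfloor>s\<rfloor>"
    have s: "s \<in> {of_int M..of_int M + 1}" by (simp add: M_def less_imp_le)
    let ?y = "circle_point (colat M) (phase (speed_coeff M) s)"
    have xy: "x = rot1 (axis_angle M) ?y" using x track_piece[OF s] by (simp add: piece_def)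
    obtain i where i: "i < n" "cos (colat M) = cos ((2 * real i + 1) * \<theta> n)"
      by (rule colat_reduce)
    have y: "?y \<in> (\<Union>i<n. lat_circle n i)" using i by (auto simp: lat_circle_iff)
    have side: "0 \<le> (if even M then ?y $ 1 else - (?y $ 1))"
      using piece_side[OF s] unfolding piece_def rot1_nth .
    show "x \<in> glued_circles n k"
    proof (cases "even M")
      case True
      then have "?y \<in> east" using side by (simp add: east_def)
      then show ?thesis using y xy True by (auto simp: glued_circles_def axis_angle_def)
    next
      case False
      then have "?y \<in> west" using side by (simp add: west_def)
      then show ?thesis using y xy False by (auto simp: glued_circles_def axis_angle_def)
    qed
  qed
  have hit: "rot1 (axis_angle p) y \<in> range track"
    if y: "y \<in> (\<Union>i<n. lat_circle n i)" "0 \<le> (if even p then y $ 1 else - (y $ 1))" for p y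
  proof -
    obtain i where i: "i < n" "norm y = 1" "y $ 3 = cos ((2 * real i + 1) * \<theta> n)"
      using y(1) by (auto simp: lat_circle_iff)
    obtain f where f: "bij_betw f {..<n} {..<n}"
      "\<forall>l<n. cos (colat (2 * int l + p)) = cos ((2 * real (f l) + 1) * \<theta> n) \<and>
        \<bar>sin (colat (2 * int l + p))\<bar> = sin ((2 * real (f l) + 1) * \<theta> n)"
      using circle_bij[of p] by blast
    have "i \<in> f ` {..<n}" using bij_betw_imp_surj_on[OF f(1)] i(1) by simp
    then obtain l where l: "l < n" "f l = i" by auto
    define M where "M = 2 * int l + p"
    have ev: "even M = even p" by (simp add: M_def)
    have "y $ 3 = cos (colat M)" using f(2) l i(3) by (simp add: M_def)
    moreover have "0 \<le> (if even M then y $ 1 else - (y $ 1))" using y(2) ev by simp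
    ultimately obtain A where A: "A \<in> {of_int M * pi..(of_int M + 1) * pi}" "y = circle_point (colat M) A"
      using circle_point_exists[OF i(2) _ sin_colat_nonzero] by blast
    obtain s where s: "s \<in> {of_int M..of_int M + 1}" "phase (speed_coeff M) s = A"
      using phase_surj[OF A(1)] by blast
    have "rot1 (axis_angle p) y = track s"
      using track_piece[OF s(1)] s(2) A(2) ev by (simp add: piece_def axis_angle_def)
    then show ?thesis by blast
  qed
  show "glued_circles n k \<subseteq> range track"
  proof
    fix x assume "x \<in> glued_circles n k"
    then consider "x \<in> west" "x \<in> (\<Union>i<n. lat_circle n i)"
      | y where "y \<in> east" "y \<in> (\<Union>i<n. lat_circle n i)" "x = rot1 (2 * real k * \<theta> n) y"
      unfolding glued_circles_def by blast
    then show "x \<in> range track"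
    proof cases
      case 1
      then show ?thesis using hit[of x 1] by (simp add: west_def axis_angle_def)
    next
      case 2
      then show ?thesis using hit[of y 0] by (simp add: east_def axis_angle_def)
    qed
  qed
qed

lemma range_rope: "range rope = glued_circles n k"
proof -
  have "track s \<in> range rope" for s
  proof -
    have "track s = rope (pi * s / real n)" using n by (simp add: rope_track)
    then show ?thesis by blast
  qed
  then have "range rope = range track" by (auto simp: rope_track)
  then show ?thesis by (simp add: range_track)
qed

text \<open>Each parameter interval contributes the length \<open>pi * \<bar>sin (colat M)\<bar>\<close> of its semicircle.\<close>

lemma curve_length_rope: "curve_length rope = 2 * pi / sin (\<theta> n)"
proof -
  define v where "v t = norm (vector_derivative rope (at t))" for t
  have v: "v t = real n * (\<bar>sin (colat M)\<bar> + (sin (\<theta> n) - \<bar>sin (colat M)\<bar>) * cos (2 * real n * t))"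
    if "real n * t / pi \<in> {of_int M..of_int M + 1}" for t M
  proof -
    have "v t = norm ((real n / pi) *\<^sub>R piece' M (real n * t / pi))"
      by (simp only: v_def vector_derivative_at[OF rope_derivative] floor_glue_eq[where X=piece', OF piece'_match that])
    also have "\<dots> = real n / pi * (pi * (\<bar>sin (colat M)\<bar> + (sin (\<theta> n) - \<bar>sin (colat M)\<bar>) * cos (2 * pi * (real n * t / pi))))"
      by (simp only: norm_scaleR norm_piece'(1)) simp
    finally show ?thesis by (simp add: mult.assoc)
  qed
  have piece_len: "(v has_integral pi * \<bar>sin (colat (int j))\<bar>) {real j * pi / n..real (Suc j) * pi / n}" for j
  proof -
    let ?m = "\<bar>sin (colat (int j))\<bar>"
    define F where "F t = real n * ?m * t + (sin (\<theta> n) - ?m) / 2 * sin (2 * real n * t)" for t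
    have "((\<lambda>t. real n * (?m + (sin (\<theta> n) - ?m) * cos (2 * real n * t))) has_integral
       (F (real (Suc j) * pi / n) - F (real j * pi / n))) {real j * pi / n..real (Suc j) * pi / n}"
    proof (rule fundamental_theorem_of_calculus)
      show "real j * pi / n \<le> real (Suc j) * pi / n" by (intro divide_right_mono mult_right_mono) auto
      fix t
      have "(F has_real_derivative real n * (?m + (sin (\<theta> n) - ?m) * cos (2 * real n * t))) (at t)"
        unfolding F_def by (auto intro!: derivative_eq_intros simp: field_simps)
      then show "(F has_vector_derivative real n * (?m + (sin (\<theta> n) - ?m) * cos (2 * real n * t)))
          (at t within {real j * pi / n..real (Suc j) * pi / n})"
        by (simp add: has_real_derivative_iff_has_vector_derivative has_vector_derivative_at_within)
    qed
    moreover have F: "F (real i * pi / n) = ?m * real i * pi" for i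
    proof -
      have "2 * real n * (real i * pi / n) = 2 * pi * of_int (int i)" using n by simp
      then have "sin (2 * real n * (real i * pi / n)) = 0" by (simp only: sin_int_2pin)
      then show ?thesis using n unfolding F_def by simp
    qed
    moreover have "F (real (Suc j) * pi / n) - F (real j * pi / n) = pi * ?m"
      unfolding F by (simp add: algebra_simps)
    ultimately have "((\<lambda>t. real n * (?m + (sin (\<theta> n) - ?m) * cos (2 * real n * t))) has_integral pi * ?m)
        {real j * pi / n..real (Suc j) * pi / n}"
      by (simp only:)
    moreover have "real n * (?m + (sin (\<theta> n) - ?m) * cos (2 * real n * t)) = v t"
      if "t \<in> {real j * pi / n..real (Suc j) * pi / n}" for t
      using that n by (intro v[symmetric]) (auto simp: field_simps)
    ultimately show ?thesis by (rule has_integral_eq[rotated])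
  qed
  have total: "(v has_integral (\<Sum>j<m. pi * \<bar>sin (colat (int j))\<bar>)) {0..real m * pi / n}" for m
  proof (induction m)
    case 0 then show ?case by (simp add: has_integral_refl)
  next
    case (Suc m)
    show ?case unfolding sum.lessThan_Suc
    proof (rule has_integral_combine[OF _ _ Suc piece_len])
      show "real m * pi / n \<le> real (Suc m) * pi / n" by (intro divide_right_mono mult_right_mono) auto
    qed simp
  qed
  have half: "(\<Sum>l<n. \<bar>sin (colat (2 * int l + p))\<bar>) = 1 / sin (\<theta> n)" for p
  proof -
    obtain f where f: "bij_betw f {..<n} {..<n}"
      "\<forall>l<n. cos (colat (2 * int l + p)) = cos ((2 * real (f l) + 1) * \<theta> n) \<and>
        \<bar>sin (colat (2 * int l + p))\<bar> = sin ((2 * real (f l) + 1) * \<theta> n)"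
      using circle_bij[of p] by blast
    have "(\<Sum>l<n. \<bar>sin (colat (2 * int l + p))\<bar>) = (\<Sum>l<n. sin ((2 * real (f l) + 1) * \<theta> n))"
      using f(2) by (intro sum.cong) auto
    also have "\<dots> = (\<Sum>i<n. sin ((2 * real i + 1) * \<theta> n))"
      by (rule sum.reindex_bij_betw[OF f(1)])
    finally show ?thesis using sum_sin_odd_theta[OF n] by simp
  qed
  have split: "(\<Sum>j<2 * m. F (int j)) = (\<Sum>l<m. F (2 * int l)) + (\<Sum>l<m. F (2 * int l + 1))"
    for F :: "int \<Rightarrow> real" and m :: nat
    by (induction m) (simp_all add: algebra_simps)
  have "(\<Sum>j<2 * n. pi * \<bar>sin (colat (int j))\<bar>) = pi * (\<Sum>j<2 * n. \<bar>sin (colat (int j))\<bar>)"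
    by (simp only: sum_distrib_left)
  also have "\<dots> = pi * (1 / sin (\<theta> n) + 1 / sin (\<theta> n))"
    using half[of 0] half[of 1] by (simp only: split[of "\<lambda>j. \<bar>sin (colat j)\<bar>"] add_0_right)
  finally have "(\<Sum>j<2 * n. pi * \<bar>sin (colat (int j))\<bar>) = 2 * pi / sin (\<theta> n)" by simp
  then have "(v has_integral 2 * pi / sin (\<theta> n)) {0..2 * pi}"
    using total[of "2 * n"] n by simp
  then have "integral {0..2 * pi} v = 2 * pi / sin (\<theta> n)" by (rule integral_unique)
  then show ?thesis by (simp only: curve_length_def v_def[abs_def])
qed

lemma piecewise_circular_rope: "piecewise_circular rope"
  unfolding piecewise_circular_def
proof (intro exI conjI allI impI)
  define S where "S j = real j * pi / n" for j
  show "S 0 = 0" "S (2 * n) = 2 * pi" using n by (simp_all add: S_def)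
  fix j
  show "S j < S (Suc j)" using n by (simp add: S_def divide_strict_right_mono)
  define N where "N = rot1 (axis_angle (int j)) (axis 3 1)"
  have N: "norm N = 1" by (simp add: N_def)
  then show "N \<noteq> 0" by auto
  let ?k = "cos (colat (int j))"
  have "0 < (sin (colat (int j)))\<^sup>2" using sin_colat_nonzero[of "int j"] by simp
  then show "0 < sqrt (1 - ?k\<^sup>2)" by (simp add: sin_squared_eq)
  show "rope ` {S j..S (Suc j)} \<subseteq> circle3 (?k *\<^sub>R N) N (sqrt (1 - ?k\<^sup>2))"
  proof
    fix x assume "x \<in> rope ` {S j..S (Suc j)}"
    then obtain t where t: "t \<in> {S j..S (Suc j)}" "x = rope t" by blast
    have "real n * t / pi \<in> {of_int (int j)..of_int (int j) + 1}"
      using t(1) n by (auto simp: S_def field_simps)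
    then have x: "x = piece (int j) (real n * t / pi)" using t(2) track_piece by (simp add: rope_track)
    have "x \<bullet> N = ?k" unfolding x piece_def N_def rot1_inner by (simp add: inner_axis)
    then show "x \<in> circle3 (?k *\<^sub>R N) N (sqrt (1 - ?k\<^sup>2))"
      using sphere_section_in_circle3[OF N] x by simp
  qed
qed

end

section \<open>Circles of small radius and two stacks of latitudes\<close>

lemma orthonormal_frame_inner:
  fixes a e v w :: "real ^ 3"
  assumes "norm a = 1" "norm e = 1" "a \<bullet> e = 0"
  shows "v \<bullet> w = (v \<bullet> a) * (w \<bullet> a) + (v \<bullet> cross3 a e) * (w \<bullet> cross3 a e) + (v \<bullet> e) * (w \<bullet> e)"
proof -
  let ?a = "cross3 a e"
  have i: "a \<bullet> a = 1" "e \<bullet> e = 1" "e \<bullet> a = 0" using assms by (simp_all add: norm_eq_1 inner_commute)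
  have "(norm ?a)\<^sup>2 = 1" using norm_cross_dot[of a e] assms by simp
  then have aa: "?a \<bullet> ?a = 1" by (simp only: power2_norm_eq_inner)
  have o: "?a \<bullet> a = 0" "?a \<bullet> e = 0" "a \<bullet> ?a = 0" "e \<bullet> ?a = 0"
    by (simp_all add: dot_cross_self)
  have ne: "?a \<noteq> 0" using aa by auto
  define d where "d = w - (w \<bullet> a) *\<^sub>R a - (w \<bullet> ?a) *\<^sub>R ?a - (w \<bullet> e) *\<^sub>R e"
  have "d \<bullet> a = 0" "d \<bullet> e = 0" "d \<bullet> ?a = 0"
    using i aa o assms(3) by (simp_all add: d_def inner_diff_left)
  then have "d = 0" using orthogonal_to_independent_triple[OF ne ne o(1,2)] by blast
  then have "w = (w \<bullet> a) *\<^sub>R a + (w \<bullet> ?a) *\<^sub>R ?a + (w \<bullet> e) *\<^sub>R e"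
    by (simp add: d_def algebra_simps)
  then have "v \<bullet> w = v \<bullet> ((w \<bullet> a) *\<^sub>R a + (w \<bullet> ?a) *\<^sub>R ?a + (w \<bullet> e) *\<^sub>R e)" by simp
  then show ?thesis by (simp add: inner_add_right mult.commute)
qed

text \<open>Triangle inequality for the geodesic distance: the components of \<open>u\<close> and \<open>w\<close> orthogonal to \<open>v\<close> have
  the sines of the two angles as norms, so Cauchy-Schwarz bounds \<open>u \<bullet> w\<close> from below by the cosine of the
  sum.\<close>

lemma arccos_inner_triangle:
  fixes u v w :: "'a::real_inner"
  assumes "norm u = 1" "norm v = 1" "norm w = 1"
  shows "arccos (u \<bullet> w) \<le> arccos (u \<bullet> v) + arccos (v \<bullet> w)"
proof -
  have b: "\<bar>x \<bullet> y\<bar> \<le> 1" if "norm x = 1" "norm y = 1" for x y :: 'a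
    using Cauchy_Schwarz_ineq2[of x y] that by simp
  have uu: "u \<bullet> u = 1" "v \<bullet> v = 1" "w \<bullet> w = 1" using assms by (simp_all add: norm_eq_1)
  let ?A = "arccos (u \<bullet> v)" and ?B = "arccos (v \<bullet> w)"
  have AB: "0 \<le> ?A" "?A \<le> pi" "0 \<le> ?B" "?B \<le> pi" and cAB: "cos ?A = u \<bullet> v" "cos ?B = v \<bullet> w"
    using b[OF assms(1,2)] b[OF assms(2,3)] by (auto simp: abs_le_iff arccos_lbound arccos_ubound cos_arccos)
  show ?thesis
  proof (cases "?A + ?B \<le> pi")
    case True
    define x y where "x = u - (u \<bullet> v) *\<^sub>R v" and "y = w - (v \<bullet> w) *\<^sub>R v"
    have nx: "(norm x)\<^sup>2 = (sin ?A)\<^sup>2"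
      unfolding power2_norm_eq_inner x_def sin_squared_eq cAB
      by (simp add: inner_diff_left inner_diff_right uu inner_commute power2_eq_square)
    have ny: "(norm y)\<^sup>2 = (sin ?B)\<^sup>2"
      unfolding power2_norm_eq_inner y_def sin_squared_eq cAB
      by (simp add: inner_diff_left inner_diff_right uu inner_commute power2_eq_square)
    have "norm x = sin ?A"
      by (rule power2_eq_imp_eq[OF nx norm_ge_zero sin_ge_zero[OF AB(1,2)]])
    moreover have "norm y = sin ?B"
      by (rule power2_eq_imp_eq[OF ny norm_ge_zero sin_ge_zero[OF AB(3,4)]])
    moreover have "- (x \<bullet> y) \<le> norm x * norm y" using Cauchy_Schwarz_ineq2[of x y] by linarith
    moreover have "x \<bullet> y = u \<bullet> w - (u \<bullet> v) * (v \<bullet> w)"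
      by (simp add: x_def y_def inner_diff_left inner_diff_right uu inner_commute)
    ultimately have "cos (?A + ?B) \<le> u \<bullet> w" by (simp only: cos_add cAB)
    then have "arccos (u \<bullet> w) \<le> arccos (cos (?A + ?B))"
      using b[OF assms(1,3)] by (intro arccos_le_arccos) auto
    then show ?thesis using True AB by (simp add: arccos_cos)
  next
    case False
    then show ?thesis using b[OF assms(1,3)] arccos_ubound[of "u \<bullet> w"] by (auto simp: abs_le_iff)
  qed
qed

lemma arccos_le_radius: "0 \<le> r \<Longrightarrow> r \<le> pi \<Longrightarrow> cos r \<le> x \<Longrightarrow> x \<le> 1 \<Longrightarrow> arccos x \<le> r"
  using arccos_le_arccos[of "cos r" x] by (simp add: arccos_cos)

text \<open>On the lower half of a circle of radius \<open>s\<close> the functional \<open>c * y + b * h\<close> with \<open>0 \<le> b\<close> is a convex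
  function of \<open>y\<close>. If it takes the value \<open>V\<close> at two points, it is at least \<open>V\<close> at the end point \<open>y = - s\<close>.
  The point of the chord from the left end point to the second point that lies above the first
  point is used to express this convexity.\<close>

lemma lower_arc_functional_le:
  fixes s b c :: real
  assumes s: "0 \<le> s" and p1: "y1\<^sup>2 + h1\<^sup>2 = s\<^sup>2" "h1 \<le> 0" and p2: "y2\<^sup>2 + h2\<^sup>2 = s\<^sup>2" "h2 \<le> 0"
    and ne: "y1 < y2" and b: "0 \<le> b" and V: "c * y1 + b * h1 = V" "c * y2 + b * h2 = V"
  shows "V \<le> - (c * s)"
proof -
  have y1: "- s \<le> y1" using p1(1) s by (metis abs_le_D2 abs_of_nonneg abs_le_square_iff le_add_same_cancel1 minus_le_iff zero_le_power2)
  define l where "l = (y2 - y1) / (y2 + s)"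
  have pos: "0 < y2 + s" using y1 ne by linarith
  have l: "0 < l" "l \<le> 1" using ne y1 pos by (simp_all add: l_def)
  have "l * (y2 + s) = y2 - y1" using pos by (simp add: l_def)
  then have ly: "y1 = l * (- s) + (1 - l) * y2" by (simp add: algebra_simps)
  have "((1 - l) * h2)\<^sup>2 + y1\<^sup>2 \<le> s\<^sup>2"
  proof -
    have "((1 - l) * h2)\<^sup>2 + y1\<^sup>2 = l\<^sup>2 * s\<^sup>2 + (1 - l)\<^sup>2 * (y2\<^sup>2 + h2\<^sup>2) - 2 * l * (1 - l) * (s * y2)"
      unfolding ly by (simp add: power2_eq_square algebra_simps)
    also have "\<dots> = s\<^sup>2 - 2 * l * (1 - l) * (s * (s + y2))"
      unfolding p2(1) by (simp add: power2_eq_square algebra_simps)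
    also have "\<dots> \<le> s\<^sup>2" using l s pos by simp
    finally show ?thesis .
  qed
  then have "((1 - l) * h2)\<^sup>2 \<le> h1\<^sup>2" using p1(1) by linarith
  then have "\<bar>(1 - l) * h2\<bar> \<le> \<bar>h1\<bar>" by (simp only: abs_le_square_iff)
  then have "h1 \<le> (1 - l) * h2" using p1(2) by linarith
  then have "b * h1 \<le> b * ((1 - l) * h2)" using b by (rule mult_left_mono)
  then have "V \<le> c * (l * (- s) + (1 - l) * y2) + b * ((1 - l) * h2)" using V(1) ly by simp
  also have "\<dots> = l * (- (c * s)) + (1 - l) * (c * y2 + b * h2)" by (simp add: algebra_simps)
  finally have "l * V \<le> l * (- (c * s))" unfolding V(2) by (simp add: algebra_simps)
  then show ?thesis using l(1) by (simp only: mult_le_cancel_left_pos)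
qed

lemma lower_arc_functional_le_ends:
  fixes s b c :: real
  assumes s: "0 \<le> s" and p1: "y1\<^sup>2 + h1\<^sup>2 = s\<^sup>2" "h1 \<le> 0" and p2: "y2\<^sup>2 + h2\<^sup>2 = s\<^sup>2" "h2 \<le> 0"
    and ne: "y1 \<noteq> y2" and b: "0 \<le> b" and V: "c * y1 + b * h1 = V" "c * y2 + b * h2 = V"
  shows "V \<le> - (c * s)" "V \<le> c * s"
proof -
  have gen: "V \<le> - (c * s)" if "0 \<le> s" "y1\<^sup>2 + h1\<^sup>2 = s\<^sup>2" "h1 \<le> 0" "y2\<^sup>2 + h2\<^sup>2 = s\<^sup>2" "h2 \<le> 0" "y1 \<noteq> y2"
    "c * y1 + b * h1 = V" "c * y2 + b * h2 = V" for y1 y2 h1 h2 c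
    using lower_arc_functional_le[OF that(1-5) _ b that(7,8)]
      lower_arc_functional_le[OF that(1,4,5,2,3) _ b that(8,7)] that(6) by linarith
  show "V \<le> - (c * s)" by (rule gen[OF s p1 p2 ne V])
  have "V \<le> - ((- c) * s)"
    by (rule gen[of "- y1" h1 "- y2" h2 "- c"]) (use s p1 p2 ne V in auto)
  then show "V \<le> c * s" by simp
qed

text \<open>The plane orthogonal to \<open>e\<close> cuts the sphere. Latitudes about \<open>a\<close> are considered on the side of \<open>e\<close>, which
  contains the centre \<open>p\<close> of the small circle, and latitudes about \<open>q\<close> on the opposite side. The
  assumption \<open>grid\<close> says that semicircles about \<open>q\<close> end where semicircles about \<open>a\<close> begin.\<close>

locale two_stacks =
  fixes n :: nat and e a q p :: "real ^ 3" and r :: real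
  assumes n: "1 \<le> n"
    and unit: "norm e = 1" "norm a = 1" "norm q = 1" "norm p = 1"
    and orth: "a \<bullet> e = 0" "q \<bullet> e = 0"
    and grid: "\<And>g j. norm g = 1 \<Longrightarrow> g \<bullet> e = 0 \<Longrightarrow> j < n \<Longrightarrow> g \<bullet> q = cos ((2 * real j + 1) * \<theta> n) \<Longrightarrow>
       \<exists>i<n. g \<bullet> a = cos ((2 * real i + 1) * \<theta> n)"
    and side: "0 \<le> p \<bullet> e" and r: "0 < r" "r < \<theta> n"
begin

lemma theta_le: "\<theta> n \<le> pi / 2" using n by (simp add: \<theta>_def field_simps)

text \<open>A latitude has distance at least \<open>\<theta> n > r\<close> from both of its poles.\<close>

lemma abs_cos_odd_less:
  assumes "i < n" shows "\<bar>cos ((2 * real i + 1) * \<theta> n)\<bar> < cos r"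
proof -
  note o = odd_theta_range[OF assms]
  have "cos ((2 * real i + 1) * \<theta> n) < cos r"
    using o r theta_le pi_gt_zero by (intro cos_monotone_0_pi) linarith+
  moreover have "cos (pi - (2 * real i + 1) * \<theta> n) < cos r"
    using o r theta_le pi_gt_zero by (intro cos_monotone_0_pi) linarith+
  ultimately show ?thesis by (simp add: abs_less_iff)
qed

lemma angle_le:
  assumes "norm w = 1" "norm w' = 1" "cos r \<le> w \<bullet> p" "cos r \<le> w' \<bullet> p"
  shows "arccos (w \<bullet> w') \<le> 2 * r"
proof -
  have b: "x \<bullet> p \<le> 1" if "norm x = 1" for x
    using norm_cauchy_schwarz[of x p] that unit(4) by simp
  have rr: "0 \<le> r" "r \<le> pi" using r theta_le pi_gt_zero by linarith+
  show ?thesis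
    using arccos_inner_triangle[OF assms(1) unit(4) assms(2)]
      arccos_le_radius[OF rr assms(3) b[OF assms(1)]] arccos_le_radius[OF rr assms(4) b[OF assms(2)]]
    by (simp add: inner_commute)
qed

text \<open>Two points of the cap of radius \<open>r\<close> have distance at most \<open>2 * r < 2 * \<theta> n\<close>, less than the distance of
  two neighbouring latitudes.\<close>

lemma same_index:
  assumes "norm w = 1" "norm w' = 1" "cos r \<le> w \<bullet> p" "cos r \<le> w' \<bullet> p" and N: "norm N = 1"
    and "i < n" "w \<bullet> N = cos ((2 * real i + 1) * \<theta> n)" "i' < n" "w' \<bullet> N = cos ((2 * real i' + 1) * \<theta> n)"
  shows "i = i'"
proof -
  have ac: "arccos (cos ((2 * real i + 1) * \<theta> n)) = (2 * real i + 1) * \<theta> n" if "i < n" for i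
    using odd_theta_range[OF that] theta_pos[OF n] by (intro arccos_cos) linarith+
  have t: "arccos (w \<bullet> N) \<le> arccos (w \<bullet> w') + arccos (w' \<bullet> N)" "arccos (w' \<bullet> N) \<le> arccos (w' \<bullet> w) + arccos (w \<bullet> N)"
    by (rule arccos_inner_triangle[OF assms(1,2) N] arccos_inner_triangle[OF assms(2,1) N])+
  have sm: "arccos (w \<bullet> w') < 2 * \<theta> n" "arccos (w' \<bullet> w) < 2 * \<theta> n"
    using angle_le[OF assms(1-4)] r by (simp_all add: inner_commute)
  have "(2 * real i + 1) * \<theta> n < (2 * real i' + 3) * \<theta> n" "(2 * real i' + 1) * \<theta> n < (2 * real i + 3) * \<theta> n"
    using t sm unfolding assms(7,9) ac[OF assms(6)] ac[OF assms(8)] by (simp_all add: algebra_simps)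
  then have "2 * real i + 1 < 2 * real i' + 3" "2 * real i' + 1 < 2 * real i + 3"
    using theta_pos[OF n] by (simp_all only: mult_less_cancel_right_pos)
  then show ?thesis by linarith
qed

lemma coordinates:
  assumes N: "norm N = 1" "N \<bullet> e = 0" and w: "norm w = 1" "w \<bullet> N = cos \<beta>"
  shows "w \<bullet> p = cos \<beta> * (p \<bullet> N) + ((p \<bullet> cross3 N e) * (w \<bullet> cross3 N e) + (p \<bullet> e) * (w \<bullet> e))"
    and "(w \<bullet> cross3 N e)\<^sup>2 + (w \<bullet> e)\<^sup>2 = (sin \<beta>)\<^sup>2"
proof -
  note F = orthonormal_frame_inner[OF N(1) unit(1) N(2)]
  show "w \<bullet> p = cos \<beta> * (p \<bullet> N) + ((p \<bullet> cross3 N e) * (w \<bullet> cross3 N e) + (p \<bullet> e) * (w \<bullet> e))"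
    unfolding F[of w p] w(2) by (simp add: algebra_simps)
  have "1 = w \<bullet> w" using w(1) by (simp add: norm_eq_1)
  then show "(w \<bullet> cross3 N e)\<^sup>2 + (w \<bullet> e)\<^sup>2 = (sin \<beta>)\<^sup>2"
    using sin_squared_eq[of \<beta>] unfolding F[of w w] w(2) power2_eq_square by linarith
qed

lemma coordinates_eqI:
  assumes N: "norm N = 1" "N \<bullet> e = 0" and "w \<bullet> N = w' \<bullet> N" "w \<bullet> e = w' \<bullet> e" "w \<bullet> cross3 N e = w' \<bullet> cross3 N e"
  shows "w = w'"
proof -
  have "(w - w') \<bullet> (w - w') = 0"
    by (subst orthonormal_frame_inner[OF N(1) unit(1) N(2)]) (simp add: inner_diff_left assms(3-5))
  then show ?thesis by simp
qed

text \<open>The two points, for \<open>\<sigma>\<close> equal to \<open>1\<close> or \<open>- 1\<close>, where the circle of colatitude \<open>\<beta>\<close> about \<open>N\<close> meets the cut.\<close>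

definition endpoint :: "real ^ 3 \<Rightarrow> real \<Rightarrow> real \<Rightarrow> real ^ 3" where
  "endpoint N \<beta> \<sigma> = cos \<beta> *\<^sub>R N + (\<sigma> * sin \<beta>) *\<^sub>R cross3 N e"

lemma endpoint:
  assumes N: "norm N = 1" "N \<bullet> e = 0" and s: "\<sigma> * \<sigma> = 1"
  shows "norm (endpoint N \<beta> \<sigma>) = 1" "endpoint N \<beta> \<sigma> \<bullet> N = cos \<beta>" "endpoint N \<beta> \<sigma> \<bullet> e = 0"
    "endpoint N \<beta> \<sigma> \<bullet> p = cos \<beta> * (p \<bullet> N) + (p \<bullet> cross3 N e) * (\<sigma> * sin \<beta>)"
    "endpoint N \<beta> \<sigma> \<bullet> endpoint N \<beta> (- \<sigma>) = cos (2 * \<beta>)"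
proof -
  have NN: "N \<bullet> N = 1" using N(1) by (simp add: norm_eq_1)
  have "(norm (cross3 N e))\<^sup>2 = 1" using norm_cross_dot[of N e] N unit(1) by simp
  then have cc: "cross3 N e \<bullet> cross3 N e = 1" by (simp only: power2_norm_eq_inner)
  have o: "cross3 N e \<bullet> N = 0" "cross3 N e \<bullet> e = 0" "N \<bullet> cross3 N e = 0" by (simp_all add: dot_cross_self)
  show "endpoint N \<beta> \<sigma> \<bullet> N = cos \<beta>" "endpoint N \<beta> \<sigma> \<bullet> e = 0"
    by (simp_all add: endpoint_def inner_add_left o NN N)
  show "endpoint N \<beta> \<sigma> \<bullet> p = cos \<beta> * (p \<bullet> N) + (p \<bullet> cross3 N e) * (\<sigma> * sin \<beta>)"
    by (simp add: endpoint_def inner_add_right inner_commute[of _ p])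
  have gg: "endpoint N \<beta> \<sigma> \<bullet> endpoint N \<beta> \<tau> = (cos \<beta>)\<^sup>2 + (\<sigma> * \<tau>) * (sin \<beta>)\<^sup>2" for \<tau>
    by (simp add: endpoint_def inner_add_left inner_add_right o NN cc power2_eq_square)
  show "norm (endpoint N \<beta> \<sigma>) = 1" using gg[of \<sigma>] s by (simp add: norm_eq_1)
  show "endpoint N \<beta> \<sigma> \<bullet> endpoint N \<beta> (- \<sigma>) = cos (2 * \<beta>)"
    using gg[of "- \<sigma>"] s by (simp add: cos_double)
qed

text \<open>By convexity both end points of the far semicircle would lie in the cap of radius \<open>r\<close> about \<open>p\<close>, but
  their distance is at least \<open>2 * \<theta> n\<close>.\<close>

lemma no_two_far:
  assumes x: "norm x = 1" "x \<bullet> e < 0" "j < n" "x \<bullet> q = cos ((2 * real j + 1) * \<theta> n)" "x \<bullet> p = cos r"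
    and x': "norm x' = 1" "x' \<bullet> e < 0" "j' < n" "x' \<bullet> q = cos ((2 * real j' + 1) * \<theta> n)" "x' \<bullet> p = cos r"
  shows "x = x'"
proof (rule ccontr)
  assume "x \<noteq> x'"
  have jj: "j' = j" using same_index[of x' x q j' j] x x' unit by simp
  define \<beta> where "\<beta> = (2 * real j + 1) * \<theta> n"
  have x'q: "x' \<bullet> q = cos \<beta>" and xq: "x \<bullet> q = cos \<beta>" using x x' jj by (simp_all add: \<beta>_def)
  note c = coordinates[OF unit(3) orth(2) x(1) xq] and c' = coordinates[OF unit(3) orth(2) x'(1) x'q]
  have o: "\<theta> n \<le> \<beta>" "\<beta> \<le> pi - \<theta> n" using odd_theta_range[OF x(3)] by (simp_all add: \<beta>_def)
  have s: "0 \<le> sin \<beta>" using o theta_pos[OF n] by (intro sin_ge_zero) linarith+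
  have ne: "x \<bullet> cross3 q e \<noteq> x' \<bullet> cross3 q e"
  proof
    assume eq: "x \<bullet> cross3 q e = x' \<bullet> cross3 q e"
    then have "(x \<bullet> e)\<^sup>2 = (x' \<bullet> e)\<^sup>2" using c(2) c'(2) by simp
    then have "x \<bullet> e = x' \<bullet> e" using x(2) x'(2) by (simp add: power2_eq_iff)
    then show False using coordinates_eqI[OF unit(3) orth(2) _ _ eq] xq x'q \<open>x \<noteq> x'\<close> by simp
  qed
  define V where "V = cos r - cos \<beta> * (p \<bullet> q)"
  have V: "(p \<bullet> cross3 q e) * (x \<bullet> cross3 q e) + (p \<bullet> e) * (x \<bullet> e) = V"
    "(p \<bullet> cross3 q e) * (x' \<bullet> cross3 q e) + (p \<bullet> e) * (x' \<bullet> e) = V"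
    using c(1) c'(1) x(5) x'(5) by (simp_all add: V_def)
  note ends = lower_arc_functional_le_ends[OF s c(2) less_imp_le[OF x(2)] c'(2) less_imp_le[OF x'(2)] ne side V]
  have g: "cos r \<le> endpoint q \<beta> 1 \<bullet> p" "cos r \<le> endpoint q \<beta> (- 1) \<bullet> p"
    using ends endpoint(4)[OF unit(3) orth(2), of 1 \<beta>] endpoint(4)[OF unit(3) orth(2), of "-1" \<beta>]
    by (simp_all add: V_def)
  have "arccos (cos (2 * \<beta>)) \<le> 2 * r"
    using angle_le[OF endpoint(1)[OF unit(3) orth(2), of 1 \<beta>] endpoint(1)[OF unit(3) orth(2), of "- 1" \<beta>] g]
      endpoint(5)[OF unit(3) orth(2), of 1 \<beta>] by simp
  moreover have "2 * \<theta> n \<le> arccos (cos (2 * \<beta>))"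
  proof (cases "2 * \<beta> \<le> pi")
    case True
    then show ?thesis using o theta_pos[OF n] by (subst arccos_cos) linarith+
  next
    case False
    have "cos (2 * \<beta>) = cos (2 * pi - 2 * \<beta>)" by (simp add: cos_diff)
    moreover have "arccos (cos (2 * pi - 2 * \<beta>)) = 2 * pi - 2 * \<beta>"
      using False o theta_pos[OF n] by (intro arccos_cos) linarith+
    ultimately show ?thesis using o by simp
  qed
  ultimately show False using r by simp
qed

text \<open>From a far point move along its semicircle to the end point on the side of \<open>p\<close>. Both the component along
  \<open>e\<close> and the component along the cut improve the inner product with \<open>p\<close>, one of them strictly
  unless \<open>p\<close> is an axis of the circle, and then the radius \<open>r\<close> is too small to reach the circle.\<close>

lemma far_imp_endpoint:
  assumes x: "norm x = 1" "x \<bullet> e < 0" "j < n" "x \<bullet> q = cos ((2 * real j + 1) * \<theta> n)" "x \<bullet> p = cos r"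
  obtains g i where "norm g = 1" "g \<bullet> e = 0" "i < n" "g \<bullet> a = cos ((2 * real i + 1) * \<theta> n)" "cos r < g \<bullet> p"
proof -
  define \<beta> where "\<beta> = (2 * real j + 1) * \<theta> n"
  have xq: "x \<bullet> q = cos \<beta>" using x by (simp add: \<beta>_def)
  note c = coordinates[OF unit(3) orth(2) x(1) xq]
  have o: "\<theta> n \<le> \<beta>" "\<beta> \<le> pi - \<theta> n" using odd_theta_range[OF x(3)] by (simp_all add: \<beta>_def)
  have s: "0 \<le> sin \<beta>" using o theta_pos[OF n] by (intro sin_ge_zero) linarith+
  let ?c = "p \<bullet> cross3 q e" and ?y = "x \<bullet> cross3 q e"
  define \<sigma> :: real where "\<sigma> = (if 0 \<le> ?c then 1 else - 1)"
  have ss: "\<sigma> * \<sigma> = 1" "?c * \<sigma> = \<bar>?c\<bar>" by (auto simp: \<sigma>_def)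
  define g where "g = endpoint q \<beta> \<sigma>"
  note g = endpoint[OF unit(3) orth(2) ss(1), of \<beta>, folded g_def]
  have "?y\<^sup>2 < (sin \<beta>)\<^sup>2" using c(2) x(2) zero_less_power2[of "x \<bullet> e"] by linarith
  then have y: "\<bar>?y\<bar> < sin \<beta>" using s by (metis abs_of_nonneg abs_le_square_iff not_le)
  have gp: "g \<bullet> p = cos \<beta> * (p \<bullet> q) + \<bar>?c\<bar> * sin \<beta>" using g(4) ss(2) by (simp add: mult.assoc[symmetric])
  have cy: "?c * ?y \<le> \<bar>?c\<bar> * \<bar>?y\<bar>" using abs_ge_self[of "?c * ?y"] by (simp add: abs_mult)
  have "cos r < g \<bullet> p"
  proof (cases "?c = 0")
    case False
    then have "\<bar>?c\<bar> * \<bar>?y\<bar> < \<bar>?c\<bar> * sin \<beta>" using y by simp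
    moreover have "(p \<bullet> e) * (x \<bullet> e) \<le> 0" using side x(2) by (simp add: mult_nonneg_nonpos)
    ultimately show ?thesis using cy c(1) gp x(5) by linarith
  next
    case True
    have "p \<bullet> e \<noteq> 0"
    proof
      assume "p \<bullet> e = 0"
      then have "cos r = cos \<beta> * (p \<bullet> q)" using c(1) True x(5) by simp
      moreover have "\<bar>cos \<beta> * (p \<bullet> q)\<bar> \<le> \<bar>cos \<beta>\<bar> * 1"
        unfolding abs_mult using Cauchy_Schwarz_ineq2[of p q] unit by (intro mult_left_mono) auto
      ultimately show False using abs_cos_odd_less[OF x(3)] by (simp add: \<beta>_def)
    qed
    then have "(p \<bullet> e) * (x \<bullet> e) < 0" using side x(2) by (simp add: mult_pos_neg)
    then show ?thesis using c(1) gp x(5) True by simp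
  qed
  moreover obtain i where "i < n" "g \<bullet> a = cos ((2 * real i + 1) * \<theta> n)"
    using grid[OF g(1,3) x(3)] g(2) by (auto simp: \<beta>_def)
  ultimately show thesis using that g(1,3) by blast
qed

text \<open>A far point yields a grid point \<open>g\<close> strictly inside the small circle. It is an end point of the near
  semicircle through \<open>y\<close> and \<open>z\<close>. By concavity, however, the inner product with \<open>p\<close> at an end point is at most
  its common value at \<open>y\<close> and \<open>z\<close>.\<close>

lemma no_two_near_one_far:
  assumes x: "norm x = 1" "x \<bullet> e < 0" "j < n" "x \<bullet> q = cos ((2 * real j + 1) * \<theta> n)" "x \<bullet> p = cos r"
    and y: "norm y = 1" "0 \<le> y \<bullet> e" "i < n" "y \<bullet> a = cos ((2 * real i + 1) * \<theta> n)" "y \<bullet> p = cos r"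
    and z: "norm z = 1" "0 \<le> z \<bullet> e" "i' < n" "z \<bullet> a = cos ((2 * real i' + 1) * \<theta> n)" "z \<bullet> p = cos r"
  shows "y = z"
proof (rule ccontr)
  assume "y \<noteq> z"
  obtain g i2 where g: "norm g = 1" "g \<bullet> e = 0" "i2 < n" "g \<bullet> a = cos ((2 * real i2 + 1) * \<theta> n)" "cos r < g \<bullet> p"
    by (rule far_imp_endpoint[OF x])
  have ii: "i' = i" "i2 = i"
    using same_index[of z y a i' i] same_index[of g y a i2 i] y z g unit by auto
  define \<beta> where "\<beta> = (2 * real i + 1) * \<theta> n"
  have ya: "y \<bullet> a = cos \<beta>" and za: "z \<bullet> a = cos \<beta>" and ga: "g \<bullet> a = cos \<beta>"
    using y z g ii by (simp_all add: \<beta>_def)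
  note cy = coordinates[OF unit(2) orth(1) y(1) ya] and cz = coordinates[OF unit(2) orth(1) z(1) za]
    and cg = coordinates[OF unit(2) orth(1) g(1) ga]
  have o: "\<theta> n \<le> \<beta>" "\<beta> \<le> pi - \<theta> n" using odd_theta_range[OF y(3)] by (simp_all add: \<beta>_def)
  have s: "0 \<le> sin \<beta>" using o theta_pos[OF n] by (intro sin_ge_zero) linarith+
  have ne: "y \<bullet> cross3 a e \<noteq> z \<bullet> cross3 a e"
  proof
    assume eq: "y \<bullet> cross3 a e = z \<bullet> cross3 a e"
    then have "(y \<bullet> e)\<^sup>2 = (z \<bullet> e)\<^sup>2" using cy(2) cz(2) by simp
    then have "y \<bullet> e = z \<bullet> e" using y(2) z(2) by (rule power2_eq_imp_eq)
    then show False using coordinates_eqI[OF unit(2) orth(1) _ _ eq] ya za \<open>y \<noteq> z\<close> by simp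
  qed
  let ?c = "p \<bullet> cross3 a e"
  define V where "V = cos \<beta> * (p \<bullet> a) - cos r"
  have V: "(- ?c) * (y \<bullet> cross3 a e) + (p \<bullet> e) * (- (y \<bullet> e)) = V"
    "(- ?c) * (z \<bullet> cross3 a e) + (p \<bullet> e) * (- (z \<bullet> e)) = V"
    using cy(1) cz(1) y(5) z(5) by (simp_all add: V_def)
  \<comment> \<open>Concavity on the near side is convexity of the negated functional.\<close>
  have ends: "V \<le> - ((- ?c) * sin \<beta>)" "V \<le> (- ?c) * sin \<beta>"
    by (rule lower_arc_functional_le_ends[OF s, of "y \<bullet> cross3 a e" "- (y \<bullet> e)" "z \<bullet> cross3 a e" "- (z \<bullet> e)" "p \<bullet> e"];
        use cy(2) cz(2) y(2) z(2) ne side V in simp)+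
  have "(g \<bullet> cross3 a e)\<^sup>2 = (sin \<beta>)\<^sup>2" using cg(2) g(2) by simp
  then have "g \<bullet> cross3 a e = sin \<beta> \<or> g \<bullet> cross3 a e = - sin \<beta>" by (simp add: power2_eq_iff)
  then have "g \<bullet> p = cos \<beta> * (p \<bullet> a) + ?c * sin \<beta> \<or> g \<bullet> p = cos \<beta> * (p \<bullet> a) - ?c * sin \<beta>"
    using cg(1) g(2) by auto
  then show False using ends g(5) by (auto simp: V_def)
qed

text \<open>The three points lie on a single latitude, whose circumradius differs from that of the small circle.\<close>

lemma no_three_near:
  assumes x: "norm x = 1" "j < n" "x \<bullet> a = cos ((2 * real j + 1) * \<theta> n)" "x \<bullet> p = cos r"
    and y: "norm y = 1" "i < n" "y \<bullet> a = cos ((2 * real i + 1) * \<theta> n)" "y \<bullet> p = cos r"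
    and z: "norm z = 1" "i' < n" "z \<bullet> a = cos ((2 * real i' + 1) * \<theta> n)" "z \<bullet> p = cos r"
    and ne: "x \<noteq> y" "y \<noteq> z" "x \<noteq> z"
  shows False
proof -
  have ii: "i' = i" "j = i"
    using same_index[of z y a i' i] same_index[of x y a j i] x y z unit by auto
  define \<kappa> where "\<kappa> = cos ((2 * real i + 1) * \<theta> n)"
  have "circumradius x y z = ereal (sqrt (1 - (cos r)\<^sup>2))"
    by (rule circumradius_on_sphere[OF unit(4) x(1) y(1) z(1) ne x(4) y(4) z(4)])
  moreover have "circumradius x y z = ereal (sqrt (1 - \<kappa>\<^sup>2))"
    by (rule circumradius_on_sphere[OF unit(2) x(1) y(1) z(1) ne]) (use x y z ii in \<open>simp_all add: \<kappa>_def\<close>)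
  ultimately have "\<kappa>\<^sup>2 = (cos r)\<^sup>2" by simp
  moreover have "\<kappa>\<^sup>2 < (cos r)\<^sup>2"
  proof -
    have "\<bar>\<kappa>\<bar>\<^sup>2 < (cos r)\<^sup>2" using abs_cos_odd_less[OF y(2)] by (intro power_strict_mono) (auto simp: \<kappa>_def)
    then show ?thesis by simp
  qed
  ultimately show False by simp
qed

definition near :: "real ^ 3 \<Rightarrow> bool" where
  "near x \<longleftrightarrow> norm x = 1 \<and> 0 \<le> x \<bullet> e \<and> (\<exists>i<n. x \<bullet> a = cos ((2 * real i + 1) * \<theta> n))"
definition far :: "real ^ 3 \<Rightarrow> bool" where
  "far x \<longleftrightarrow> norm x = 1 \<and> x \<bullet> e \<le> 0 \<and> (\<exists>i<n. x \<bullet> q = cos ((2 * real i + 1) * \<theta> n))"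

lemma circle_meets_at_most_twice:
  assumes nf: "near x \<or> far x" "near y \<or> far y" "near z \<or> far z"
    and p: "x \<bullet> p = cos r" "y \<bullet> p = cos r" "z \<bullet> p = cos r" and ne: "x \<noteq> y" "y \<noteq> z" "x \<noteq> z"
  shows False
proof -
  \<comment> \<open>Points of the cut belong to both stacks and are counted as near.\<close>
  define sfar where "sfar w \<longleftrightarrow> norm w = 1 \<and> w \<bullet> e < 0 \<and> (\<exists>i<n. w \<bullet> q = cos ((2 * real i + 1) * \<theta> n))" for w
  have cl: "near w \<or> sfar w" if "near w \<or> far w" for w
    using that grid[of w] by (auto simp: near_def far_def sfar_def le_less)
  have ff: "u = w" if "sfar u" "sfar w" "u \<bullet> p = cos r" "w \<bullet> p = cos r" for u w
    using that no_two_far unfolding sfar_def by blast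
  have nnf: "u = w" if "sfar v" "near u" "near w" "v \<bullet> p = cos r" "u \<bullet> p = cos r" "w \<bullet> p = cos r" for u v w
    using that no_two_near_one_far unfolding sfar_def near_def by blast
  have nnn: "\<not> (near x \<and> near y \<and> near z)"
    using p ne no_three_near unfolding near_def by blast
  show False using cl[OF nf(1)] cl[OF nf(2)] cl[OF nf(3)] ff nnf nnn p ne by metis
qed

end

section \<open>Thickness of the glued curve and comparison of different rotations\<close>

lemma rot1_inner_axis3: "x \<bullet> rot1 \<alpha> (axis 3 1) = cos \<alpha> * x $ 3 - sin \<alpha> * x $ 2"
  by (simp add: inner_vec_def sum_3 axis_def)

lemma glued_circles_cases:
  assumes "x \<in> glued_circles n k"
  shows "norm x = 1 \<and> ((x $ 1 \<le> 0 \<and> (\<exists>i<n. x \<bullet> axis 3 1 = cos ((2 * real i + 1) * \<theta> n))) \<or>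
     (0 \<le> x $ 1 \<and> (\<exists>i<n. x \<bullet> rot1 (2 * real k * \<theta> n) (axis 3 1) = cos ((2 * real i + 1) * \<theta> n))))"
proof -
  from assms consider "x \<in> west" "x \<in> (\<Union>i<n. lat_circle n i)"
    | y where "y \<in> east" "y \<in> (\<Union>i<n. lat_circle n i)" "x = rot1 (2 * real k * \<theta> n) y"
    unfolding glued_circles_def by blast
  then show ?thesis
  proof cases
    case 1
    then obtain i where "i < n" "x \<in> lat_circle n i" by blast
    then show ?thesis using 1(1) by (auto simp: lat_circle_iff west_def inner_axis)
  next
    case 2
    then obtain i where i: "i < n" "y \<in> lat_circle n i" by blast
    have "x \<bullet> rot1 (2 * real k * \<theta> n) (axis 3 1) = y $ 3" unfolding 2(3) rot1_inner by (simp add: inner_axis)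
    then show ?thesis using 2 i by (auto simp: lat_circle_iff east_def)
  qed
qed

lemma cos_odd_theta_shift:
  assumes "1 \<le> n" "cos w = cos ((2 * real j + 1) * \<theta> n)"
  shows "\<exists>i<n. cos (w + of_int (2 * m) * \<theta> n) = cos ((2 * real i + 1) * \<theta> n)"
proof -
  obtain q :: int where q: "w = (2 * real j + 1) * \<theta> n + 2 * of_int q * pi \<or> w = - ((2 * real j + 1) * \<theta> n) + 2 * of_int q * pi"
    using assms(2) unfolding cos_eq by (auto elim!: Ints_cases)
  have per: "2 * of_int q * pi = of_int (4 * int n * q) * \<theta> n"
    using assms(1) by (simp add: \<theta>_def)
  obtain J where J: "odd J" "w + of_int (2 * m) * \<theta> n = of_int J * \<theta> n"
  proof (cases "w = (2 * real j + 1) * \<theta> n + 2 * of_int q * pi")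
    case True
    then have "w + of_int (2 * m) * \<theta> n = of_int (2 * int j + 1 + 4 * int n * q + 2 * m) * \<theta> n"
      unfolding per by (simp add: algebra_simps)
    moreover have "odd (2 * int j + 1 + 4 * int n * q + 2 * m)" by simp
    ultimately show thesis using that by blast
  next
    case False
    then have "w + of_int (2 * m) * \<theta> n = of_int (- (2 * int j + 1) + 4 * int n * q + 2 * m) * \<theta> n"
      using q unfolding per by (simp add: algebra_simps)
    moreover have "odd (- (2 * int j + 1) + 4 * int n * q + 2 * m)" by simp
    ultimately show thesis using that by blast
  qed
  obtain i where "i < n" "cos (of_int J * \<theta> n) = cos ((2 * real i + 1) * \<theta> n)"
    by (rule cos_odd_theta_reduce[OF assms(1) J(1)])
  then show ?thesis unfolding J(2) by blast
qed

text \<open>On the great circle \<open>x $ 1 = 0\<close> the latitudes mark the odd multiples of \<open>\<theta> n\<close>, a set that is invariant under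
  rotation by even multiples.\<close>

lemma cut_circle_grid:
  assumes n: "1 \<le> n" and g: "norm g = 1" "g $ 1 = 0"
  shows "(\<exists>i<n. g \<bullet> axis 3 1 = cos ((2 * real i + 1) * \<theta> n)) \<longleftrightarrow>
     (\<exists>i<n. g \<bullet> rot1 (2 * real k * \<theta> n) (axis 3 1) = cos ((2 * real i + 1) * \<theta> n))"
proof -
  have "(g $ 3)\<^sup>2 + (- (g $ 2))\<^sup>2 = 1"
    using g unfolding norm_eq_1 inner_vec_def sum_3 by (simp add: power2_eq_square)
  then obtain w where w: "g $ 3 = cos w" "- (g $ 2) = sin w" using sincos_total_2pi by metis
  let ?\<alpha> = "2 * real k * \<theta> n"
  have 3: "g \<bullet> axis 3 1 = cos w" using w by (simp add: inner_axis)
  have "g $ 2 = - sin w" using w by simp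
  then have r: "g \<bullet> rot1 ?\<alpha> (axis 3 1) = cos (w - ?\<alpha>)"
    using w(1) by (simp add: rot1_inner_axis3 cos_diff algebra_simps)
  have "\<exists>i<n. cos (w - ?\<alpha>) = cos ((2 * real i + 1) * \<theta> n)" if "cos w = cos ((2 * real j + 1) * \<theta> n)" for j
    using cos_odd_theta_shift[OF n that, of "- int k"] by simp
  moreover have "\<exists>i<n. cos w = cos ((2 * real i + 1) * \<theta> n)" if "cos (w - ?\<alpha>) = cos ((2 * real j + 1) * \<theta> n)" for j
    using cos_odd_theta_shift[OF n that, of "int k"] by simp
  ultimately show ?thesis unfolding 3 r by blast
qed

text \<open>Three points lie on a circle of geodesic radius \<open>r\<close> and have circumradius \<open>sin r\<close>, and \<open>r < \<theta> n\<close> is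
  impossible. The sign of \<open>p $ 1\<close> decides which of the two stacks is on the side of \<open>p\<close>.\<close>

lemma thickness_glued_circles:
  assumes n: "1 \<le> n"
  shows "ereal (sin (\<theta> n)) \<le> thickness (glued_circles n k)"
  unfolding thickness_def
proof (rule Inf_greatest)
  fix \<rho> assume "\<rho> \<in> {circumradius x y z |x y z. x \<in> glued_circles n k \<and> y \<in> glued_circles n k \<and> z \<in> glued_circles n k
      \<and> x \<noteq> y \<and> y \<noteq> z \<and> x \<noteq> z}"
  then obtain x y z where \<rho>: "\<rho> = circumradius x y z"
    and mem: "x \<in> glued_circles n k" "y \<in> glued_circles n k" "z \<in> glued_circles n k"
    and ne: "x \<noteq> y" "y \<noteq> z" "x \<noteq> z" by blast
  note cases = mem[THEN glued_circles_cases]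
  have nrm: "norm x = 1" "norm y = 1" "norm z = 1" using cases by blast+
  obtain p \<kappa> where p: "norm p = 1" "0 \<le> \<kappa>" "x \<bullet> p = \<kappa>" "y \<bullet> p = \<kappa>" "z \<bullet> p = \<kappa>"
    by (rule three_points_on_circle[OF nrm ne])
  have \<rho>': "\<rho> = ereal (sqrt (1 - \<kappa>\<^sup>2))"
    unfolding \<rho> by (rule circumradius_on_sphere[OF p(1) nrm ne p(3-5)])
  have pole: "w = p" if "norm w = 1" "w \<bullet> p = 1" for w
  proof -
    have "(w - p) \<bullet> (w - p) = 0"
      using that p(1) by (simp add: norm_eq_1 inner_diff_left inner_diff_right inner_commute)
    then show ?thesis by simp
  qed
  have k1: "\<kappa> \<le> 1" using norm_cauchy_schwarz[of x p] nrm p by simp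
  have "\<kappa> \<noteq> 1" using pole[OF nrm(1)] pole[OF nrm(2)] p ne(1) by auto
  then have k: "0 \<le> \<kappa>" "\<kappa> < 1" using k1 p(2) by simp_all
  define r where "r = arccos \<kappa>"
  have cr: "cos r = \<kappa>" and r: "0 < r" "r \<le> pi / 2"
    using k arccos_lt_bounded[of \<kappa>] arccos_le_pi2[of \<kappa>] by (auto simp: r_def)
  have sr: "sin r = sqrt (1 - \<kappa>\<^sup>2)" using k by (simp add: r_def sin_arccos)
  have th: "0 < \<theta> n" "\<theta> n \<le> pi / 2" using n by (simp_all add: \<theta>_def field_simps)
  have "\<theta> n \<le> r"
  proof (rule ccontr)
    assume "\<not> \<theta> n \<le> r"
    then have rt: "r < \<theta> n" by simp
    let ?e = "axis 1 1 :: real ^ 3" and ?a = "axis 3 1 :: real ^ 3"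
    let ?q = "rot1 (2 * real k * \<theta> n) ?a"
    have e: "w \<bullet> ?e = w $ 1" "w \<bullet> (- ?e) = - (w $ 1)" for w by (simp_all add: inner_axis)
    have o: "?a $ 1 = 0" "?q $ 1 = 0" by (simp_all add: axis_def)
    have nq: "norm ?q = 1" by simp
    show False
    proof (cases "0 \<le> p $ 1")
      case True
      interpret two_stacks n ?e ?q ?a p r
        by unfold_locales (use n p(1) nq o True r rt cut_circle_grid[OF n, of _ k] in \<open>auto simp: e simp del: rot1_nth\<close>)
      have "near w \<or> far w" if "w \<in> glued_circles n k" for w
        using glued_circles_cases[OF that] by (auto simp: near_def far_def e)
      from circle_meets_at_most_twice[OF this[OF mem(1)] this[OF mem(2)] this[OF mem(3)]]
      show False using p cr ne by simp
    next
      case False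
      interpret two_stacks n "- ?e" ?a ?q p r
        by unfold_locales (use n p(1) nq o False r rt cut_circle_grid[OF n, of _ k] in \<open>auto simp: e simp del: rot1_nth\<close>)
      have "near w \<or> far w" if "w \<in> glued_circles n k" for w
        using glued_circles_cases[OF that] by (auto simp: near_def far_def e)
      from circle_meets_at_most_twice[OF this[OF mem(1)] this[OF mem(2)] this[OF mem(3)]]
      show False using p cr ne by simp
    qed
  qed
  then have "sin (\<theta> n) \<le> sin r" using th r by (intro sin_monotone_2pi_le) auto
  then show "ereal (sin (\<theta> n)) \<le> \<rho>" by (simp add: \<rho>' sr)
qed

text \<open>The easternmost point of the first latitude about one axis has as height over the other axis
  the product \<open>cos (2 * d * \<theta> n) * cos (\<theta> n)\<close>. By the addition theorem this lies strictly between the heights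
  \<open>cos ((2 * d + 1) * \<theta> n)\<close> and \<open>cos ((2 * d - 1) * \<theta> n)\<close> of two neighbouring latitudes.\<close>

lemma glued_circles_neq:
  assumes kk: "k < n" "k' < n" "k \<noteq> k'"
  shows "glued_circles n k \<noteq> glued_circles n k'"
proof
  assume eq: "glued_circles n k = glued_circles n k'"
  have n: "1 \<le> n" using kk by simp
  have th: "0 < \<theta> n" using theta_pos[OF n] .
  have s0: "0 < sin (\<theta> n)" using odd_theta_range[of 0 n] th kk by (intro sin_gt_zero) auto
  define y :: "real ^ 3" where "y = vector [sin (\<theta> n), 0, cos (\<theta> n)]"
  have y: "y $ 1 = sin (\<theta> n)" "y $ 2 = 0" "y $ 3 = cos (\<theta> n)" by (simp_all add: y_def)
  have ny: "norm y = 1" by (simp add: norm_eq_1 inner_vec_def sum_3 y flip: power2_eq_square)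
  then have "y \<in> lat_circle n 0" using kk(1) by (simp add: lat_circle_iff y)
  moreover have "y \<in> east" using s0 ny by (simp add: east_def y)
  ultimately have "rot1 (2 * real k * \<theta> n) y \<in> glued_circles n k"
    unfolding glued_circles_def using kk(1) by (intro UnI2 imageI IntI UN_I[of 0]) simp_all
  then have "rot1 (2 * real k * \<theta> n) y \<in> glued_circles n k'" by (simp only: eq)
  then obtain i where i: "i < n" "rot1 (2 * real k * \<theta> n) y \<bullet> rot1 (2 * real k' * \<theta> n) (axis 3 1) = cos ((2 * real i + 1) * \<theta> n)"
    using glued_circles_cases[of "rot1 (2 * real k * \<theta> n) y" n k'] s0 by (auto simp: y(1))
  define d where "d = nat \<bar>int k - int k'\<bar>"
  have d: "0 < d" "d < n" "real d = \<bar>real k - real k'\<bar>" using kk by (auto simp: d_def)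
  have "rot1 (2 * real k * \<theta> n) y \<bullet> rot1 (2 * real k' * \<theta> n) (axis 3 1) = cos (2 * real k * \<theta> n - 2 * real k' * \<theta> n) * cos (\<theta> n)"
    by (simp add: rot1_inner_axis3 y cos_diff algebra_simps)
  also have "cos (2 * real k * \<theta> n - 2 * real k' * \<theta> n) = cos \<bar>2 * real k * \<theta> n - 2 * real k' * \<theta> n\<bar>" by simp
  also have "\<bar>2 * real k * \<theta> n - 2 * real k' * \<theta> n\<bar> = 2 * real d * \<theta> n"
  proof -
    have "2 * real k * \<theta> n - 2 * real k' * \<theta> n = 2 * \<theta> n * (real k - real k')"
      by (simp add: algebra_simps)
    then have "\<bar>2 * real k * \<theta> n - 2 * real k' * \<theta> n\<bar> = \<bar>2 * \<theta> n\<bar> * \<bar>real k - real k'\<bar>"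
      by (simp only: abs_mult)
    then show ?thesis using th d(3) by simp
  qed
  finally have c: "cos (2 * real d * \<theta> n) * cos (\<theta> n) = cos ((2 * real i + 1) * \<theta> n)" using i(2) by simp
  have "2 * real d * \<theta> n < pi" using d(2) n by (simp add: \<theta>_def field_simps)
  then have "0 < sin (2 * real d * \<theta> n)" using d(1) th by (intro sin_gt_zero) auto
  then have pos: "0 < sin (2 * real d * \<theta> n) * sin (\<theta> n)" using s0 by simp
  have "cos ((2 * real d + 1) * \<theta> n) = cos (2 * real d * \<theta> n + \<theta> n)"
    "cos ((2 * real (d - 1) + 1) * \<theta> n) = cos (2 * real d * \<theta> n - \<theta> n)"
    using d(1) by (simp_all add: algebra_simps of_nat_diff)
  then have "cos ((2 * real d + 1) * \<theta> n) < cos ((2 * real i + 1) * \<theta> n)"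
    "cos ((2 * real i + 1) * \<theta> n) < cos ((2 * real (d - 1) + 1) * \<theta> n)"
    using pos by (simp_all add: cos_add cos_diff c)
  moreover have "cos ((2 * real j + 1) * \<theta> n) < cos ((2 * real l + 1) * \<theta> n) \<Longrightarrow> l < j" if "j < n" "l < n" for j l
  proof -
    assume a: "cos ((2 * real j + 1) * \<theta> n) < cos ((2 * real l + 1) * \<theta> n)"
    have "(2 * real l + 1) * \<theta> n < (2 * real j + 1) * \<theta> n"
      using a odd_theta_range[OF that(1)] odd_theta_range[OF that(2)] th by (subst (asm) cos_mono_less_eq) linarith+
    then show "l < j" using th by simp
  qed
  ultimately have "i < d" "d - 1 < i" using d(2) i(1) by auto
  then show False by simp
qed

theorem theorem2p1:
  fixes n :: nat
  assumes "n \<ge> 1"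
  shows "(\<forall>k<n. gcd k n = 1 \<longrightarrow>
            (\<exists>g. range g = glued_circles n k \<and> piecewise_circular g \<and>
                 solves_P (sin (\<theta> n)) g))
       \<and> inj_on (glued_circles n) {k. k < n \<and> gcd k n = 1}
       \<and> card (glued_circles n ` {k. k < n \<and> gcd k n = 1}) = totient n"
proof (intro conjI allI impI)
  fix k assume "k < n" and cop: "gcd k n = 1"
  interpret coprime_gluing n k by unfold_locales (use assms cop in auto)
  have th: "0 < \<theta> n" "\<theta> n \<le> pi / 2" using assms by (simp_all add: \<theta>_def field_simps)
  have "solves_P (sin (\<theta> n)) rope"
    unfolding solves_P_def admissible_def[of _ rope]
    using closed_curve_rope thickness_glued_circles[OF assms, of k] admissible_length_le[OF _ th]
    by (simp add: range_rope curve_length_rope)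
  then show "\<exists>g. range g = glued_circles n k \<and> piecewise_circular g \<and> solves_P (sin (\<theta> n)) g"
    using range_rope piecewise_circular_rope by blast
next
  show inj: "inj_on (glued_circles n) {k. k < n \<and> gcd k n = 1}"
    using glued_circles_neq by (auto simp: inj_on_def)
  have "card {k. k < n \<and> gcd k n = 1} = totient n"
  \<comment> \<open>The residue coprime to \<open>1\<close> is represented by \<open>0\<close> here and by \<open>1\<close> in the definition of \<open>totient\<close>.\<close>
  proof (cases "n = 1")
    case True
    then have "{k. k < n \<and> gcd k n = 1} = {0}" by auto
    then show ?thesis using True by simp
  next
    case False
    have "k \<noteq> 0 \<and> k \<noteq> n" if "gcd k n = 1" for k
      using that False by (metis gcd_0_left_nat gcd_idem_nat)
    then have "{k. k < n \<and> gcd k n = 1} = totatives n"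
      by (auto simp: totatives_def coprime_iff_gcd_eq_1 le_less simp flip: One_nat_def)
    then show ?thesis by (simp add: totient_def)
  qed
  then show "card (glued_circles n ` {k. k < n \<and> gcd k n = 1}) = totient n"
    by (simp only: card_image[OF inj])
qed

end
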